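(* Let $d\ge 1$, let $\mathtt{A}$ be a finite set, let $X\subset \mathtt{A}^{\mathbb{Z}^d}$ be a shift space and let $\Phi\in\mathbb{B}$ be an absolutely summable potential on $X$. (1) If $X$ satisfies the decoupling condition and $\nu\in M_1(X,T)$ is a tangent functional to the pressure at $\varphi_\Phi$, then $\nu$ is a weak Gibbs measure for $\psi=\varphi_\Phi-P(\varphi_\Phi)$. (2) If $d=1$, $X$ satisfies the $1$-decoupling condition, and $$\|\Phi\|':=\sum_{\substack{A\subset \mathbb{Z}\setminus[-1,1]\\ A\cap(-\infty,-1)\neq\emptyset,\ A\cap(1,\infty)\neq\emptyset}}\|\Phi_A\|_\infty<\infty$$ (sum over finite sets $A$), then again every $\nu\in M_1(X,T)$ which is a tangent functional to the pressure at $\varphi_\Phi$ is a weak Gibbs measure for $\psi=\varphi_\Phi-P(\varphi_\Phi)$.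
   Context: Let $L=\mathbb{Z}^d$ and let $\mathtt{A}$ be a finite set with the discrete topology; $\mathtt{A}^L$ has the product topology. $L$ acts by $(T^jx)(k):=x(k+j)$. A shift space $X\subset\mathtt{A}^L$ is a closed subset invariant under all $T^j$. $C(X)$ is the space of real continuous functions with sup-norm $\|\cdot\|_\infty$; $M_1(X)$ is the set of Borel probability measures on $X$, $M_1(X,T)$ the subset of $T$-invariant ones. $\Lambda_m:=\{i\in L:\max_k|i_k|\le m\}$; $\Lambda^c:=L\setminus\Lambda$; $J_\Lambda(x):=(x(k):k\in\Lambda)$ is the restriction to $\Lambda$; $X_n:=J_{\Lambda_n}(X)$. For $d=1$, $[a,b]$, $(-\infty,a)$, $(a,\infty)$ denote intervals of integers. Potentials: an absolutely summable potential is a family $\Phi=\{\Phi_A\}$ of continuous functions $\Phi_A:X\to\mathbb{R}$ indexed by the (nonempty) finite subsets $A\subset L$ such that $\Phi_A(x)=\Phi_A(y)$ whenever $J_A(x)=J_A(y)$, $\Phi_A\circ T^a=\Phi_{A+a}$ for all $a\in L$, and $\|\Phi\|:=\sum_{A\ni 0}\|\Phi_A\|_\infty<\infty$. The set of these, with norm $\|\cdot\|$, is the Banach space $\mathbb{B}$. Put $\varphi_\Phi:=\sum_{A\ni0}\Phi_A/|A|\in C(X)$. Pressure: $P(\psi)$, for $\psi\in C(X)$, is the usual topological pressure of the $\mathbb{Z}^d$-action $T$ on $X$, $P(\psi)=\lim_{n\to\infty}\frac1{|\Lambda_n|}\ln\sum_{u\in X_n}\sup\{\exp\sum_{k\in\Lambda_n}\psi(T^kx):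 x\in X, J_{\Lambda_n}(x)=u\}$. A measure $\nu\in M_1(X,T)$ is a tangent functional to the pressure at $\varphi\in C(X)$ if $P(\varphi+f)\ge P(\varphi)+\int f\,d\nu$ for all $f\in C(X)$ (equivalently, in this setting, $\nu$ is an equilibrium measure for $\varphi$). Weak Gibbs: let $B_m(x):=\{y\in X: J_{\Lambda_m}(y)=J_{\Lambda_m}(x)\}$. A measure $\nu\in M_1(X)$ is a weak Gibbs measure for $\psi\in C(X)$ if for every $\delta>0$ there is $N_\delta$ such that for all $m\ge N_\delta$ $$\sup_{x\in X}\Big|\frac1{|\Lambda_m|}\ln\nu(B_m(x))-\frac1{|\Lambda_m|}\sum_{j\in\Lambda_m}\psi(T^jx)\Big|\le\delta .$$ Decoupling condition for $X\subset\mathtt{A}^{\mathbb{Z}^d}$: there is a function $q:\mathbb{N}\to\mathbb{N}$, written $q_m$, with $\lim_m q_m/m=0$, such that for all $m\in\mathbb{N}$ and $x,y\in X$ there exist $z\in X$ and $\ell\in\Lambda_{q_m}$ with $J_{\Lambda_m}(T^{-\ell}z)=J_{\Lambda_m}(y)$ and $J_{\Lambda_{m+q_m}^c}(z)=J_{\Lambda_{m+q_m}^c}(x)$. $1$-decoupling condition for $X\subset\mathtt{A}^{\mathbb{Z}}$: there is a function $\bar q:\mathbb{N}\to\mathbb{N}$, written $\bar q_m$, with $\lim_m\bar q_m/m=0$, such that for all $m\in\mathbb{N}$ and $x^-,y,x^+\in X$ there exist integers $\ell^-,\ell^+$ with $|\ell^-|,|\ell^+|\le\bar q_m$ and $z\in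 X$ with $J_{[-m,m]}(z)=J_{[-m,m]}(y)$, $J_{(-\infty,-m-\bar q_m)}(z)=J_{(-\infty,-m-\bar q_m)}(T^{-\ell^-}x^-)$ and $J_{(m+\bar q_m,\infty)}(z)=J_{(m+\bar q_m,\infty)}(T^{-\ell^+}x^+)$. *)

theory Defs
  imports "HOL-Analysis.Analysis" "HOL-Probability.Probability"
begin

text \<open>
  The lattice \<open>L\<close> is \<open>int ^ 'd\<close>, so \<open>d = CARD('d)\<close>. The alphabet is a finite set of elements of a
  type carrying the discrete topology; configurations then carry the product topology through the
  type class instance for functions. A function in \<open>C(X)\<close> is a total function that is continuous on
  \<open>X\<close>; its values off \<open>X\<close> are never used.
\<close>

type_synonym ('d, 'a) config = "(int, 'd) vec \<Rightarrow> 'a"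

definition shift :: "int ^ 'd \<Rightarrow> ('d, 'a) config \<Rightarrow> ('d, 'a) config"
  where "shift j x = (\<lambda>k. x (k + j))"

definition shift_space :: "'a set \<Rightarrow> ('d::finite, 'a::discrete_topology) config set \<Rightarrow> bool"
  where "shift_space \<A> X \<longleftrightarrow>
    X \<subseteq> (UNIV \<rightarrow> \<A>) \<and> closed X \<and> (\<forall>j. shift j ` X \<subseteq> X)"

definition cube :: "nat \<Rightarrow> (int ^ 'd) set"
  where "cube m = {i. \<forall>k. \<bar>i $ k\<bar> \<le> int m}"

definition sup_norm_on :: "'x set \<Rightarrow> ('x \<Rightarrow> real) \<Rightarrow> real"
  where "sup_norm_on X f = (SUP x\<in>X. \<bar>f x\<bar>)"

definition M1 :: "('d::finite, 'a::discrete_topology) config set \<Rightarrow> ('d, 'a) config measure set"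
  where "M1 X = {\<nu>. prob_space \<nu> \<and> sets \<nu> = sets (restrict_space borel X)}"

definition M1T :: "('d::finite, 'a::discrete_topology) config set \<Rightarrow> ('d, 'a) config measure set"
  where "M1T X = {\<nu> \<in> M1 X. \<forall>j. \<forall>E\<in>sets \<nu>. measure \<nu> (shift j -` E \<inter> X) = measure \<nu> E}"

text \<open>A potential is only constrained, and only used, on nonempty finite index sets.\<close>

definition potentials ::
  "('d::finite, 'a::discrete_topology) config set \<Rightarrow> ((int ^ 'd) set \<Rightarrow> ('d, 'a) config \<Rightarrow> real) set"
  where "potentials X = {\<Phi>.
    (\<forall>A. finite A \<and> A \<noteq> {} \<longrightarrow>
      continuous_on X (\<Phi> A) \<and>
      (\<forall>x\<in>X. \<forall>y\<in>X. restrict x A = restrict y A \<longrightarrow> \<Phi> A x = \<Phi> A y) \<and>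
      (\<forall>a. \<forall>x\<in>X. \<Phi> A (shift a x) = \<Phi> ((\<lambda>k. k + a) ` A) x)) \<and>
    (\<lambda>A. sup_norm_on X (\<Phi> A)) summable_on {A. finite A \<and> 0 \<in> A}}"

definition energy :: "((int ^ 'd) set \<Rightarrow> ('d, 'a) config \<Rightarrow> real) \<Rightarrow> ('d, 'a) config \<Rightarrow> real"
  where "energy \<Phi> x = (\<Sum>\<^sub>\<infinity>A\<in>{A. finite A \<and> 0 \<in> A}. \<Phi> A x / real (card A))"

definition partition_sum ::
  "('d::finite, 'a) config set \<Rightarrow> (('d, 'a) config \<Rightarrow> real) \<Rightarrow> nat \<Rightarrow> real"
  where "partition_sum X \<psi> n =
    (\<Sum>u\<in>(\<lambda>x. restrict x (cube n)) ` X.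
      SUP x\<in>{x \<in> X. restrict x (cube n) = u}. exp (\<Sum>k\<in>cube n. \<psi> (shift k x)))"

definition pressure :: "('d::finite, 'a) config set \<Rightarrow> (('d, 'a) config \<Rightarrow> real) \<Rightarrow> real"
  where "pressure X \<psi> =
    lim (\<lambda>n. 1 / real (card (cube n :: (int ^ 'd) set)) * ln (partition_sum X \<psi> n))"

definition tangent_functional ::
  "('d::finite, 'a::discrete_topology) config set \<Rightarrow> (('d, 'a) config \<Rightarrow> real) \<Rightarrow>
    ('d, 'a) config measure \<Rightarrow> bool"
  where "tangent_functional X \<phi> \<nu> \<longleftrightarrow>
    (\<forall>f. continuous_on X f \<longrightarrow>
      pressure X (\<lambda>x. \<phi> x + f x) \<ge> pressure X \<phi> + (\<integral>x. f x \<partial>\<nu>))"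

definition cylinder ::
  "('d::finite, 'a) config set \<Rightarrow> nat \<Rightarrow> ('d, 'a) config \<Rightarrow> ('d, 'a) config set"
  where "cylinder X m x = {y \<in> X. restrict y (cube m) = restrict x (cube m)}"

text \<open>
  Since \<open>ln 0 = 0\<close> in HOL, positivity of the cylinder measure is stated separately; with the usual
  \<open>ln 0 = -\<infinity>\<close> it is part of the finiteness of the supremum over \<open>x\<close>.
\<close>

definition weak_Gibbs ::
  "('d::finite, 'a::discrete_topology) config set \<Rightarrow> (('d, 'a) config \<Rightarrow> real) \<Rightarrow>
    ('d, 'a) config measure \<Rightarrow> bool"
  where "weak_Gibbs X \<psi> \<nu> \<longleftrightarrow> \<nu> \<in> M1 X \<and>
    (\<forall>\<delta>>0. \<exists>N. \<forall>m\<ge>N. \<forall>x\<in>X.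
      measure \<nu> (cylinder X m x) > 0 \<and>
      \<bar>1 / real (card (cube m :: (int ^ 'd) set)) * ln (measure \<nu> (cylinder X m x))
        - 1 / real (card (cube m :: (int ^ 'd) set)) * (\<Sum>j\<in>cube m. \<psi> (shift j x))\<bar> \<le> \<delta>)"

definition decoupling :: "('d::finite, 'a) config set \<Rightarrow> bool"
  where "decoupling X \<longleftrightarrow>
    (\<exists>q::nat \<Rightarrow> nat. (\<lambda>m. real (q m) / real m) \<longlonglongrightarrow> 0 \<and>
      (\<forall>m. \<forall>x\<in>X. \<forall>y\<in>X. \<exists>z\<in>X. \<exists>l\<in>cube (q m).
        restrict (shift (- l) z) (cube m) = restrict y (cube m) \<and>
        restrict z (- cube (m + q m)) = restrict x (- cube (m + q m))))"

text \<open>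
  The remaining definitions are meant for \<open>CARD('d) = 1\<close>, where \<open>sites S\<close> is the set \<open>S\<close> of
  integers under the identification \<open>vec\<close> of \<open>int\<close> with \<open>int ^ 'd\<close>.
\<close>

definition sites :: "int set \<Rightarrow> (int ^ 'd) set"
  where "sites S = {k. \<forall>i. k $ i \<in> S}"

definition one_decoupling :: "('d::finite, 'a) config set \<Rightarrow> bool"
  where "one_decoupling X \<longleftrightarrow>
    (\<exists>q::nat \<Rightarrow> nat. (\<lambda>m. real (q m) / real m) \<longlonglongrightarrow> 0 \<and>
      (\<forall>m. \<forall>xm\<in>X. \<forall>y\<in>X. \<forall>xp\<in>X. \<exists>lm lp :: int.
        \<bar>lm\<bar> \<le> int (q m) \<and> \<bar>lp\<bar> \<le> int (q m) \<and>
        (\<exists>z\<in>X.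
          restrict z (sites {- int m..int m}) = restrict y (sites {- int m..int m}) \<and>
          restrict z (sites {..<- int m - int (q m)}) =
            restrict (shift (vec (- lm)) xm) (sites {..<- int m - int (q m)}) \<and>
          restrict z (sites {int m + int (q m)<..}) =
            restrict (shift (vec (- lp)) xp) (sites {int m + int (q m)<..}))))"

definition straddling_summable ::
  "('d::finite, 'a) config set \<Rightarrow> ((int ^ 'd) set \<Rightarrow> ('d, 'a) config \<Rightarrow> real) \<Rightarrow> bool"
  where "straddling_summable X \<Phi> \<longleftrightarrow>
    (\<lambda>A. sup_norm_on X (\<Phi> A)) summable_on
      {A. finite A \<and> A \<subseteq> - sites {-1..1} \<and> A \<inter> sites {..<-1} \<noteq> {} \<and> A \<inter> sites {1<..} \<noteq> {}}"

end

theory Submission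
  imports Defs
begin

text \<open>
  Write \<open>S\<^sub>\<Lambda> \<psi>\<close> for the sum of \<open>\<psi> \<circ> T\<^sup>k\<close> over \<open>k \<in> \<Lambda>\<close>. Testing the tangent property on
  \<open>t f\<close>, where \<open>f\<close> is the indicator of a cylinder \<open>B\<^sub>m(x)\<close> and \<open>t\<close> is a tiny positive or negative
  number depending only on \<open>m\<close> and \<open>x\<close>, Jensen's inequality in \<open>cube n\<close> bounds \<open>\<nu>(B\<^sub>m(x))\<close> above and
  below by the asymptotic frequency of \<open>B\<^sub>m(x)\<close> under the finite-volume Gibbs weights
  \<open>exp (S\<^sub>n (\<phi> + t f))\<close>. To estimate this frequency, fix a window \<open>k + cube m\<close>. By decoupling, any
  outside configuration can be spliced with any word in the window, at the price of forgetting
  only \<open>exp (o(|cube m|))\<close> many possibilities and of an energy error \<open>o(|cube m|)\<close>, the latter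
  because the interactions crossing the boundary of a cube are \<open>o(|cube m|)\<close> for an absolutely
  summable potential (and those crossing a one-dimensional window from side to side are bounded
  in total when \<open>\<parallel>\<Phi>\<parallel>' < \<infinity>\<close>). Hence the partition function of \<open>cube n\<close> factorizes over the window and its
  complement up to \<open>exp (o(|cube m|))\<close>, and the window sees the word of \<open>x\<close> with frequency
  \<open>exp (S\<^sub>m \<phi>(x) - |cube m| P(\<phi>) + o(|cube m|))\<close>.
\<close>

section \<open>Finite-volume partition functions\<close>

text \<open>Convexity bounds an increment of finite-volume log partition functions by the slope at
  the perturbed end, so the frequency of the cylinder has to be estimated under the weights of
  \<phi> + t f rather than \<phi>. The obstacle is that t |cube n| is unbounded. What stays small is
  the effect of t on a single splice: its coefficient depends on m, but not on n or on the window,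
  so t can be fixed before n to make this effect as small as desired. For this reason the error
  bounds are uniform over finite volumes inside possibly infinite sets (the outside of a cube,
  half-lines), and one comparison principle serves \<phi> and the indicator alike. A second obstacle
  is that decoupling may displace the word. The lower bound then controls only the sum of
  frequencies over all displacements in \<open>cube r\<close>; summing over the windows counts a
  site at most |cube r| times, which costs ln |cube r| = o(|cube m|). The two signs of t bound every
  tangent functional, whether or not it is unique.\<close>

definition birkhoff ::
  "(('d, 'a) config \<Rightarrow> real) \<Rightarrow> (int ^ 'd) set \<Rightarrow> ('d, 'a) config \<Rightarrow> real"
  where "birkhoff \<psi> \<Lambda> x = (\<Sum>k\<in>\<Lambda>. \<psi> (shift k x))"

definition words :: "('d, 'a) config set \<Rightarrow> (int ^ 'd) set \<Rightarrow> ('d, 'a) config set"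
  where "words X \<Lambda> = (\<lambda>x. restrict x \<Lambda>) ` X"

text \<open>Volumes other than cubes are needed because a cube with a window removed is no longer a
  cube.\<close>

definition partition_function ::
  "('d, 'a) config set \<Rightarrow> (('d, 'a) config \<Rightarrow> real) \<Rightarrow> (int ^ 'd) set \<Rightarrow> real"
  where "partition_function X \<psi> \<Lambda> =
    (\<Sum>u\<in>words X \<Lambda>. SUP x\<in>{x \<in> X. restrict x \<Lambda> = u}. exp (birkhoff \<psi> \<Lambda> x))"

text \<open>Turns suprema into values: \<xi> extends a word on \<Lambda> to a configuration that
  attains the supremum in \<open>partition_function\<close>. Partition functions become finite sums
  over words, which injections between sets of words can compare.\<close>

definition maximizer ::
  "('d, 'a) config set \<Rightarrow> (('d, 'a) config \<Rightarrow> real) \<Rightarrow> (int ^ 'd) set \<Rightarrow>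
    (('d, 'a) config \<Rightarrow> ('d, 'a) config) \<Rightarrow> bool"
  where "maximizer X \<psi> \<Lambda> \<xi> \<longleftrightarrow> (\<forall>x\<in>X. \<xi> (restrict x \<Lambda>) \<in> X \<and>
    restrict (\<xi> (restrict x \<Lambda>)) \<Lambda> = restrict x \<Lambda> \<and>
    birkhoff \<psi> \<Lambda> x \<le> birkhoff \<psi> \<Lambda> (\<xi> (restrict x \<Lambda>)))"

lemma restrict_eq_iff: "restrict x S = restrict y S \<longleftrightarrow> (\<forall>k\<in>S. x k = y k)"
  by (auto simp: fun_eq_iff restrict_def)

lemma shift_shift: "shift i (shift j x) = shift (i + j) x"
  by (simp add: shift_def add.assoc)

lemma shift_0 [simp]: "shift 0 x = x"
  by (simp add: shift_def)

lemma birkhoff_shift: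
  "birkhoff \<psi> \<Lambda> (shift j x) = birkhoff \<psi> ((\<lambda>k. k + j) ` \<Lambda>) x"
  unfolding birkhoff_def
  by (subst sum.reindex) (auto simp: shift_shift)

lemma birkhoff_Un:
  assumes "finite \<Lambda>" "finite \<Lambda>'" "\<Lambda> \<inter> \<Lambda>' = {}"
  shows "birkhoff \<psi> (\<Lambda> \<union> \<Lambda>') x = birkhoff \<psi> \<Lambda> x + birkhoff \<psi> \<Lambda>' x"
  unfolding birkhoff_def using assms by (simp add: sum.union_disjoint)

lemma birkhoff_Diff:
  assumes "finite \<Lambda>" "\<Lambda>' \<subseteq> \<Lambda>"
  shows "birkhoff \<psi> \<Lambda> x = birkhoff \<psi> (\<Lambda> - \<Lambda>') x + birkhoff \<psi> \<Lambda>' x"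
  unfolding birkhoff_def using sum.subset_diff[OF assms(2,1)] .

lemma birkhoff_add_mult:
  "birkhoff (\<lambda>x. \<phi> x + t * f x) \<Lambda> x = birkhoff \<phi> \<Lambda> x + t * birkhoff f \<Lambda> x"
  unfolding birkhoff_def by (simp add: sum.distrib sum_distrib_left)

lemma partition_sum_eq_partition_function: "partition_sum X \<psi> n = partition_function X \<psi> (cube n)"
  by (simp add: partition_sum_def partition_function_def words_def birkhoff_def)

section \<open>Cubes as products of intervals, and their size\<close>

lemma cube_image_PiE: "cube m = vec_lambda ` (UNIV \<rightarrow>\<^sub>E {- int m..int m})"
proof -
  have "i \<in> vec_lambda ` (UNIV \<rightarrow>\<^sub>E {- int m..int m})" if "i \<in> cube m" for i
    by (rule image_eqI[of _ _ "vec_nth i"]) (use that in \<open>auto simp: cube_def abs_le_iff minus_le_iff\<close>)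
  then show ?thesis by (auto simp: cube_def PiE_def Pi_def abs_le_iff minus_le_iff)
qed

lemma finite_cube [simp]: "finite (cube m)"
  unfolding cube_image_PiE by (intro finite_imageI finite_PiE) auto

lemma card_cube: "card (cube m :: (int ^ 'd) set) = (2 * m + 1) ^ CARD('d)"
proof -
  have "card (cube m :: (int ^ 'd) set) = card ((UNIV :: 'd set) \<rightarrow>\<^sub>E {- int m..int m})"
    unfolding cube_image_PiE by (rule card_image) (auto simp: inj_on_def vec_lambda_inject)
  also have "... = (2 * m + 1) ^ CARD('d)"
    by (simp add: card_PiE nat_add_distrib nat_mult_distrib)
  finally show ?thesis .
qed

lemma card_cube_pos [simp]: "card (cube m :: (int ^ 'd) set) > 0"
  by (simp add: card_cube)

lemma cube_0 [simp]: "cube 0 = {0}"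
  by (auto simp: cube_def vec_eq_iff)

lemma cube_nonempty [simp]: "cube m \<noteq> {}"
  by (auto simp: cube_def intro!: exI[of _ 0])

lemma cube_mono: "m \<le> n \<Longrightarrow> cube m \<subseteq> cube n"
  unfolding cube_def by (auto intro: order_trans)

lemma minus_mem_cube [simp]: "- i \<in> cube m \<longleftrightarrow> i \<in> cube m"
  by (simp add: cube_def)

text \<open>The form in which partition functions are compared: words are encoded injectively so
  that no weight decreases.\<close>

lemma sum_le_sum_inj_on:
  fixes f :: "'b \<Rightarrow> real"
  assumes "finite B" "inj_on h A" "h ` A \<subseteq> B"
    and "\<And>a. a \<in> A \<Longrightarrow> f a \<le> g (h a)" and "\<And>b. b \<in> B \<Longrightarrow> 0 \<le> g b"
  shows "sum f A \<le> sum g B"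
proof -
  have "sum f A \<le> sum (g \<circ> h) A" using assms(4) by (intro sum_mono) auto
  also have "... = sum g (h ` A)" using assms(2) by (simp add: sum.reindex)
  also have "... \<le> sum g B" using assms by (intro sum_mono2) auto
  finally show ?thesis .
qed

locale finite_shift =
  fixes \<A> :: "'a::discrete_topology set" and X :: "('d::finite, 'a) config set"
  assumes finite_alphabet: "finite \<A>" and shift_space: "shift_space \<A> X" and nonempty: "X \<noteq> {}"
begin

lemma shift_mem: "x \<in> X \<Longrightarrow> shift j x \<in> X"
  using shift_space by (simp add: shift_space_def image_subset_iff)

lemma mem_alphabet: "x \<in> X \<Longrightarrow> x k \<in> \<A>"
  using shift_space by (auto simp: shift_space_def)

section \<open>Compactness of the shift space and clopen cylinders\<close>

lemma compact_X: "compact X"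
proof -
  have "compact (UNIV \<rightarrow>\<^sub>E \<A> :: ('d, 'a) config set)"
    using finite_alphabet
    by (simp add: compactin_PiE finite_imp_compactin flip: compactin_euclidean_iff euclidean_product_topology)
  moreover have "X = (UNIV \<rightarrow>\<^sub>E \<A>) \<inter> X" "closed X"
    using shift_space by (auto simp: shift_space_def)
  ultimately show ?thesis by (metis compact_Int_closed)
qed

lemma continuous_on_shift: "continuous_on S (shift j :: ('d, 'a) config \<Rightarrow> _)"
  unfolding shift_def
  by (intro continuous_on_coordinatewise_then_product
      continuous_on_subset[OF continuous_on_product_coordinates]) auto

lemma continuous_on_shift_comp: "continuous_on X f \<Longrightarrow> continuous_on X (\<lambda>x. f (shift j x))"
  by (rule continuous_on_compose2[OF _ continuous_on_shift]) (auto simp: shift_mem)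

lemma continuous_on_birkhoff: "continuous_on X f \<Longrightarrow> continuous_on X (birkhoff f \<Lambda>)"
  unfolding birkhoff_def by (intro continuous_on_sum continuous_on_shift_comp)

lemma clopen_coordinate: "open {x :: ('d, 'a) config. x k \<in> S}" "closed {x :: ('d, 'a) config. x k \<in> S}"
proof -
  have *: "open {x :: ('d, 'a) config. x k \<in> S}" for S
  proof -
    have "open ((\<lambda>x :: ('d, 'a) config. x k) -` S)"
      by (rule open_vimage[OF Topological_Spaces.open_discrete continuous_on_product_coordinates])
    then show ?thesis by (simp add: vimage_def)
  qed
  show "open {x :: ('d, 'a) config. x k \<in> S}" by (rule *)
  show "closed {x :: ('d, 'a) config. x k \<in> S}"
    unfolding closed_def using *[of "- S"] by (simp add: Collect_neg_eq[symmetric])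
qed

text \<open>The alphabet is discrete and only finitely many coordinates matter. Closedness gives
  attained suprema, openness gives measurability, and both together give continuity of cylinder
  indicators.\<close>

lemma clopen_agree:
  assumes "finite \<Lambda>"
  shows "open {y :: ('d, 'a) config. \<forall>k\<in>\<Lambda>. y k = x k}" "closed {y :: ('d, 'a) config. \<forall>k\<in>\<Lambda>. y k = x k}"
proof -
  have "{y :: ('d, 'a) config. \<forall>k\<in>\<Lambda>. y k = x k} = (\<Inter>k\<in>\<Lambda>. {y. y k \<in> {x k}})" by auto
  then show "open {y :: ('d, 'a) config. \<forall>k\<in>\<Lambda>. y k = x k}"
      "closed {y :: ('d, 'a) config. \<forall>k\<in>\<Lambda>. y k = x k}"
    using assms by (simp_all only:) (intro open_INT closed_INT ballI clopen_coordinate assms)+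
qed

lemma finite_words: "finite \<Lambda> \<Longrightarrow> finite (words X \<Lambda>)"
  by (rule finite_subset[of _ "\<Lambda> \<rightarrow>\<^sub>E \<A>"])
     (auto simp: words_def mem_alphabet finite_alphabet intro: finite_PiE)

lemma card_words_le: "finite \<Lambda> \<Longrightarrow> card (words X \<Lambda>) \<le> card \<A> ^ card \<Lambda>"
  using card_mono[of "\<Lambda> \<rightarrow>\<^sub>E \<A>" "words X \<Lambda>"]
  by (force simp: words_def mem_alphabet finite_alphabet card_PiE intro!: finite_PiE)

lemma words_nonempty: "words X \<Lambda> \<noteq> {}"
  using nonempty by (simp add: words_def)

lemma bounded_continuous:
  assumes "continuous_on X f"
  obtains C :: real where "C > 0" "\<And>x. x \<in> X \<Longrightarrow> \<bar>f x\<bar> \<le> C"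
proof -
  have "bounded (f ` X)"
    using assms compact_X compact_continuous_image compact_imp_bounded by blast
  then obtain C where "C > 0" "\<forall>x\<in>X. \<bar>f x\<bar> \<le> C" by (auto simp: bounded_pos)
  then show thesis using that by blast
qed

section \<open>Attained suprema and partition functions as sums over words\<close>

lemma attains_on_cylinder:
  assumes "finite \<Lambda>" "continuous_on X \<psi>" "x \<in> X"
  shows "\<exists>y\<in>X. restrict y \<Lambda> = restrict x \<Lambda> \<and>
    (\<forall>z\<in>X. restrict z \<Lambda> = restrict x \<Lambda> \<longrightarrow> birkhoff \<psi> \<Lambda> z \<le> birkhoff \<psi> \<Lambda> y)"
proof -
  have eq: "{y \<in> X. restrict y \<Lambda> = restrict x \<Lambda>} = X \<inter> {y. \<forall>k\<in>\<Lambda>. y k = x k}"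
    by (auto simp: restrict_eq_iff)
  have "compact {y \<in> X. restrict y \<Lambda> = restrict x \<Lambda>}"
    unfolding eq by (intro compact_Int_closed compact_X clopen_agree assms)
  moreover have "continuous_on {y \<in> X. restrict y \<Lambda> = restrict x \<Lambda>} (birkhoff \<psi> \<Lambda>)"
    by (rule continuous_on_subset[OF continuous_on_birkhoff[OF assms(2)]]) auto
  moreover have "{y \<in> X. restrict y \<Lambda> = restrict x \<Lambda>} \<noteq> {}" using assms(3) by auto
  ultimately have "\<exists>y\<in>{y \<in> X. restrict y \<Lambda> = restrict x \<Lambda>}.
      \<forall>z\<in>{y \<in> X. restrict y \<Lambda> = restrict x \<Lambda>}. birkhoff \<psi> \<Lambda> z \<le> birkhoff \<psi> \<Lambda> y"
    by (intro continuous_attains_sup)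
  then show ?thesis by fast
qed

lemma maximizer_exists:
  assumes "finite \<Lambda>" "continuous_on X \<psi>"
  shows "\<exists>\<xi>. maximizer X \<psi> \<Lambda> \<xi>"
proof -
  have "\<forall>u\<in>words X \<Lambda>. \<exists>y. y \<in> X \<and> restrict y \<Lambda> = u \<and>
    (\<forall>z\<in>X. restrict z \<Lambda> = u \<longrightarrow> birkhoff \<psi> \<Lambda> z \<le> birkhoff \<psi> \<Lambda> y)"
    using attains_on_cylinder[OF assms] unfolding words_def by fast
  then obtain \<xi> where "\<forall>u\<in>words X \<Lambda>. \<xi> u \<in> X \<and> restrict (\<xi> u) \<Lambda> = u \<and>
    (\<forall>z\<in>X. restrict z \<Lambda> = u \<longrightarrow> birkhoff \<psi> \<Lambda> z \<le> birkhoff \<psi> \<Lambda> (\<xi> u))"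
    unfolding bchoice_iff by blast
  then show ?thesis unfolding maximizer_def words_def by blast
qed

lemma maximizerD:
  assumes "maximizer X \<psi> \<Lambda> \<xi>"
  shows "u \<in> words X \<Lambda> \<Longrightarrow> \<xi> u \<in> X" "u \<in> words X \<Lambda> \<Longrightarrow> restrict (\<xi> u) \<Lambda> = u"
    "x \<in> X \<Longrightarrow> birkhoff \<psi> \<Lambda> x \<le> birkhoff \<psi> \<Lambda> (\<xi> (restrict x \<Lambda>))"
  using assms by (auto simp: maximizer_def words_def)

lemma partition_function_maximizer:
  assumes "maximizer X \<psi> \<Lambda> \<xi>"
  shows "partition_function X \<psi> \<Lambda> = (\<Sum>u\<in>words X \<Lambda>. exp (birkhoff \<psi> \<Lambda> (\<xi> u)))"
  unfolding partition_function_def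
proof (intro sum.cong refl)
  fix u assume u: "u \<in> words X \<Lambda>"
  show "(SUP x\<in>{x \<in> X. restrict x \<Lambda> = u}. exp (birkhoff \<psi> \<Lambda> x)) = exp (birkhoff \<psi> \<Lambda> (\<xi> u))"
    by (rule cSup_eq_maximum) (use u maximizerD[OF assms] in auto)
qed

lemma partition_function_pos: "finite \<Lambda> \<Longrightarrow> continuous_on X \<psi> \<Longrightarrow> partition_function X \<psi> \<Lambda> > 0"
  using maximizer_exists[of \<Lambda> \<psi>] finite_words[of \<Lambda>] words_nonempty[of \<Lambda>]
  by (auto simp: partition_function_maximizer intro!: sum_pos)

section \<open>Submultiplicativity and translation invariance of partition functions\<close>

lemma restrict_mem_words: "x \<in> X \<Longrightarrow> restrict x \<Lambda> \<in> words X \<Lambda>"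
  by (simp add: words_def)

text \<open>A word on the union is determined by its two restrictions, and its sum over each piece
  is at most that of the piece's own maximizer. Two words need not occur together, so in general
  there is no equality; splicing later supplies a converse up to errors.\<close>

lemma partition_function_Un_le:
  assumes "finite \<Lambda>" "finite \<Lambda>'" "\<Lambda> \<inter> \<Lambda>' = {}" "continuous_on X \<psi>"
  shows "partition_function X \<psi> (\<Lambda> \<union> \<Lambda>') \<le> partition_function X \<psi> \<Lambda> * partition_function X \<psi> \<Lambda>'"
proof -
  obtain \<xi> \<xi>1 \<xi>2 where m: "maximizer X \<psi> (\<Lambda> \<union> \<Lambda>') \<xi>" "maximizer X \<psi> \<Lambda> \<xi>1" "maximizer X \<psi> \<Lambda>' \<xi>2"
    using maximizer_exists assms by (meson finite_UnI)
  let ?h = "\<lambda>u. (restrict (\<xi> u) \<Lambda>, restrict (\<xi> u) \<Lambda>')"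
  let ?g = "\<lambda>p. exp (birkhoff \<psi> \<Lambda> (\<xi>1 (fst p))) * exp (birkhoff \<psi> \<Lambda>' (\<xi>2 (snd p)))"
  have "(\<Sum>u\<in>words X (\<Lambda> \<union> \<Lambda>'). exp (birkhoff \<psi> (\<Lambda> \<union> \<Lambda>') (\<xi> u))) \<le> sum ?g (words X \<Lambda> \<times> words X \<Lambda>')"
  proof (rule sum_le_sum_inj_on[where h = ?h])
    show "inj_on ?h (words X (\<Lambda> \<union> \<Lambda>'))"
    proof (rule inj_onI)
      fix u v assume uv: "u \<in> words X (\<Lambda> \<union> \<Lambda>')" "v \<in> words X (\<Lambda> \<union> \<Lambda>')" "?h u = ?h v"
      then have "restrict (\<xi> u) (\<Lambda> \<union> \<Lambda>') = restrict (\<xi> v) (\<Lambda> \<union> \<Lambda>')"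
        by (auto simp: restrict_eq_iff)
      then show "u = v" using maximizerD(2)[OF m(1)] uv by metis
    qed
  qed (use assms m maximizerD[OF m(1)] maximizerD(3)[OF m(2)] maximizerD(3)[OF m(3)] in
      \<open>auto simp: finite_words restrict_mem_words birkhoff_Un exp_add[symmetric] intro!: add_mono\<close>)
  then show ?thesis
    by (simp add: partition_function_maximizer[OF m(1)] partition_function_maximizer[OF m(2)] partition_function_maximizer[OF m(3)]
        sum_product sum.cartesian_product split_beta)
qed

text \<open>Shifting by \<open>j\<close> turns words on the translate into words on \<Lambda> and
  preserves the sums. The opposite inequality is the same fact for \<open>- j\<close>.\<close>

lemma partition_function_translate_le:
  assumes "finite \<Lambda>" "continuous_on X \<psi>"
  shows "partition_function X \<psi> ((\<lambda>k. k + j) ` \<Lambda>) \<le> partition_function X \<psi> \<Lambda>"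
proof -
  let ?M = "(\<lambda>k. k + j) ` \<Lambda>"
  obtain \<xi> \<xi>1 where m: "maximizer X \<psi> ?M \<xi>" "maximizer X \<psi> \<Lambda> \<xi>1"
    using maximizer_exists assms by (meson finite_imageI)
  let ?h = "\<lambda>u. restrict (shift j (\<xi> u)) \<Lambda>"
  have "(\<Sum>u\<in>words X ?M. exp (birkhoff \<psi> ?M (\<xi> u))) \<le> (\<Sum>u\<in>words X \<Lambda>. exp (birkhoff \<psi> \<Lambda> (\<xi>1 u)))"
  proof (rule sum_le_sum_inj_on[where h = ?h])
    show "inj_on ?h (words X ?M)"
    proof (rule inj_onI)
      fix u v assume uv: "u \<in> words X ?M" "v \<in> words X ?M" "?h u = ?h v"
      then have "restrict (\<xi> u) ?M = restrict (\<xi> v) ?M"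
        by (auto simp: restrict_eq_iff shift_def)
      then show "u = v" using maximizerD(2)[OF m(1)] uv by metis
    qed
  qed (use assms m maximizerD[OF m(1)] maximizerD(3)[OF m(2)] in
      \<open>auto simp: finite_words restrict_mem_words birkhoff_shift[symmetric] shift_mem\<close>)
  then show ?thesis
    by (simp add: partition_function_maximizer[OF m(1)] partition_function_maximizer[OF m(2)])
qed

lemma partition_function_translate:
  assumes "finite \<Lambda>" "continuous_on X \<psi>"
  shows "partition_function X \<psi> ((\<lambda>k. k + j) ` \<Lambda>) = partition_function X \<psi> \<Lambda>"
proof (rule antisym[OF partition_function_translate_le[OF assms]])
  have "(\<lambda>k. k + - j) ` (\<lambda>k. k + j) ` \<Lambda> = \<Lambda>" by (simp add: image_image)
  then show "partition_function X \<psi> \<Lambda> \<le> partition_function X \<psi> ((\<lambda>k. k + j) ` \<Lambda>)"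
    using partition_function_translate_le[of "(\<lambda>k. k + j) ` \<Lambda>" \<psi> "- j"] assms by simp
qed

lemma partition_function_empty [simp]: "partition_function X \<psi> {} = 1"
proof -
  have "words X {} = {\<lambda>_. undefined}" using nonempty by (auto simp: words_def restrict_def)
  moreover have "{x \<in> X. restrict x {} = (\<lambda>_. undefined)} = X" by (auto simp: restrict_def)
  ultimately show ?thesis using nonempty by (simp add: partition_function_def birkhoff_def)
qed

lemma partition_function_tiles_le:
  assumes "finite F" "finite \<Lambda>" "continuous_on X \<psi>"
    and "\<And>i j. i \<in> F \<Longrightarrow> j \<in> F \<Longrightarrow> i \<noteq> j \<Longrightarrow> (\<lambda>k. k + i) ` \<Lambda> \<inter> (\<lambda>k. k + j) ` \<Lambda> = {}"
  shows "partition_function X \<psi> (\<Union>i\<in>F. (\<lambda>k. k + i) ` \<Lambda>) \<le> partition_function X \<psi> \<Lambda> ^ card F"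
  using assms(1,4)
proof (induction F rule: finite_induct)
  case (insert i F)
  have "partition_function X \<psi> (\<Union>j\<in>insert i F. (\<lambda>k. k + j) ` \<Lambda>)
      \<le> partition_function X \<psi> ((\<lambda>k. k + i) ` \<Lambda>) * partition_function X \<psi> (\<Union>j\<in>F. (\<lambda>k. k + j) ` \<Lambda>)"
    using partition_function_Un_le[of "(\<lambda>k. k + i) ` \<Lambda>" "\<Union>j\<in>F. (\<lambda>k. k + j) ` \<Lambda>" \<psi>] assms(2,3) insert by fastforce
  also have "... \<le> partition_function X \<psi> \<Lambda> * partition_function X \<psi> \<Lambda> ^ card F"
    using insert assms by (intro mult_mono) (auto simp: partition_function_translate less_imp_le[OF partition_function_pos])
  finally show ?case using insert by simp
qed auto

lemma partition_function_le_power: "finite \<Lambda> \<Longrightarrow> continuous_on X \<psi> \<Longrightarrow> partition_function X \<psi> \<Lambda> \<le> partition_function X \<psi> {0} ^ card \<Lambda>"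
  using partition_function_tiles_le[of \<Lambda> "{0}" \<psi>] by auto

end

section \<open>The pressure and its tangent functionals\<close>

text \<open>The volume ratio is a power of the ratio of side lengths, and the latter eventually
  differs from 1 by at most \<open>k n / n\<close>.\<close>

lemma cube_ratio_tendsto_1:
  fixes p k :: "nat \<Rightarrow> nat"
  assumes "(\<lambda>n. real (k n) / real n) \<longlonglongrightarrow> 0"
    and "\<forall>\<^sub>F n in sequentially. \<bar>real (p n) - real n\<bar> \<le> real (k n)"
  shows "(\<lambda>n. real (card (cube (p n) :: (int ^ 'd) set)) / real (card (cube n :: (int ^ 'd) set))) \<longlonglongrightarrow> 1"
proof -
  have "(\<lambda>n. real (2 * p n + 1) / real (2 * n + 1) - 1) \<longlonglongrightarrow> 0"
  proof (rule tendsto_rabs_zero_cancel, rule tendsto_sandwich[OF _ _ tendsto_const assms(1)])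
    show "\<forall>\<^sub>F n in sequentially. \<bar>real (2 * p n + 1) / real (2 * n + 1) - 1\<bar> \<le> real (k n) / real n"
      using assms(2) eventually_gt_at_top[of 0]
    proof eventually_elim
      case (elim n)
      have "real (2 * p n + 1) / real (2 * n + 1) - 1 = 2 * (real (p n) - real n) / (2 * real n + 1)"
        by (simp add: field_simps)
      also have "\<bar>...\<bar> \<le> 2 * real (k n) / (2 * real n + 1)"
        using elim by (simp add: abs_mult divide_right_mono)
      also have "... \<le> real (k n) / real n"
        using elim by (simp add: field_simps)
      finally show ?case .
    qed
  qed auto
  then have "(\<lambda>n. real (2 * p n + 1) / real (2 * n + 1)) \<longlonglongrightarrow> 1"
    using LIM_zero_iff by blast
  from tendsto_power[OF this, of "CARD('d)"] show ?thesis
    by (simp add: card_cube power_divide)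
qed

lemma const_over_n_tendsto_0: "(\<lambda>n. real k / real n) \<longlonglongrightarrow> 0"
  by (intro tendsto_divide_0[OF tendsto_const] filterlim_at_top_imp_at_infinity filterlim_real_sequentially)

text \<open>The analytic end of Fekete's argument: every \<open>b m\<close> is an asymptotic upper
  bound, so the limes superior is at most the infimum, which in turn lies below all terms. The
  division with remainder is hidden in \<open>g\<close>.\<close>

lemma tendsto_Inf_if_eventually_le:
  fixes b :: "nat \<Rightarrow> real"
  assumes "\<And>m. \<exists>g. g \<longlonglongrightarrow> b m \<and> (\<forall>\<^sub>F n in sequentially. b n \<le> g n)" "bdd_below (range b)"
  shows "b \<longlonglongrightarrow> Inf (range b)"
proof (rule order_tendstoI)
  fix a assume "a < Inf (range b)"
  then show "\<forall>\<^sub>F n in sequentially. a < b n"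
    using cInf_lower[OF _ assms(2)] by (intro always_eventually allI) (meson less_le_trans rangeI)
next
  fix a assume "Inf (range b) < a"
  then obtain m where "b m < a"
    using cInf_lessD[of "range b" a] by auto
  moreover obtain g where "g \<longlonglongrightarrow> b m" "\<forall>\<^sub>F n in sequentially. b n \<le> g n" using assms(1) by blast
  ultimately show "\<forall>\<^sub>F n in sequentially. b n < a"
    by (auto dest: order_tendstoD(2) elim: eventually_elim2)
qed

context finite_shift
begin

text \<open>Disjoint translates of \<open>cube m\<close> cover \<open>cube n\<close> up to a
  boundary layer. Submultiplicativity charges the partition function of \<open>cube m\<close> for
  each tile and that of \<open>{0}\<close> for each leftover site.\<close>

lemma ln_partition_function_tiles_le:
  assumes "continuous_on X \<psi>" and "m \<le> n"
  shows "\<exists>p. n \<le> p + 2 * m \<and> p \<le> n \<and>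
    ln (partition_function X \<psi> (cube n)) \<le> real (card (cube p :: (int ^ 'd) set)) / real (card (cube m :: (int ^ 'd) set)) *
      ln (partition_function X \<psi> (cube m)) + (real (card (cube n :: (int ^ 'd) set)) - real (card (cube p :: (int ^ 'd) set))) * ln (partition_function X \<psi> {0})"
proof -
  \<comment> \<open>\<open>M\<close> is the side length of a tile, and \<open>T\<close> is the
    largest number for which the tiles centred at \<open>M t\<close>, with \<open>t\<close> in
    \<open>cube T\<close>, stay inside \<open>cube n\<close>. Since 2p + 1 = (2T + 1) M, they have
    together as many sites as \<open>cube p\<close>.\<close>
  define M where "M = 2 * m + 1"
  define T where "T = (n - m) div M"
  define p where "p = T * M + m"
  let ?F = "(\<lambda>t :: int ^ 'd. int M *s t) ` cube T"
  let ?U = "\<Union>i\<in>?F. (\<lambda>k. k + i) ` cube m"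
  have TM: "T * M \<le> n - m" "n - m < T * M + M"
    using div_mult_mod_eq[of "n - m" M] mod_less_divisor[of M "n - m"]
    unfolding T_def by (auto simp: M_def simp del: mod_less_divisor)
  have p: "n \<le> p + 2 * m" "p \<le> n" using TM assms(2) by (auto simp: p_def M_def)
  have cp: "card (cube p :: (int ^ 'd) set) = card (cube T :: (int ^ 'd) set) * card (cube m :: (int ^ 'd) set)"
    by (simp add: card_cube p_def M_def algebra_simps flip: power_mult_distrib)
  have inj: "inj_on (\<lambda>t :: int ^ 'd. int M *s t) (cube T)"
  proof -
    have "int M \<noteq> 0" by (simp add: M_def)
    then show ?thesis by (auto simp: inj_on_def vec_eq_iff)
  qed
  then have cF: "card ?F = card (cube T :: (int ^ 'd) set)" by (rule card_image)
  have disj: "(\<lambda>k. k + i) ` cube m \<inter> (\<lambda>k. k + j) ` cube m = {}" if ij: "i \<in> ?F" "j \<in> ?F" "i \<noteq> j" for i j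
  proof (rule ccontr)
    assume "\<not> ?thesis"
    then obtain k l where kl: "k \<in> cube m" "l \<in> cube m" "k + i = l + j" by auto
    obtain s t where st: "i = int M *s s" "j = int M *s t" using ij by auto
    with ij obtain a where a: "s $ a \<noteq> t $ a" by (auto simp: vec_eq_iff)
    have "k $ a + int M * s $ a = l $ a + int M * t $ a"
      using kl(3) by (metis st vector_add_component vector_smult_component)
    then have eq: "int M * (s $ a - t $ a) = l $ a - k $ a" by (simp add: algebra_simps)
    have "\<bar>l $ a - k $ a\<bar> < int M" using kl(1,2) by (auto simp: cube_def M_def dest!: spec[of _ a])
    moreover have "int M * 1 \<le> int M * \<bar>s $ a - t $ a\<bar>" using a by (intro mult_left_mono) auto
    ultimately show False by (simp add: abs_mult flip: eq)
  qed
  have cU: "card ?U = card (cube p :: (int ^ 'd) set)"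
    by (subst card_UN_disjoint) (use disj in \<open>auto simp: card_image cp cF inj_on_def\<close>)
  have sub: "?U \<subseteq> cube n"
  proof clarify
    fix k t :: "int ^ 'd" assume kt: "k \<in> cube m" "t \<in> cube T"
    have "\<bar>k $ a + int M * t $ a\<bar> \<le> int n" for a
    proof -
      have "\<bar>k $ a\<bar> \<le> int m" "\<bar>t $ a\<bar> \<le> int T" using kt by (auto simp: cube_def)
      then have "\<bar>k $ a + int M * t $ a\<bar> \<le> int m + int M * int T"
        by (intro order_trans[OF abs_triangle_ineq] add_mono) (auto simp: abs_mult mult_left_mono)
      also have "... = int p" by (simp add: p_def)
      finally show ?thesis using p by simp
    qed
    then show "k + int M *s t \<in> cube n" by (simp add: cube_def)
  qed
  have pos: "0 < partition_function X \<psi> \<Lambda>" if "finite \<Lambda>" for \<Lambda> using partition_function_pos[OF that assms(1)] .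
  have "partition_function X \<psi> (cube n) = partition_function X \<psi> (?U \<union> (cube n - ?U))" using sub by (simp add: Un_absorb1)
  also have "... \<le> partition_function X \<psi> ?U * partition_function X \<psi> (cube n - ?U)"
    using assms by (intro partition_function_Un_le) auto
  also have "... \<le> partition_function X \<psi> (cube m) ^ card ?F * partition_function X \<psi> {0} ^ card (cube n - ?U)"
    using assms disj by (intro mult_mono partition_function_tiles_le partition_function_le_power) (auto intro!: less_imp_le[OF pos] zero_le_power)
  finally have "ln (partition_function X \<psi> (cube n)) \<le> ln (partition_function X \<psi> (cube m) ^ card ?F * partition_function X \<psi> {0} ^ card (cube n - ?U))"
    by (intro ln_mono pos) auto
  also have "... = real (card ?F) * ln (partition_function X \<psi> (cube m)) + real (card (cube n - ?U)) * ln (partition_function X \<psi> {0})"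
    using pos[of "cube m"] pos[of "{0}"] by (simp add: ln_mult ln_realpow)
  also have "real (card ?F) = real (card (cube p :: (int ^ 'd) set)) / real (card (cube m :: (int ^ 'd) set))"
    using less_imp_neq[OF card_cube_pos[of m, where 'd = 'd]] by (simp add: cF cp del: card_cube_pos)
  also have "real (card (cube n - ?U)) = real (card (cube n :: (int ^ 'd) set)) - real (card (cube p :: (int ^ 'd) set))"
  proof -
    have "card (cube n - ?U) = card (cube n :: (int ^ 'd) set) - card (cube p :: (int ^ 'd) set)"
      by (simp only: card_Diff_subset[OF finite_subset[OF sub finite_cube] sub] cU)
    moreover have "card (cube p :: (int ^ 'd) set) \<le> card (cube n :: (int ^ 'd) set)"
      using card_mono[OF finite_cube sub] by (simp only: cU)
    ultimately show ?thesis by (simp only: of_nat_diff)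
  qed
  finally show ?thesis using p by blast
qed

text \<open>One word already contributes at least exp (- C |\<Lambda>|). This is the lower bound on
  the normalised logarithms that Fekete's argument requires.\<close>

lemma ln_partition_function_ge:
  assumes "finite \<Lambda>" "continuous_on X \<psi>" "\<And>x. x \<in> X \<Longrightarrow> \<bar>\<psi> x\<bar> \<le> C"
  shows "- (C * real (card \<Lambda>)) \<le> ln (partition_function X \<psi> \<Lambda>)"
proof -
  obtain \<xi> where \<xi>: "maximizer X \<psi> \<Lambda> \<xi>" using maximizer_exists assms by blast
  obtain x where x: "x \<in> X" using nonempty by blast
  let ?u = "restrict x \<Lambda>"
  have "\<bar>birkhoff \<psi> \<Lambda> x\<bar> \<le> (\<Sum>k\<in>\<Lambda>. C)"
    unfolding birkhoff_def by (intro order_trans[OF sum_abs] sum_mono assms shift_mem x)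
  then have "- (C * real (card \<Lambda>)) \<le> birkhoff \<psi> \<Lambda> (\<xi> ?u)"
    using maximizerD(3)[OF \<xi> x] by (simp add: mult.commute)
  also have "exp (birkhoff \<psi> \<Lambda> (\<xi> ?u)) \<le> partition_function X \<psi> \<Lambda>"
    unfolding partition_function_maximizer[OF \<xi>]
    by (rule member_le_sum) (simp_all only: restrict_mem_words[OF x] finite_words[OF assms(1)] exp_ge_zero)
  then have "birkhoff \<psi> \<Lambda> (\<xi> ?u) \<le> ln (partition_function X \<psi> \<Lambda>)"
    by (simp add: ln_ge_iff partition_function_pos assms)
  finally show ?thesis .
qed

text \<open>The limit exists and is an infimum, so the \<open>lim\<close> in \<open>pressure\<close>
  has its intended value, and every finite cube compares with the pressure in one direction without
  any error term. The upper bound on cylinder measures relies on this exactness.\<close>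

proposition pressure_limit:
  assumes "continuous_on X \<psi>"
  shows "(\<lambda>n. ln (partition_function X \<psi> (cube n)) / real (card (cube n :: (int ^ 'd) set))) \<longlonglongrightarrow> pressure X \<psi>" (is ?lim)
    and "real (card (cube m :: (int ^ 'd) set)) * pressure X \<psi> \<le> ln (partition_function X \<psi> (cube m))"
proof -
  let ?c = "\<lambda>n. real (card (cube n :: (int ^ 'd) set))"
  define b where "b n = ln (partition_function X \<psi> (cube n)) / ?c n" for n
  have cpos: "?c n > 0" for n by simp
  obtain C where C: "\<And>x. x \<in> X \<Longrightarrow> \<bar>\<psi> x\<bar> \<le> C" using bounded_continuous[OF assms] by blast
  have bdd: "bdd_below (range b)"
    using ln_partition_function_ge[OF finite_cube assms C] cpos
    by (intro bdd_belowI2[of _ "- C"]) (simp add: b_def le_divide_eq)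
  have lim: "b \<longlonglongrightarrow> Inf (range b)"
  proof (rule tendsto_Inf_if_eventually_le[OF _ bdd])
    fix m
    obtain p where p: "\<And>n. m \<le> n \<Longrightarrow> n \<le> p n + 2 * m \<and> p n \<le> n \<and>
      ln (partition_function X \<psi> (cube n)) \<le> ?c (p n) / ?c m * ln (partition_function X \<psi> (cube m)) + (?c n - ?c (p n)) * ln (partition_function X \<psi> {0})"
      using ln_partition_function_tiles_le[OF assms, of m] by metis
    define g where "g n = ?c (p n) / ?c n * b m + (1 - ?c (p n) / ?c n) * ln (partition_function X \<psi> {0})" for n
    have "(\<lambda>n. ?c (p n) / ?c n) \<longlonglongrightarrow> 1"
      by (rule cube_ratio_tendsto_1[OF const_over_n_tendsto_0[of "2 * m"]])
         (use p in \<open>fastforce intro!: eventually_sequentiallyI[of m]\<close>)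
    then have "g \<longlonglongrightarrow> 1 * b m + (1 - 1) * ln (partition_function X \<psi> {0})"
      unfolding g_def by (intro tendsto_intros)
    moreover have "\<forall>\<^sub>F n in sequentially. b n \<le> g n"
    proof (rule eventually_sequentiallyI)
      fix n assume "m \<le> n"
      from p[OF this] have "b n \<le> (?c (p n) / ?c m * ln (partition_function X \<psi> (cube m)) + (?c n - ?c (p n)) * ln (partition_function X \<psi> {0})) / ?c n"
        unfolding b_def by (intro divide_right_mono) auto
      also have "... = g n" using less_imp_neq[OF cpos[of n]]
        by (simp add: g_def b_def add_divide_distrib diff_divide_distrib left_diff_distrib del: card_cube_pos)
      finally show "b n \<le> g n" .
    qed
    ultimately show "\<exists>g. g \<longlonglongrightarrow> b m \<and> (\<forall>\<^sub>F n in sequentially. b n \<le> g n)" by auto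
  qed
  have "pressure X \<psi> = Inf (range b)"
    unfolding pressure_def partition_sum_eq_partition_function using limI[OF lim] by (simp add: b_def[abs_def])
  then show ?lim "?c m * pressure X \<psi> \<le> ln (partition_function X \<psi> (cube m))"
    using lim cInf_lower[OF rangeI bdd, of m] cpos[of m]
    by (simp_all add: b_def[abs_def] le_divide_eq mult.commute)
qed

text \<open>Apply 1 + y \<le> exp y to y = K - t S, where S is the sum of \<open>f\<close> over
  \<Lambda>. By \<open>le\<close> the mean of y under the perturbed weights is nonnegative, and exp
  y times a perturbed weight is \<open>exp K\<close> times an unperturbed one. This is the bound of
  a convex increment by the slope at its far end.\<close>

lemma jensen_partition_function:
  assumes "finite \<Lambda>" "continuous_on X \<phi>" "continuous_on X f"
    and \<xi>: "maximizer X (\<lambda>x. \<phi> x + t * f x) \<Lambda> \<xi>"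
    and le: "t * (\<Sum>u\<in>words X \<Lambda>. exp (birkhoff (\<lambda>x. \<phi> x + t * f x) \<Lambda> (\<xi> u)) * birkhoff f \<Lambda> (\<xi> u))
      \<le> K * partition_function X (\<lambda>x. \<phi> x + t * f x) \<Lambda>"
  shows "ln (partition_function X (\<lambda>x. \<phi> x + t * f x) \<Lambda>) \<le> ln (partition_function X \<phi> \<Lambda>) + K"
proof -
  let ?\<psi> = "\<lambda>x. \<phi> x + t * f x"
  let ?W = "words X \<Lambda>"
  let ?w = "\<lambda>u. exp (birkhoff ?\<psi> \<Lambda> (\<xi> u))"
  let ?s = "\<lambda>u. t * birkhoff f \<Lambda> (\<xi> u)"
  have cont: "continuous_on X ?\<psi>" using assms by (intro continuous_intros)
  obtain \<xi>0 where \<xi>0: "maximizer X \<phi> \<Lambda> \<xi>0" using maximizer_exists assms by blast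
  have Z: "partition_function X ?\<psi> \<Lambda> = sum ?w ?W" by (rule partition_function_maximizer[OF \<xi>])
  have "exp (- K) * partition_function X ?\<psi> \<Lambda> \<le> exp (- K) * (\<Sum>u\<in>?W. ?w u * (1 + (K - ?s u)))"
    using le by (intro mult_left_mono)
      (simp_all add: Z sum.distrib sum_subtractf algebra_simps sum_distrib_left)
  also have "... \<le> exp (- K) * (\<Sum>u\<in>?W. ?w u * exp (K - ?s u))"
    by (intro mult_left_mono sum_mono) auto
  also have "... = (\<Sum>u\<in>?W. exp (birkhoff \<phi> \<Lambda> (\<xi> u)))"
    by (simp add: sum_distrib_left birkhoff_add_mult flip: exp_add)
  \<comment> \<open>\<open>\<xi>\<close> maximizes for the perturbed function only, so its sums of
    \<phi> have to be compared with those of \<open>\<xi>0\<close>.\<close>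
  also have "... \<le> (\<Sum>u\<in>?W. exp (birkhoff \<phi> \<Lambda> (\<xi>0 u)))"
    using maximizerD(3)[OF \<xi>0 maximizerD(1)[OF \<xi>]] maximizerD(2)[OF \<xi>] by (intro sum_mono) auto
  also have "... = partition_function X \<phi> \<Lambda>" by (rule partition_function_maximizer[OF \<xi>0, symmetric])
  finally have "ln (exp (- K) * partition_function X ?\<psi> \<Lambda>) \<le> ln (partition_function X \<phi> \<Lambda>)"
    by (intro ln_mono mult_pos_pos) (auto intro: partition_function_pos assms cont)
  then show ?thesis
    using partition_function_pos[OF assms(1) cont] by (simp add: ln_mult)
qed

text \<open>After division by the volume the finite-volume bounds pass to the pressures, and
  tangency tested on \<open>t * f\<close> turns them into a bound on the integral: from above for
  positive \<open>t\<close>, from below for negative \<open>t\<close>.\<close>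

proposition tangent_bound:
  assumes "continuous_on X \<phi>" "continuous_on X f" "tangent_functional X \<phi> \<nu>"
    and le: "\<forall>\<^sub>F n in sequentially. \<forall>\<xi>. maximizer X (\<lambda>x. \<phi> x + t * f x) (cube n) \<xi> \<longrightarrow>
      t * (\<Sum>u\<in>words X (cube n). exp (birkhoff (\<lambda>x. \<phi> x + t * f x) (cube n) (\<xi> u)) * birkhoff f (cube n) (\<xi> u))
      \<le> K n * partition_function X (\<lambda>x. \<phi> x + t * f x) (cube n)"
    and lim: "(\<lambda>n. K n / real (card (cube n :: (int ^ 'd) set))) \<longlonglongrightarrow> \<kappa>"
  shows "t * (\<integral>x. f x \<partial>\<nu>) \<le> \<kappa>"
proof -
  let ?c = "\<lambda>n. real (card (cube n :: (int ^ 'd) set))"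
  let ?\<psi> = "\<lambda>x. \<phi> x + t * f x"
  have cont: "continuous_on X ?\<psi>" using assms by (intro continuous_intros)
  have "pressure X ?\<psi> \<le> pressure X \<phi> + \<kappa>"
  proof (rule tendsto_le[OF _ tendsto_add[OF pressure_limit(1)[OF assms(1)] lim] pressure_limit(1)[OF cont]])
    show "\<forall>\<^sub>F n in sequentially. ln (partition_function X ?\<psi> (cube n)) / ?c n \<le> ln (partition_function X \<phi> (cube n)) / ?c n + K n / ?c n"
      using le
    proof eventually_elim
      case (elim n)
      obtain \<xi> where "maximizer X ?\<psi> (cube n) \<xi>" using maximizer_exists[OF finite_cube cont] by blast
      from jensen_partition_function[OF finite_cube assms(1,2) this] elim this
      have "ln (partition_function X ?\<psi> (cube n)) \<le> ln (partition_function X \<phi> (cube n)) + K n" by blast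
      then show ?case by (simp add: add_divide_distrib[symmetric] divide_right_mono)
    qed
  qed simp
  moreover have "continuous_on X (\<lambda>x. t * f x)" using assms(2) by (intro continuous_intros)
  then have "pressure X \<phi> + (\<integral>x. t * f x \<partial>\<nu>) \<le> pressure X ?\<psi>"
    using assms(3) unfolding tangent_functional_def by blast
  ultimately show ?thesis by simp
qed

end

section \<open>Splicing words into windows\<close>

text \<open>One \<open>b\<close> serves all finite \<Lambda> inside \<open>S\<close>. For infinite
  \<open>S\<close>, such as the outside of a cube or a half-line, this makes errors independent of
  the surrounding \<open>cube n\<close>.\<close>

definition agreement_bound ::
  "('d, 'a) config set \<Rightarrow> (('d, 'a) config \<Rightarrow> real) \<Rightarrow> (int ^ 'd) set \<Rightarrow> real \<Rightarrow> bool"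
  where "agreement_bound X g S b \<longleftrightarrow> (\<forall>x\<in>X. \<forall>y\<in>X. (\<forall>k\<in>S. x k = y k) \<longrightarrow>
    (\<forall>\<Lambda>. finite \<Lambda> \<and> \<Lambda> \<subseteq> S \<longrightarrow> \<bar>birkhoff g \<Lambda> x - birkhoff g \<Lambda> y\<bar> \<le> b))"

text \<open>
  \<open>Z w y\<close> carries the word of \<open>y\<close> near the window \<open>k + cube m\<close> and looks like \<open>w\<close> elsewhere, while
  \<open>lab w y\<close> is one of at most \<open>N\<close> labels recording what is lost (displacements, and letters of \<open>w\<close>
  near the window or the ends of \<open>cube n\<close>). The energy clause is required of every observable \<open>g\<close>,
  with constants not depending on it, because it is applied both to \<open>\<phi>\<close> and to the indicator
  perturbing it.
\<close>

definition splicing ::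
  "('d, 'a) config set \<Rightarrow> (int ^ 'd) set set \<Rightarrow> nat \<Rightarrow> nat \<Rightarrow> real \<Rightarrow> nat \<Rightarrow> nat \<Rightarrow> int ^ 'd \<Rightarrow> bool"
  where "splicing X \<S> m r c N n k \<longleftrightarrow>
    (\<exists>(Z :: ('d, 'a) config \<Rightarrow> ('d, 'a) config \<Rightarrow> ('d, 'a) config)
      (lab :: ('d, 'a) config \<Rightarrow> ('d, 'a) config \<Rightarrow> int \<times> int \<times> (int ^ 'd) \<times> ('d, 'a) config) L.
      finite L \<and> card L \<le> N \<and>
      (\<forall>w\<in>X. \<forall>y\<in>X. Z w y \<in> X \<and> lab w y \<in> L \<and> (\<exists>l\<in>cube r. \<forall>i\<in>cube m. Z w y (i + (k + l)) = y i)) \<and>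
      (\<forall>w\<in>X. \<forall>y\<in>X. \<forall>w'\<in>X. \<forall>y'\<in>X.
        lab w y = lab w' y' \<and> (\<forall>i\<in>cube n. Z w y i = Z w' y' i) \<longrightarrow>
        (\<forall>i\<in>cube n - (\<lambda>i. i + k) ` cube m. w i = w' i) \<and> (\<forall>i\<in>cube m. y i = y' i)) \<and>
      (\<forall>g b C. (\<forall>x\<in>X. \<bar>g x\<bar> \<le> C) \<and> (\<forall>S\<in>\<S>. agreement_bound X g S b) \<longrightarrow>
        (\<forall>w\<in>X. \<forall>y\<in>X. \<bar>birkhoff g (cube n) (Z w y) - birkhoff g (cube m) y
          - birkhoff g (cube n - (\<lambda>i. i + k) ` cube m) w\<bar> \<le> 4 * b + C * c)))"

lemma mem_cylinder_iff: "y \<in> cylinder X m x \<longleftrightarrow> y \<in> X \<and> (\<forall>i\<in>cube m. y i = x i)"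
  by (auto simp: cylinder_def restrict_eq_iff)

lemma cube_add_subset:
  assumes "\<forall>i. \<bar>k $ i\<bar> + int m \<le> int n" "j \<in> cube m"
  shows "j + k \<in> cube n" "k + j \<in> cube n"
proof -
  have "\<bar>j $ i + k $ i\<bar> \<le> int n" for i
    using spec[OF assms(1), of i] assms(2) abs_triangle_ineq[of "j $ i" "k $ i"]
    by (auto simp: cube_def dest!: spec[of _ i])
  then show "j + k \<in> cube n" "k + j \<in> cube n" by (auto simp: cube_def add.commute)
qed

context finite_shift
begin

text \<open>Below, \<open>\<psi>\<close> is the slightly perturbed \<open>\<phi>\<close> of the tangent inequality.\<close>

context
  fixes \<phi> \<psi> :: "('d, 'a) config \<Rightarrow> real" and \<S> :: "(int ^ 'd) set set"
    and m r N n :: nat and k :: "int ^ 'd" and E :: real and D :: "(int ^ 'd) set"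
    and Z :: "('d, 'a) config \<Rightarrow> ('d, 'a) config \<Rightarrow> ('d, 'a) config"
    and lab :: "('d, 'a) config \<Rightarrow> ('d, 'a) config \<Rightarrow> 'l" and L :: "'l set"
  assumes cont: "continuous_on X \<phi>" "continuous_on X \<psi>"
    and D_def: "D = cube n - (\<lambda>i. i + k) ` cube m"
    and room: "\<forall>i. \<bar>k $ i\<bar> + int m + int r \<le> int n"
    and L: "finite L" "card L \<le> N"
    and Z: "\<And>w y. w \<in> X \<Longrightarrow> y \<in> X \<Longrightarrow> Z w y \<in> X" "\<And>w y. w \<in> X \<Longrightarrow> y \<in> X \<Longrightarrow> lab w y \<in> L"
      "\<And>w y. w \<in> X \<Longrightarrow> y \<in> X \<Longrightarrow> \<exists>l\<in>cube r. \<forall>i\<in>cube m. Z w y (i + (k + l)) = y i"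
    and decode: "\<And>w y w' y'. w \<in> X \<Longrightarrow> y \<in> X \<Longrightarrow> w' \<in> X \<Longrightarrow> y' \<in> X \<Longrightarrow> lab w y = lab w' y' \<Longrightarrow>
      restrict (Z w y) (cube n) = restrict (Z w' y') (cube n) \<Longrightarrow>
      restrict w D = restrict w' D \<and> restrict y (cube m) = restrict y' (cube m)"
    and splice_energy: "\<And>w y. w \<in> X \<Longrightarrow> y \<in> X \<Longrightarrow>
      \<bar>birkhoff \<psi> (cube n) (Z w y) - birkhoff \<phi> (cube m) y - birkhoff \<psi> D w\<bar> \<le> E"
    and variation: "\<And>x y. x \<in> X \<Longrightarrow> y \<in> X \<Longrightarrow> \<forall>i\<in>cube m. x i = y i \<Longrightarrow>
      \<bar>birkhoff \<phi> (cube m) x - birkhoff \<phi> (cube m) y\<bar> \<le> E"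
    and perturbation: "\<And>x. x \<in> X \<Longrightarrow> \<bar>birkhoff \<psi> (cube m) x - birkhoff \<phi> (cube m) x\<bar> \<le> E"
begin

lemma window_subset: "(\<lambda>i. i + k) ` cube m \<subseteq> cube n"
proof -
  have "\<forall>i. \<bar>k $ i\<bar> + int m \<le> int n" using room by (metis add.assoc add_increasing2 le_add_same_cancel1 of_nat_0_le_iff order_trans)
  then show ?thesis using cube_add_subset(1)[of k m n] by blast
qed

lemma finite_D [simp]: "finite D"
  by (simp add: D_def)

lemma birkhoff_window:
  "birkhoff \<psi> (cube n) x = birkhoff \<psi> D x + birkhoff \<psi> (cube m) (shift k x)"
  unfolding D_def birkhoff_shift by (rule birkhoff_Diff[OF finite_cube window_subset])

text \<open>Spliced words together with their labels encode the pairs in \<open>S\<close>: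
  \<open>decode\<close> makes the encoding injective, \<open>splice_energy\<close> limits the loss
  of weight to \<open>exp E\<close>, and a word of \<open>T\<close> occurs with at most
  \<open>N\<close> labels. \<open>S\<close> and \<open>T\<close> are left free because the upper
  bound splices all pairs of words, the lower bound one fixed word into every surrounding.\<close>

lemma partition_function_window_product:
  assumes S: "S \<subseteq> words X D \<times> words X (cube m)"
    and T: "T \<subseteq> words X (cube n)"
    and \<xi>D: "maximizer X \<psi> D \<xi>D" and \<xi>m: "maximizer X \<phi> (cube m) \<xi>m" and \<xi>: "maximizer X \<psi> (cube n) \<xi>"
    and ST: "\<And>v u. (v, u) \<in> S \<Longrightarrow> restrict (Z (\<xi>D v) (\<xi>m u)) (cube n) \<in> T"
  shows "(\<Sum>p\<in>S. exp (birkhoff \<psi> D (\<xi>D (fst p))) * exp (birkhoff \<phi> (cube m) (\<xi>m (snd p))))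
    \<le> exp E * real N * (\<Sum>u\<in>T. exp (birkhoff \<psi> (cube n) (\<xi> u)))"
proof -
  let ?h = "\<lambda>p. (restrict (Z (\<xi>D (fst p)) (\<xi>m (snd p))) (cube n), lab (\<xi>D (fst p)) (\<xi>m (snd p)))"
  have mem: "\<xi>D (fst p) \<in> X" "\<xi>m (snd p) \<in> X" "restrict (\<xi>D (fst p)) D = fst p"
    "restrict (\<xi>m (snd p)) (cube m) = snd p" if "p \<in> S" for p
    using that S maximizerD(1,2)[OF \<xi>D] maximizerD(1,2)[OF \<xi>m] by auto
  have finT: "finite T" using T finite_words[OF finite_cube] by (rule finite_subset)
  have "(\<Sum>p\<in>S. exp (birkhoff \<psi> D (\<xi>D (fst p))) * exp (birkhoff \<phi> (cube m) (\<xi>m (snd p))))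
      \<le> (\<Sum>q\<in>T \<times> L. exp E * exp (birkhoff \<psi> (cube n) (\<xi> (fst q))))"
  proof (rule sum_le_sum_inj_on[where h = ?h])
    show "inj_on ?h S"
    proof (rule inj_onI)
      fix p q assume pq: "p \<in> S" "q \<in> S" "?h p = ?h q"
      then have "restrict (\<xi>D (fst p)) D = restrict (\<xi>D (fst q)) D \<and>
          restrict (\<xi>m (snd p)) (cube m) = restrict (\<xi>m (snd q)) (cube m)"
        using decode[of "\<xi>D (fst p)" "\<xi>m (snd p)" "\<xi>D (fst q)" "\<xi>m (snd q)"] mem by simp
      then show "p = q" using mem(3,4) pq by (metis prod_eqI)
    qed
    show "?h ` S \<subseteq> T \<times> L" using ST Z(2) mem by fastforce
  next
    fix p assume p: "p \<in> S"
    have "birkhoff \<psi> D (\<xi>D (fst p)) + birkhoff \<phi> (cube m) (\<xi>m (snd p))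
        \<le> E + birkhoff \<psi> (cube n) (Z (\<xi>D (fst p)) (\<xi>m (snd p)))"
      using splice_energy[OF mem(1,2)[OF p]] by linarith
    also have "... \<le> E + birkhoff \<psi> (cube n) (\<xi> (fst (?h p)))"
      using maximizerD(3)[OF \<xi> Z(1)[OF mem(1,2)[OF p]]] by simp
    finally show "exp (birkhoff \<psi> D (\<xi>D (fst p))) * exp (birkhoff \<phi> (cube m) (\<xi>m (snd p)))
        \<le> exp E * exp (birkhoff \<psi> (cube n) (\<xi> (fst (?h p))))"
      by (simp flip: exp_add)
  qed (use L finT in auto)
  also have "... = exp E * real (card L) * (\<Sum>u\<in>T. exp (birkhoff \<psi> (cube n) (\<xi> u)))"
    by (simp add: sum_distrib_left mult_ac flip: sum.cartesian_product[where g = "\<lambda>x y. exp E * exp (birkhoff \<psi> (cube n) (\<xi> x))", unfolded split_beta])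
  also have "... \<le> exp E * real N * (\<Sum>u\<in>T. exp (birkhoff \<psi> (cube n) (\<xi> u)))"
    using L by (intro mult_right_mono mult_left_mono sum_nonneg) auto
  finally show ?thesis .
qed

text \<open>Words that show \<open>x\<close> in the window are determined by their restriction to
  \<open>D\<close>, so they weigh at most about exp (S \<phi> (x)) times the partition function of
  \<open>D\<close>. Splicing all words bounds the latter by the quotient of the partition functions
  of \<open>cube n\<close> and \<open>cube m\<close>. One \<open>E\<close> each is lost to
  \<open>perturbation\<close>, \<open>variation\<close> and \<open>splice_energy\<close>.\<close>

lemma window_upper:
  assumes \<xi>: "maximizer X \<psi> (cube n) \<xi>" and x: "x \<in> X"
  shows "(\<Sum>u\<in>words X (cube n). exp (birkhoff \<psi> (cube n) (\<xi> u)) * indicat_real (cylinder X m x) (shift k (\<xi> u)))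
    * partition_function X \<phi> (cube m) \<le> real N * exp (3 * E + birkhoff \<phi> (cube m) x) * partition_function X \<psi> (cube n)"
proof -
  obtain \<xi>D \<xi>m where \<xi>D: "maximizer X \<psi> D \<xi>D" and \<xi>m: "maximizer X \<phi> (cube m) \<xi>m"
    using maximizer_exists cont finite_D finite_cube by metis
  let ?W = "words X (cube n)"
  define U where "U = {u \<in> ?W. shift k (\<xi> u) \<in> cylinder X m x}"
  have U: "finite U" "U \<subseteq> ?W" using finite_words[OF finite_cube] by (auto simp: U_def)
  have "(\<Sum>u\<in>?W. exp (birkhoff \<psi> (cube n) (\<xi> u)) * indicat_real (cylinder X m x) (shift k (\<xi> u)))
      = (\<Sum>u\<in>U. exp (birkhoff \<psi> (cube n) (\<xi> u)))"
    using finite_words[OF finite_cube, of n]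
    by (auto simp: U_def indicator_def intro!: sum.mono_neutral_cong_right)
  also have "... \<le> (\<Sum>v\<in>words X D. exp (2 * E + birkhoff \<phi> (cube m) x) * exp (birkhoff \<psi> D (\<xi>D v)))"
  proof (rule sum_le_sum_inj_on[where h = "\<lambda>u. restrict (\<xi> u) D"])
    show "inj_on (\<lambda>u. restrict (\<xi> u) D) U"
    proof (rule inj_onI)
      fix u v assume uv: "u \<in> U" "v \<in> U" "restrict (\<xi> u) D = restrict (\<xi> v) D"
      have "\<xi> u i = \<xi> v i" if i: "i \<in> cube n" for i
      proof (cases "i \<in> D")
        case False
        then obtain j where "j \<in> cube m" "i = j + k" using i unfolding D_def by blast
        then show ?thesis using uv by (auto simp: U_def mem_cylinder_iff shift_def)
      qed (use uv in \<open>auto simp: restrict_eq_iff\<close>)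
      then have "restrict (\<xi> u) (cube n) = restrict (\<xi> v) (cube n)" by (auto simp: restrict_eq_iff)
      then show "u = v" using maximizerD(2)[OF \<xi>] uv by (auto simp: U_def)
    qed
  next
    fix u assume u: "u \<in> U"
    then have uX: "\<xi> u \<in> X" using maximizerD(1)[OF \<xi>] by (auto simp: U_def)
    have "birkhoff \<psi> (cube n) (\<xi> u) = birkhoff \<psi> D (\<xi> u) + birkhoff \<psi> (cube m) (shift k (\<xi> u))"
      by (rule birkhoff_window)
    also have "... \<le> birkhoff \<psi> D (\<xi>D (restrict (\<xi> u) D)) + (birkhoff \<phi> (cube m) (shift k (\<xi> u)) + E)"
      using maximizerD(3)[OF \<xi>D uX] perturbation[OF shift_mem[OF uX], of k] by linarith
    also have "... \<le> birkhoff \<psi> D (\<xi>D (restrict (\<xi> u) D)) + (birkhoff \<phi> (cube m) x + 2 * E)"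
      using variation[of "shift k (\<xi> u)" x] u x by (auto simp: U_def mem_cylinder_iff)
    finally show "exp (birkhoff \<psi> (cube n) (\<xi> u))
        \<le> exp (2 * E + birkhoff \<phi> (cube m) x) * exp (birkhoff \<psi> D (\<xi>D (restrict (\<xi> u) D)))"
      by (simp add: algebra_simps flip: exp_add)
  qed (use maximizerD(1)[OF \<xi>] in \<open>auto simp: finite_words U_def restrict_mem_words\<close>)
  also have "... = exp (2 * E + birkhoff \<phi> (cube m) x) * partition_function X \<psi> D"
    by (simp add: partition_function_maximizer[OF \<xi>D] sum_distrib_left)
  finally have 1: "(\<Sum>u\<in>?W. exp (birkhoff \<psi> (cube n) (\<xi> u)) * indicat_real (cylinder X m x) (shift k (\<xi> u)))
      \<le> exp (2 * E + birkhoff \<phi> (cube m) x) * partition_function X \<psi> D" .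
  have "partition_function X \<psi> D * partition_function X \<phi> (cube m) \<le> exp E * real N * partition_function X \<psi> (cube n)"
    using partition_function_window_product[OF subset_refl subset_refl \<xi>D \<xi>m \<xi>] maximizerD(1)[OF \<xi>D] maximizerD(1)[OF \<xi>m]
    by (simp add: partition_function_maximizer[OF \<xi>D] partition_function_maximizer[OF \<xi>m] partition_function_maximizer[OF \<xi>] restrict_mem_words Z(1)
        sum_product sum.cartesian_product split_beta)
  then have "exp (2 * E + birkhoff \<phi> (cube m) x) * (partition_function X \<psi> D * partition_function X \<phi> (cube m))
      \<le> exp (2 * E + birkhoff \<phi> (cube m) x) * (exp E * real N * partition_function X \<psi> (cube n))"
    by (intro mult_left_mono) auto
  also have "... = real N * exp (3 * E + birkhoff \<phi> (cube m) x) * partition_function X \<psi> (cube n)"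
    by (simp add: mult_ac flip: exp_add)
  finally show ?thesis
    using mult_right_mono[OF 1, of "partition_function X \<phi> (cube m)"] partition_function_pos[OF finite_cube cont(1), of m]
    by (simp only: mult.assoc) linarith
qed

text \<open>Submultiplicativity splits the partition function of \<open>cube n\<close> into those of
  \<open>D\<close> and the window, and splicing the word of \<open>x\<close> into every word on
  \<open>D\<close> recovers the first factor from words that show \<open>x\<close>. The displacement
  of the spliced word depends on its surrounding, so only the sum over \<open>cube r\<close> is
  bounded below.\<close>

lemma window_lower:
  assumes \<xi>: "maximizer X \<psi> (cube n) \<xi>" and x: "x \<in> X"
  shows "exp (birkhoff \<phi> (cube m) x) * partition_function X \<psi> (cube n) \<le> real N * exp (3 * E) * partition_function X \<phi> (cube m) *
    (\<Sum>l\<in>cube r. \<Sum>u\<in>words X (cube n).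
      exp (birkhoff \<psi> (cube n) (\<xi> u)) * indicat_real (cylinder X m x) (shift (k + l) (\<xi> u)))"
proof -
  obtain \<xi>D \<xi>m \<xi>m' where \<xi>D: "maximizer X \<psi> D \<xi>D" and \<xi>m: "maximizer X \<phi> (cube m) \<xi>m"
      and \<xi>m': "maximizer X \<psi> (cube m) \<xi>m'"
    using maximizer_exists cont finite_D finite_cube by metis
  let ?W = "words X (cube n)" and ?x = "restrict x (cube m)"
  let ?i = "\<lambda>l u. indicat_real (cylinder X m x) (shift (k + l) (\<xi> u))"
  define U where "U = {u \<in> ?W. \<exists>l\<in>cube r. shift (k + l) (\<xi> u) \<in> cylinder X m x}"
  have U: "finite U" "U \<subseteq> ?W" using finite_words[OF finite_cube] by (auto simp: U_def)
  have x': "?x \<in> words X (cube m)" "\<xi>m ?x \<in> X" "\<forall>i\<in>cube m. \<xi>m ?x i = x i"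
    using x maximizerD(1,2)[OF \<xi>m, of ?x] by (auto simp: restrict_mem_words restrict_eq_iff)
  have "partition_function X \<psi> (cube n) = partition_function X \<psi> (D \<union> (\<lambda>i. i + k) ` cube m)"
    using window_subset by (simp add: D_def Un_absorb2)
  also have "... \<le> partition_function X \<psi> D * partition_function X \<psi> ((\<lambda>i. i + k) ` cube m)"
    using cont by (intro partition_function_Un_le) (auto simp: D_def)
  also have "... = partition_function X \<psi> D * partition_function X \<psi> (cube m)" using cont by (simp add: partition_function_translate)
  also have "... \<le> partition_function X \<psi> D * (exp E * partition_function X \<phi> (cube m))"
  proof (rule mult_left_mono)
    have "partition_function X \<psi> (cube m) \<le> (\<Sum>u\<in>words X (cube m). exp E * exp (birkhoff \<phi> (cube m) (\<xi>m u)))"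
      unfolding partition_function_maximizer[OF \<xi>m']
    proof (rule sum_mono)
      fix u assume u: "u \<in> words X (cube m)"
      then have "\<xi>m' u \<in> X" "restrict (\<xi>m' u) (cube m) = u" using maximizerD[OF \<xi>m'] by auto
      then show "exp (birkhoff \<psi> (cube m) (\<xi>m' u)) \<le> exp E * exp (birkhoff \<phi> (cube m) (\<xi>m u))"
        using perturbation[of "\<xi>m' u"] maximizerD(3)[OF \<xi>m, of "\<xi>m' u"] by (simp flip: exp_add)
    qed
    then show "partition_function X \<psi> (cube m) \<le> exp E * partition_function X \<phi> (cube m)"
      by (simp add: partition_function_maximizer[OF \<xi>m] sum_distrib_left)
  qed (use partition_function_pos[OF finite_D cont(2)] in simp)
  finally have "exp (birkhoff \<phi> (cube m) x) * partition_function X \<psi> (cube n)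
      \<le> exp (birkhoff \<phi> (cube m) x) * (partition_function X \<psi> D * (exp E * partition_function X \<phi> (cube m)))"
    by (intro mult_left_mono) auto
  also have "... = exp E * partition_function X \<phi> (cube m) * (partition_function X \<psi> D * exp (birkhoff \<phi> (cube m) x))"
    by simp
  also have "... \<le> exp E * partition_function X \<phi> (cube m) * (exp (2 * E) * real N * (\<Sum>u\<in>U. exp (birkhoff \<psi> (cube n) (\<xi> u))))"
  proof (rule mult_left_mono)
    have T: "restrict (Z (\<xi>D v) (\<xi>m ?x)) (cube n) \<in> U" if v: "v \<in> words X D" for v
    proof -
      let ?z = "Z (\<xi>D v) (\<xi>m ?x)"
      have vX: "\<xi>D v \<in> X" using maximizerD(1)[OF \<xi>D v] .
      have zX: "?z \<in> X" using Z(1) vX x' by auto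
      obtain l where l: "l \<in> cube r" "\<forall>i\<in>cube m. ?z (i + (k + l)) = \<xi>m ?x i" using Z(3)[OF vX x'(2)] by blast
      have \<xi>z: "\<forall>i\<in>cube n. \<xi> (restrict ?z (cube n)) i = ?z i" "\<xi> (restrict ?z (cube n)) \<in> X"
        using maximizerD(1,2)[OF \<xi> restrict_mem_words[OF zX]] by (auto simp: restrict_eq_iff)
      \<comment> \<open>The maximizer agrees with the spliced configuration inside
        \<open>cube n\<close> only, and \<open>room\<close> keeps the displaced window
        there.\<close>
      have "i + (k + l) \<in> cube n" if i: "i \<in> cube m" for i
      proof -
        have "l + i \<in> cube (r + m)"
          using cube_add_subset(1)[of i r "r + m" l] i l(1) by (auto simp: cube_def)
        moreover have "\<forall>a. \<bar>k $ a\<bar> + int (r + m) \<le> int n" using room by (simp add: algebra_simps)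
        ultimately have "l + i + k \<in> cube n" using cube_add_subset(1)[of k "r + m" n] by blast
        then show ?thesis by (simp add: add_ac)
      qed
      then have "shift (k + l) (\<xi> (restrict ?z (cube n))) \<in> cylinder X m x"
        using \<xi>z l(2) x'(3) shift_mem[OF \<xi>z(2), of "k + l"] by (auto simp: mem_cylinder_iff shift_def)
      then show ?thesis using l(1) zX by (auto simp: U_def restrict_mem_words)
    qed
    have "(\<Sum>p\<in>words X D \<times> {?x}. exp (birkhoff \<psi> D (\<xi>D (fst p))) * exp (birkhoff \<phi> (cube m) (\<xi>m (snd p))))
        \<le> exp E * real N * (\<Sum>u\<in>U. exp (birkhoff \<psi> (cube n) (\<xi> u)))"
      using T U x' by (intro partition_function_window_product[OF _ _ \<xi>D \<xi>m \<xi>]) auto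
    also have "(\<Sum>p\<in>words X D \<times> {?x}. exp (birkhoff \<psi> D (\<xi>D (fst p))) * exp (birkhoff \<phi> (cube m) (\<xi>m (snd p))))
        = partition_function X \<psi> D * exp (birkhoff \<phi> (cube m) (\<xi>m ?x))"
      unfolding partition_function_maximizer[OF \<xi>D] sum_distrib_right
      by (rule sum.reindex_cong[of "\<lambda>v. (v, ?x)"]) (auto simp: inj_on_def)
    finally have "exp E * (partition_function X \<psi> D * exp (birkhoff \<phi> (cube m) (\<xi>m ?x)))
      \<le> exp E * (exp E * real N * (\<Sum>u\<in>U. exp (birkhoff \<psi> (cube n) (\<xi> u))))"
      by (intro mult_left_mono) auto
    \<comment> \<open>The spliced configuration was built from \<open>\<xi>m ?x\<close>, which
      agrees with \<open>x\<close> on \<open>cube m\<close>; passing to \<open>x\<close> costs one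
      \<open>E\<close> of \<open>variation\<close>.\<close>
    moreover have "partition_function X \<psi> D * exp (birkhoff \<phi> (cube m) x)
        \<le> exp E * (partition_function X \<psi> D * exp (birkhoff \<phi> (cube m) (\<xi>m ?x)))"
      using variation[OF x'(2) x x'(3)] partition_function_pos[OF finite_D cont(2)]
      by (simp add: mult.left_commute flip: exp_add)
    ultimately show "partition_function X \<psi> D * exp (birkhoff \<phi> (cube m) x)
        \<le> exp (2 * E) * real N * (\<Sum>u\<in>U. exp (birkhoff \<psi> (cube n) (\<xi> u)))"
      by (simp add: mult_exp_exp mult.assoc[symmetric])
  qed (use partition_function_pos[OF finite_cube cont(1), of m] in simp)
  also have "... \<le> exp E * partition_function X \<phi> (cube m) * (exp (2 * E) * real N *
      (\<Sum>l\<in>cube r. \<Sum>u\<in>?W. exp (birkhoff \<psi> (cube n) (\<xi> u)) * ?i l u))"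
  proof (intro mult_left_mono)
    have "(\<Sum>u\<in>U. exp (birkhoff \<psi> (cube n) (\<xi> u)))
        \<le> (\<Sum>u\<in>U. \<Sum>l\<in>cube r. exp (birkhoff \<psi> (cube n) (\<xi> u)) * ?i l u)"
    proof (rule sum_mono)
      fix u assume "u \<in> U"
      then obtain l where "l \<in> cube r" "shift (k + l) (\<xi> u) \<in> cylinder X m x" by (auto simp: U_def)
      then show "exp (birkhoff \<psi> (cube n) (\<xi> u)) \<le> (\<Sum>l\<in>cube r. exp (birkhoff \<psi> (cube n) (\<xi> u)) * ?i l u)"
        using member_le_sum[of l "cube r" "\<lambda>l. exp (birkhoff \<psi> (cube n) (\<xi> u)) * ?i l u"] by simp
    qed
    also have "... \<le> (\<Sum>u\<in>?W. \<Sum>l\<in>cube r. exp (birkhoff \<psi> (cube n) (\<xi> u)) * ?i l u)"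
      using U finite_words[OF finite_cube, of n] by (intro sum_mono2 sum_nonneg) auto
    finally show "(\<Sum>u\<in>U. exp (birkhoff \<psi> (cube n) (\<xi> u)))
        \<le> (\<Sum>l\<in>cube r. \<Sum>u\<in>?W. exp (birkhoff \<psi> (cube n) (\<xi> u)) * ?i l u)"
      by (subst sum.swap)
  qed (use partition_function_pos[OF finite_cube cont(1), of m] in auto)
  also have "... = real N * exp (3 * E) * partition_function X \<phi> (cube m) *
      (\<Sum>l\<in>cube r. \<Sum>u\<in>?W. exp (birkhoff \<psi> (cube n) (\<xi> u)) * ?i l u)"
    by (simp add: mult_ac mult_exp_exp)
  finally show ?thesis .
qed

end

end

section \<open>Cylinder measures of tangent functionals\<close>

context finite_shift
begin

text \<open>The agreement set and its complement are both closed. Continuity makes the indicator an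
  admissible test function for tangency.\<close>

lemma continuous_on_indicator_cylinder:
  "continuous_on X (indicat_real (cylinder X m x))"
proof -
  let ?U = "{y :: ('d, 'a) config. \<forall>k\<in>cube m. y k = x k}"
  have "continuous_on (?U \<union> - ?U) (\<lambda>y. if y \<in> ?U then 1 else 0 :: real)"
    by (rule continuous_on_If) (use clopen_agree[OF finite_cube, of m x] in \<open>auto simp: closed_Compl\<close>)
  then have "continuous_on X (\<lambda>y. if y \<in> ?U then 1 else 0 :: real)"
    by (rule continuous_on_subset) auto
  moreover have "(if y \<in> ?U then 1 else 0) = indicat_real (cylinder X m x) y" if "y \<in> X" for y
    using that by (auto simp: indicator_def mem_cylinder_iff)
  ultimately show ?thesis by (rule continuous_on_cong[THEN iffD1, OF refl, rotated]) auto
qed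

lemma integral_indicator_cylinder:
  assumes "\<nu> \<in> M1 X"
  shows "(\<integral>y. indicat_real (cylinder X m x) y \<partial>\<nu>) = measure \<nu> (cylinder X m x)"
proof -
  have "cylinder X m x = X \<inter> {y. \<forall>k\<in>cube m. y k = x k}"
    by (auto simp: mem_cylinder_iff)
  then have "cylinder X m x \<in> sets (restrict_space borel X)"
    using clopen_agree(1)[OF finite_cube, of m x] by (auto simp: sets_restrict_space)
  then have "cylinder X m x \<in> sets \<nu>" using assms by (simp add: M1_def)
  then show ?thesis by simp
qed

text \<open>In the condition on \<open>E\<close>, 4 b + C c is the splicing error of \<phi>. The
  factor of |t| consists of the splicing error 4 b' + c of the indicator, which is bounded by 1, and
  of its sum over the window, at most |cube m|, because the window term is compared with \<phi> and
  not with the perturbed function.\<close>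

lemma splicing_window_bounds:
  fixes t :: real and m :: nat and \<phi> :: "('d, 'a) config \<Rightarrow> real"
  defines "f x \<equiv> indicat_real (cylinder X m x)"
  defines "\<psi> x \<equiv> \<lambda>y. \<phi> y + t * indicat_real (cylinder X m x) y"
  assumes cont: "continuous_on X \<phi>" and bound: "\<And>x. x \<in> X \<Longrightarrow> \<bar>\<phi> x\<bar> \<le> C"
    and splice: "splicing X \<S> m r c N n k"
    and room: "\<forall>i. \<bar>k $ i\<bar> + int m + int r \<le> int n"
    and cube: "cube m \<in> \<S>" and c: "c \<ge> 0" and b: "b \<ge> 0"
    and agree: "\<And>S. S \<in> \<S> \<Longrightarrow> agreement_bound X \<phi> S b"
    and agree_f: "\<And>S. S \<in> \<S> \<Longrightarrow> agreement_bound X (f x) S b'"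
    and E: "4 * b + C * c + \<bar>t\<bar> * (4 * b' + c + real (card (cube m :: (int ^ 'd) set))) \<le> E"
    and C: "C \<ge> 0" and b': "b' \<ge> 0"
    and x: "x \<in> X"
    and \<xi>: "maximizer X (\<psi> x) (cube n) \<xi>"
  shows "(\<Sum>u\<in>words X (cube n). exp (birkhoff (\<psi> x) (cube n) (\<xi> u)) * f x (shift k (\<xi> u))) * partition_function X \<phi> (cube m)
      \<le> real N * exp (3 * E + birkhoff \<phi> (cube m) x) * partition_function X (\<psi> x) (cube n)" (is ?upper)
    and "exp (birkhoff \<phi> (cube m) x) * partition_function X (\<psi> x) (cube n) \<le> real N * exp (3 * E) * partition_function X \<phi> (cube m) *
      (\<Sum>l\<in>cube r. \<Sum>u\<in>words X (cube n). exp (birkhoff (\<psi> x) (cube n) (\<xi> u)) * f x (shift (k + l) (\<xi> u)))" (is ?lower)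
proof -
  let ?D = "cube n - (\<lambda>i. i + k) ` cube m" and ?v = "real (card (cube m :: (int ^ 'd) set))"
  from splice[unfolded splicing_def]
  obtain Z and lab :: "('d, 'a) config \<Rightarrow> ('d, 'a) config \<Rightarrow> int \<times> int \<times> (int ^ 'd) \<times> ('d, 'a) config" and L where L: "finite L" "card L \<le> N"
    and Z': "\<forall>w\<in>X. \<forall>y\<in>X. Z w y \<in> X \<and> lab w y \<in> L \<and> (\<exists>l\<in>cube r. \<forall>i\<in>cube m. Z w y (i + (k + l)) = y i)"
    and decode: "\<forall>w\<in>X. \<forall>y\<in>X. \<forall>w'\<in>X. \<forall>y'\<in>X.
        lab w y = lab w' y' \<and> (\<forall>i\<in>cube n. Z w y i = Z w' y' i) \<longrightarrow>
        (\<forall>i\<in>?D. w i = w' i) \<and> (\<forall>i\<in>cube m. y i = y' i)"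
    and energy': "\<forall>g b C. (\<forall>x\<in>X. \<bar>g x\<bar> \<le> C) \<and> (\<forall>S\<in>\<S>. agreement_bound X g S b) \<longrightarrow> (\<forall>w\<in>X. \<forall>y\<in>X.
        \<bar>birkhoff g (cube n) (Z w y) - birkhoff g (cube m) y - birkhoff g ?D w\<bar> \<le> 4 * b + C * c)"
    by (elim exE conjE) (rule that)
  have Z: "\<And>w y. w \<in> X \<Longrightarrow> y \<in> X \<Longrightarrow> Z w y \<in> X" "\<And>w y. w \<in> X \<Longrightarrow> y \<in> X \<Longrightarrow> lab w y \<in> L"
      "\<And>w y. w \<in> X \<Longrightarrow> y \<in> X \<Longrightarrow> \<exists>l\<in>cube r. \<forall>i\<in>cube m. Z w y (i + (k + l)) = y i"
    using Z' by auto
  have energy: "\<bar>birkhoff g (cube n) (Z w y) - birkhoff g (cube m) y - birkhoff g ?D w\<bar> \<le> 4 * b + C * c"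
    if "(\<forall>x\<in>X. \<bar>g x\<bar> \<le> C) \<and> (\<forall>S\<in>\<S>. agreement_bound X g S b)" "w \<in> X" "y \<in> X" for g b C w y
    using energy'[rule_format, OF that] .
  have cont_f: "continuous_on X (f x)" unfolding f_def by (rule continuous_on_indicator_cylinder)
  have cont\<psi>: "continuous_on X (\<psi> x)" using cont cont_f unfolding \<psi>_def f_def by (intro continuous_intros)
  have decode': "restrict w ?D = restrict w' ?D \<and> restrict y (cube m) = restrict y' (cube m)"
    if "w \<in> X" "y \<in> X" "w' \<in> X" "y' \<in> X" "lab w y = lab w' y'"
      "restrict (Z w y) (cube n) = restrict (Z w' y') (cube n)" for w y w' y'
    using decode[rule_format, OF that(1-4)] that(5,6) unfolding restrict_eq_iff by blast
  have b\<psi>: "birkhoff (\<psi> x) \<Lambda> y = birkhoff \<phi> \<Lambda> y + t * birkhoff (f x) \<Lambda> y" for \<Lambda> y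
    unfolding \<psi>_def f_def by (rule birkhoff_add_mult)
  have bf: "\<bar>birkhoff (f x) (cube m) y\<bar> \<le> ?v" for y
    unfolding birkhoff_def f_def using sum_bounded_above[of "cube m" "\<lambda>k. indicat_real (cylinder X m x) (shift k y)" 1]
    by (auto simp: abs_of_nonneg sum_nonneg)
  have Cc: "0 \<le> C * c" using C c by simp
  have vE: "4 * b \<le> E" "0 \<le> \<bar>t\<bar> * (4 * b' + c)" "\<bar>t\<bar> * ?v \<le> E"
  proof -
    have "0 \<le> \<bar>t\<bar> * (4 * b' + c)" "0 \<le> \<bar>t\<bar> * ?v" using b' c by auto
    moreover have "\<bar>t\<bar> * (4 * b' + c + ?v) = \<bar>t\<bar> * (4 * b' + c) + \<bar>t\<bar> * ?v" by (simp add: ring_distribs)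
    ultimately show "4 * b \<le> E" "0 \<le> \<bar>t\<bar> * (4 * b' + c)" "\<bar>t\<bar> * ?v \<le> E" using E b Cc by linarith+
  qed
  have perturbation: "\<bar>birkhoff (\<psi> x) (cube m) y - birkhoff \<phi> (cube m) y\<bar> \<le> E" if "y \<in> X" for y
  proof -
    have "\<bar>birkhoff (\<psi> x) (cube m) y - birkhoff \<phi> (cube m) y\<bar> \<le> \<bar>t\<bar> * ?v"
      using bf[of y] by (simp add: b\<psi> abs_mult mult_left_mono)
    then show ?thesis using vE by linarith
  qed
  have variation: "\<bar>birkhoff \<phi> (cube m) y - birkhoff \<phi> (cube m) z\<bar> \<le> E"
    if "y \<in> X" "z \<in> X" "\<forall>i\<in>cube m. y i = z i" for y z
  proof -
    have "\<bar>birkhoff \<phi> (cube m) y - birkhoff \<phi> (cube m) z\<bar> \<le> b"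
      using agree[OF cube, unfolded agreement_bound_def, rule_format, OF that(1,2), of "cube m"] that(3)
      by simp
    then show ?thesis using vE b by linarith
  qed
  have splice_energy: "\<bar>birkhoff (\<psi> x) (cube n) (Z w y) - birkhoff \<phi> (cube m) y - birkhoff (\<psi> x) ?D w\<bar> \<le> E"
    if wy: "w \<in> X" "y \<in> X" for w y
  proof -
    have 1: "\<bar>birkhoff \<phi> (cube n) (Z w y) - birkhoff \<phi> (cube m) y - birkhoff \<phi> ?D w\<bar> \<le> 4 * b + C * c"
      by (rule energy) (use wy bound agree in auto)
    have 2: "\<bar>birkhoff (f x) (cube n) (Z w y) - birkhoff (f x) (cube m) y - birkhoff (f x) ?D w\<bar> \<le> 4 * b' + 1 * c"
      by (rule energy) (use wy agree_f in \<open>auto simp: f_def\<close>)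
    have 3: "\<bar>t * (birkhoff (f x) (cube n) (Z w y) - birkhoff (f x) ?D w)\<bar> \<le> \<bar>t\<bar> * (4 * b' + c + ?v)"
      unfolding abs_mult using 2 bf[of y] by (intro mult_left_mono) auto
    have "birkhoff (\<psi> x) (cube n) (Z w y) - birkhoff \<phi> (cube m) y - birkhoff (\<psi> x) ?D w
      = (birkhoff \<phi> (cube n) (Z w y) - birkhoff \<phi> (cube m) y - birkhoff \<phi> ?D w)
        + t * (birkhoff (f x) (cube n) (Z w y) - birkhoff (f x) ?D w)"
      by (simp add: b\<psi> algebra_simps)
    then show ?thesis using 1 3 E by linarith
  qed
  show ?upper unfolding f_def
    by (rule window_upper[OF cont cont\<psi> refl room L Z decode' splice_energy variation perturbation \<xi> x])
  show ?lower unfolding f_def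
    by (rule window_lower[OF cont cont\<psi> refl room L Z decode' splice_energy variation perturbation \<xi> x])
qed

text \<open>Windows too near the boundary of \<open>cube n\<close> obey only the trivial bound
  \<open>Q\<close>; they are counted separately because their proportion will vanish.\<close>

lemma sum_expectation_upper:
  fixes Y :: "int ^ 'd \<Rightarrow> real"
  assumes "p + s = n" "\<And>k. k \<in> cube p \<Longrightarrow> Y k \<le> \<alpha> * Q" "\<And>k. Y k \<le> Q"
  shows "(\<Sum>k\<in>cube n. Y k) \<le> (\<alpha> * real (card (cube p :: (int ^ 'd) set)) +
    (real (card (cube n :: (int ^ 'd) set)) - real (card (cube p :: (int ^ 'd) set)))) * Q"
proof -
  have sub: "cube p \<subseteq> (cube n :: (int ^ 'd) set)" using assms(1) by (intro cube_mono) auto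
  have "(\<Sum>k\<in>cube n. Y k) = (\<Sum>k\<in>cube n - cube p. Y k) + (\<Sum>k\<in>cube p. Y k)"
    by (rule sum.subset_diff[OF sub finite_cube])
  also have "... \<le> real (card (cube n - cube p :: (int ^ 'd) set)) * Q + real (card (cube p :: (int ^ 'd) set)) * (\<alpha> * Q)"
    using assms by (intro add_mono sum_bounded_above) auto
  also have "real (card (cube n - cube p :: (int ^ 'd) set)) =
      real (card (cube n :: (int ^ 'd) set)) - real (card (cube p :: (int ^ 'd) set))"
    using sub card_mono[OF finite_cube sub] by (subst card_Diff_subset) auto
  finally show ?thesis by (simp add: algebra_simps)
qed

text \<open>Double counting: a site of \<open>cube n\<close> arises as \<open>k + l\<close> with
  \<open>l\<close> in \<open>cube r\<close> at most |cube r| times.\<close>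

lemma sum_expectation_lower:
  fixes Y :: "int ^ 'd \<Rightarrow> real"
  assumes "p + r \<le> n" "\<And>k. k \<in> cube p \<Longrightarrow> a \<le> (\<Sum>l\<in>cube r. Y (k + l))" "\<And>k. 0 \<le> Y k"
  shows "real (card (cube p :: (int ^ 'd) set)) * a \<le> real (card (cube r :: (int ^ 'd) set)) * (\<Sum>k\<in>cube n. Y k)"
proof -
  have "real (card (cube p :: (int ^ 'd) set)) * a \<le> (\<Sum>k\<in>cube p. \<Sum>l\<in>cube r. Y (k + l))"
    using assms(2) by (intro sum_bounded_below) auto
  also have "... = (\<Sum>l\<in>cube r. \<Sum>k\<in>cube p. Y (k + l))" by (rule sum.swap)
  also have "... \<le> (\<Sum>l\<in>(cube r :: (int ^ 'd) set). \<Sum>k\<in>cube n. Y k)"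
  proof (rule sum_mono)
    fix l :: "int ^ 'd" assume l: "l \<in> cube r"
    have "k + l \<in> cube n" if k: "k \<in> cube p" for k :: "int ^ 'd"
    proof (rule cube_add_subset(2)[OF _ l], rule allI)
      fix i have "\<bar>k $ i\<bar> \<le> int p" using k by (simp add: cube_def)
      then show "\<bar>k $ i\<bar> + int r \<le> int n" using assms(1) by linarith
    qed
    then show "(\<Sum>k\<in>cube p. Y (k + l)) \<le> (\<Sum>k\<in>cube n. Y k)"
      using assms(3) by (intro sum_le_sum_inj_on[where h = "\<lambda>k. k + l"]) (auto simp: inj_on_def)
  qed
  finally show ?thesis by simp
qed

lemma bulk_ratio:
  "(\<lambda>n. real (card (cube (n - s) :: (int ^ 'd) set)) / real (card (cube n :: (int ^ 'd) set))) \<longlonglongrightarrow> 1"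
  by (rule cube_ratio_tendsto_1[OF const_over_n_tendsto_0[of s]])
     (auto intro!: eventually_sequentiallyI[of s])

text \<open>The perturbation \<open>\<tau>\<close> turns the upper window bound into an upper bound
  on the measure, and \<open>- \<tau>\<close> turns the lower one into a lower bound. The conclusion
  is free of \<open>b'\<close>: \<tau> is chosen after it and shrinks its contribution to the slack
  left in \<open>E\<close>.\<close>

proposition gibbs_bounds_from_splicing:
  fixes m :: nat
  defines "v \<equiv> real (card (cube m :: (int ^ 'd) set))"
  assumes cont: "continuous_on X \<phi>" and bound: "\<And>x. x \<in> X \<Longrightarrow> \<bar>\<phi> x\<bar> \<le> C" and C: "C \<ge> 0"
    and tangent: "tangent_functional X \<phi> \<nu>" and \<nu>: "\<nu> \<in> M1 X"
    and splice: "\<And>n k. \<forall>i. \<bar>k $ i\<bar> + int m + int r \<le> int n \<Longrightarrow> splicing X \<S> m r c N n k"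
    and cube: "cube m \<in> \<S>" and c: "c \<ge> 0" and b: "b \<ge> 0"
    and agree: "\<And>S. S \<in> \<S> \<Longrightarrow> agreement_bound X \<phi> S b"
    and b': "b' \<ge> 0" and agree_f: "\<And>S. S \<in> \<S> \<Longrightarrow> agreement_bound X (indicat_real (cylinder X m x)) S b'"
    and E: "4 * b + C * c < E"
    and pressure: "ln (partition_function X \<phi> (cube m)) \<le> v * pressure X \<phi> + E"
    and x: "x \<in> X"
  shows "measure \<nu> (cylinder X m x) > 0"
    and "\<bar>ln (measure \<nu> (cylinder X m x)) - (birkhoff \<phi> (cube m) x - v * pressure X \<phi>)\<bar>
      \<le> ln (real N) + 4 * E + ln (real (card (cube r :: (int ^ 'd) set)))"
proof -
  let ?c = "\<lambda>n. real (card (cube n :: (int ^ 'd) set))"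
  let ?f = "indicat_real (cylinder X m x)"
  let ?\<psi> = "\<lambda>t y. \<phi> y + t * ?f y"
  let ?P = "pressure X \<phi>"
  define B where "B = birkhoff \<phi> (cube m) x - v * ?P"
  define K where "K = 4 * b' + c + v"
  \<comment> \<open>The slack that the splicing error of \<phi> leaves in \<open>E\<close>, divided
    by the cost of a perturbation of unit size. It does not depend on \<open>n\<close>.\<close>
  define \<tau> where "\<tau> = (E - (4 * b + C * c)) / K"
  have v: "v > 0" by (simp add: v_def)
  have K: "K > 0" using v b' c by (simp add: K_def)
  have \<tau>: "\<tau> > 0" using E K by (simp add: \<tau>_def)
  have \<tau>E: "4 * b + C * c + \<bar>t\<bar> * (4 * b' + c + v) \<le> E" if "\<bar>t\<bar> = \<tau>" for t
    using K that by (simp add: \<tau>_def flip: K_def)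
  have cont_f: "continuous_on X ?f" by (rule continuous_on_indicator_cylinder)
  have cont\<psi>: "continuous_on X (?\<psi> t)" for t using cont cont_f by (intro continuous_intros)
  have partition_function\<phi>: "partition_function X \<phi> (cube m) > 0" using partition_function_pos[OF finite_cube cont] .
  have Epos: "0 < E" using E b mult_nonneg_nonneg[OF C c] by linarith
  \<comment> \<open>Splicing \<open>x\<close> with itself in the smallest admissible cube shows that
    there is a label, so \<open>ln (real N)\<close> is a genuine logarithm.\<close>
  have N: "N > 0"
  proof -
    have "splicing X \<S> m r c N (m + r) 0" by (rule splice) simp
    then obtain lab :: "('d, 'a) config \<Rightarrow> ('d, 'a) config \<Rightarrow> int \<times> int \<times> (int ^ 'd) \<times> ('d, 'a) config" and L
      where "finite L" "card L \<le> N" "lab x x \<in> L"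
      unfolding splicing_def using x by blast
    then show ?thesis by (metis card_gt_0_iff empty_iff less_le_trans)
  qed
  have room: "\<forall>i. \<bar>k $ i\<bar> + int m + int r \<le> int n" if "k \<in> cube (n - (m + r))" "m + r \<le> n" for k :: "int ^ 'd" and n
    using that by (auto simp: cube_def of_nat_diff algebra_simps)
  note bounds = splicing_window_bounds[OF cont bound splice _ cube c b agree agree_f \<tau>E[unfolded v_def] C b' x, simplified]
  define Y where "Y t n \<xi> k = (\<Sum>u\<in>words X (cube n). exp (birkhoff (?\<psi> t) (cube n) (\<xi> u)) * ?f (shift k (\<xi> u)))"
    for t :: real and n and \<xi> :: "('d, 'a) config \<Rightarrow> ('d, 'a) config" and k :: "int ^ 'd"
  have sumY: "(\<Sum>u\<in>words X (cube n). exp (birkhoff (?\<psi> t) (cube n) (\<xi> u)) * birkhoff ?f (cube n) (\<xi> u))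
      = (\<Sum>k\<in>cube n. Y t n \<xi> k)" for t n \<xi>
    unfolding Y_def birkhoff_def[of ?f] sum_distrib_left by (rule sum.swap)
  have Y0: "0 \<le> Y t n \<xi> k" for t n \<xi> k unfolding Y_def by (intro sum_nonneg) auto
  have Y1: "Y t n \<xi> k \<le> partition_function X (?\<psi> t) (cube n)" if "maximizer X (?\<psi> t) (cube n) \<xi>" for t n \<xi> k
    unfolding Y_def partition_function_maximizer[OF that] by (intro sum_mono) (auto simp: indicator_def)
  have "\<tau> * measure \<nu> (cylinder X m x) \<le> \<tau> * (real N * exp (3 * E + birkhoff \<phi> (cube m) x) / partition_function X \<phi> (cube m))"
  proof -
    define \<alpha> where "\<alpha> = real N * exp (3 * E + birkhoff \<phi> (cube m) x) / partition_function X \<phi> (cube m)"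
    \<comment> \<open>The summand \<open>1 - 1\<close> is the limiting proportion of windows near
      the boundary of \<open>cube n\<close>.\<close>
    have "\<tau> * (\<integral>y. ?f y \<partial>\<nu>) \<le> \<tau> * (\<alpha> * 1 + (1 - 1))"
    proof (rule tangent_bound[OF cont cont_f tangent, where K = "\<lambda>n. \<tau> * (\<alpha> * ?c (n - (m + r)) + (?c n - ?c (n - (m + r))))"])
      show "\<forall>\<^sub>F n in sequentially. \<forall>\<xi>. maximizer X (?\<psi> \<tau>) (cube n) \<xi> \<longrightarrow>
        \<tau> * (\<Sum>u\<in>words X (cube n). exp (birkhoff (?\<psi> \<tau>) (cube n) (\<xi> u)) * birkhoff ?f (cube n) (\<xi> u))
        \<le> \<tau> * (\<alpha> * ?c (n - (m + r)) + (?c n - ?c (n - (m + r)))) * partition_function X (?\<psi> \<tau>) (cube n)"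
      proof (intro eventually_sequentiallyI[of "m + r"] allI impI)
        fix n \<xi> assume n: "m + r \<le> n" and \<xi>: "maximizer X (?\<psi> \<tau>) (cube n) \<xi>"
        have "(\<Sum>k\<in>cube n. Y \<tau> n \<xi> k) \<le> (\<alpha> * ?c (n - (m + r)) + (?c n - ?c (n - (m + r)))) * partition_function X (?\<psi> \<tau>) (cube n)"
        proof (rule sum_expectation_upper[where s = "m + r"])
          fix k :: "int ^ 'd" assume k: "k \<in> cube (n - (m + r))"
          have "Y \<tau> n \<xi> k * partition_function X \<phi> (cube m) \<le> real N * exp (3 * E + birkhoff \<phi> (cube m) x) * partition_function X (?\<psi> \<tau>) (cube n)"
            unfolding Y_def using \<tau> by (intro bounds(1) room[OF k n] \<xi>) auto
          then show "Y \<tau> n \<xi> k \<le> \<alpha> * partition_function X (?\<psi> \<tau>) (cube n)"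
            using partition_function\<phi> by (simp add: \<alpha>_def pos_le_divide_eq)
        qed (use n Y1[OF \<xi>] in auto)
        then show "\<tau> * (\<Sum>u\<in>words X (cube n). exp (birkhoff (?\<psi> \<tau>) (cube n) (\<xi> u)) * birkhoff ?f (cube n) (\<xi> u))
          \<le> \<tau> * (\<alpha> * ?c (n - (m + r)) + (?c n - ?c (n - (m + r)))) * partition_function X (?\<psi> \<tau>) (cube n)"
          using \<tau> by (simp add: sumY mult.assoc)
      qed
      have "(\<lambda>n. \<tau> * (\<alpha> * (?c (n - (m + r)) / ?c n) + (1 - ?c (n - (m + r)) / ?c n))) \<longlonglongrightarrow> \<tau> * (\<alpha> * 1 + (1 - 1))"
        by (intro tendsto_intros bulk_ratio)
      moreover have "\<tau> * (\<alpha> * (?c (n - (m + r)) / ?c n) + (1 - ?c (n - (m + r)) / ?c n)) =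
          \<tau> * (\<alpha> * ?c (n - (m + r)) + (?c n - ?c (n - (m + r)))) / ?c n" for n
        by (simp add: field_simps)
      ultimately show "(\<lambda>n. \<tau> * (\<alpha> * ?c (n - (m + r)) + (?c n - ?c (n - (m + r)))) / ?c n) \<longlonglongrightarrow> \<tau> * (\<alpha> * 1 + (1 - 1))"
        by simp
    qed
    then show ?thesis by (simp only: integral_indicator_cylinder[OF \<nu>] \<alpha>_def) simp
  qed
  then have up: "measure \<nu> (cylinder X m x) \<le> real N * exp (3 * E + birkhoff \<phi> (cube m) x) / partition_function X \<phi> (cube m)"
    using \<tau> by (simp only: mult_le_cancel_left_pos)
  have low: "exp (birkhoff \<phi> (cube m) x) / (real N * exp (3 * E) * partition_function X \<phi> (cube m)) / ?c r \<le> measure \<nu> (cylinder X m x)"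
  proof -
    define \<alpha> where "\<alpha> = exp (birkhoff \<phi> (cube m) x) / (real N * exp (3 * E) * partition_function X \<phi> (cube m)) / ?c r"
    have "(- \<tau>) * (\<integral>y. ?f y \<partial>\<nu>) \<le> (- \<tau>) * (\<alpha> * 1)"
    proof (rule tangent_bound[OF cont cont_f tangent, where K = "\<lambda>n. (- \<tau>) * (\<alpha> * ?c (n - (m + r)))"])
      show "\<forall>\<^sub>F n in sequentially. \<forall>\<xi>. maximizer X (?\<psi> (- \<tau>)) (cube n) \<xi> \<longrightarrow>
        (- \<tau>) * (\<Sum>u\<in>words X (cube n). exp (birkhoff (?\<psi> (- \<tau>)) (cube n) (\<xi> u)) * birkhoff ?f (cube n) (\<xi> u))
        \<le> (- \<tau>) * (\<alpha> * ?c (n - (m + r))) * partition_function X (?\<psi> (- \<tau>)) (cube n)"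
      proof (intro eventually_sequentiallyI[of "m + r"] allI impI)
        fix n \<xi> assume n: "m + r \<le> n" and \<xi>: "maximizer X (?\<psi> (- \<tau>)) (cube n) \<xi>"
        have "?c (n - (m + r)) * (?c r * \<alpha> * partition_function X (?\<psi> (- \<tau>)) (cube n)) \<le> ?c r * (\<Sum>k\<in>cube n. Y (- \<tau>) n \<xi> k)"
        proof (rule sum_expectation_lower)
          fix k :: "int ^ 'd" assume k: "k \<in> cube (n - (m + r))"
          have "exp (birkhoff \<phi> (cube m) x) * partition_function X (?\<psi> (- \<tau>)) (cube n) \<le> real N * exp (3 * E) * partition_function X \<phi> (cube m) *
              (\<Sum>l\<in>cube r. Y (- \<tau>) n \<xi> (k + l))"
            unfolding Y_def using \<tau> by (intro bounds(2) room[OF k n] \<xi>) auto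
          then show "?c r * \<alpha> * partition_function X (?\<psi> (- \<tau>)) (cube n) \<le> (\<Sum>l\<in>cube r. Y (- \<tau>) n \<xi> (k + l))"
            using partition_function\<phi> N card_cube_pos[of r, where 'd = 'd]
            by (simp add: \<alpha>_def pos_divide_le_eq mult.commute)
        qed (use n Y0 in auto)
        then have "\<alpha> * ?c (n - (m + r)) * partition_function X (?\<psi> (- \<tau>)) (cube n) \<le> (\<Sum>k\<in>cube n. Y (- \<tau>) n \<xi> k)"
          by (simp add: mult_ac)
        then show "(- \<tau>) * (\<Sum>u\<in>words X (cube n). exp (birkhoff (?\<psi> (- \<tau>)) (cube n) (\<xi> u)) * birkhoff ?f (cube n) (\<xi> u))
          \<le> (- \<tau>) * (\<alpha> * ?c (n - (m + r))) * partition_function X (?\<psi> (- \<tau>)) (cube n)"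
          using \<tau> unfolding sumY by (simp only: mult_minus_left neg_le_iff_le mult.assoc mult_le_cancel_left_pos)
      qed
      have "(\<lambda>n. - \<tau> * (\<alpha> * (?c (n - (m + r)) / ?c n))) \<longlonglongrightarrow> - \<tau> * (\<alpha> * 1)"
        by (intro tendsto_intros bulk_ratio)
      then show "(\<lambda>n. - \<tau> * (\<alpha> * ?c (n - (m + r))) / ?c n) \<longlonglongrightarrow> - \<tau> * (\<alpha> * 1)"
        by simp
    qed
    then have "\<alpha> \<le> (\<integral>y. ?f y \<partial>\<nu>)" using \<tau> by (simp del: integral_indicator Bochner_Integration.integral_indicator)
    then show ?thesis by (simp only: integral_indicator_cylinder[OF \<nu>] \<alpha>_def)
  qed
  show pos: "measure \<nu> (cylinder X m x) > 0"
    by (rule less_le_trans[OF _ low]) (use N partition_function\<phi> in auto)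
  have "ln (measure \<nu> (cylinder X m x)) \<le> ln (real N * exp (3 * E + birkhoff \<phi> (cube m) x) / partition_function X \<phi> (cube m))"
    using up by (intro ln_mono pos)
  also have "... = ln (real N) + 3 * E + birkhoff \<phi> (cube m) x - ln (partition_function X \<phi> (cube m))"
    using N partition_function\<phi> by (simp add: ln_mult ln_div)
  \<comment> \<open>No error arises here, since the pressure is the infimum of the normalised
    logarithms.\<close>
  also have "... \<le> ln (real N) + 3 * E + B"
    using pressure_limit(2)[OF cont, of m] by (simp add: B_def v_def)
  finally have 1: "ln (measure \<nu> (cylinder X m x)) \<le> ln (real N) + 3 * E + B" .
  have "ln (exp (birkhoff \<phi> (cube m) x) / (real N * exp (3 * E) * partition_function X \<phi> (cube m)) / ?c r) \<le> ln (measure \<nu> (cylinder X m x))"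
    using low N partition_function\<phi> by (intro ln_mono) auto
  moreover have "ln (exp (birkhoff \<phi> (cube m) x) / (real N * exp (3 * E) * partition_function X \<phi> (cube m)) / ?c r)
    = birkhoff \<phi> (cube m) x - (ln (real N) + 3 * E + ln (partition_function X \<phi> (cube m))) - ln (?c r)"
    using N partition_function\<phi> card_cube_pos[of r, where 'd = 'd] by (simp add: ln_mult ln_div)
  \<comment> \<open>In this direction the finite cube must not exceed the pressure by much; the
    hypothesis \<open>pressure\<close> costs the fourth \<open>E\<close>.\<close>
  ultimately have 2: "B - (ln (real N) + 4 * E + ln (?c r)) \<le> ln (measure \<nu> (cylinder X m x))"
    using pressure by (simp add: B_def)
  have "0 \<le> ln (?c r)" using card_cube_pos[of r, where 'd = 'd] by (simp add: Suc_le_eq)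
  then show "\<bar>ln (measure \<nu> (cylinder X m x)) - (birkhoff \<phi> (cube m) x - v * ?P)\<bar> \<le> ln (real N) + 4 * E + ln (?c r)"
    using 1 2 Epos unfolding B_def[symmetric] by linarith
qed

end

section \<open>Absolutely summable potentials\<close>

text \<open>The index sets of the interactions that couple \<open>S\<close> with its complement.
  Energies inside \<open>S\<close> feel the outside through these sets only.\<close>

definition boundary :: "(int ^ 'd) set \<Rightarrow> (int ^ 'd) set set"
  where "boundary S = {A. finite A \<and> A \<inter> S \<noteq> {} \<and> \<not> A \<subseteq> S}"

lemma boundary_Compl: "boundary (- S) = boundary S"
  by (auto simp: boundary_def)

lemma has_sum_sum:
  fixes h :: "'i \<Rightarrow> 'b \<Rightarrow> real"
  assumes "\<And>i. i \<in> I \<Longrightarrow> (h i has_sum s i) B"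
  shows "((\<lambda>b. \<Sum>i\<in>I. h i b) has_sum (\<Sum>i\<in>I. s i)) B"
  using assms by (induction I rule: infinite_finite_induct) (auto intro: has_sum_add)

locale shift_potential = finite_shift \<A> X
  for \<A> :: "'a::discrete_topology set" and X :: "('d::finite, 'a) config set" +
  fixes \<Phi> :: "(int ^ 'd) set \<Rightarrow> ('d, 'a) config \<Rightarrow> real"
  assumes potential: "\<Phi> \<in> potentials X"
begin

abbreviation nrm :: "(int ^ 'd) set \<Rightarrow> real" where "nrm A \<equiv> sup_norm_on X (\<Phi> A)"

section \<open>Norms of interactions and their translation invariance\<close>

lemma continuous_potential: "finite A \<Longrightarrow> A \<noteq> {} \<Longrightarrow> continuous_on X (\<Phi> A)"
  and local_potential: "finite A \<Longrightarrow> A \<noteq> {} \<Longrightarrow> x \<in> X \<Longrightarrow> y \<in> X \<Longrightarrow> (\<forall>k\<in>A. x k = y k) \<Longrightarrow> \<Phi> A x = \<Phi> A y"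
  and translate_potential: "finite A \<Longrightarrow> A \<noteq> {} \<Longrightarrow> x \<in> X \<Longrightarrow> \<Phi> A (shift a x) = \<Phi> ((\<lambda>k. k + a) ` A) x"
  and summable_nrm_0: "nrm summable_on {A. finite A \<and> 0 \<in> A}"
  using potential[unfolded potentials_def mem_Collect_eq restrict_eq_iff] by blast+

lemma bdd_above_potential: "finite A \<Longrightarrow> A \<noteq> {} \<Longrightarrow> bdd_above ((\<lambda>x. \<bar>\<Phi> A x\<bar>) ` X)"
  using bounded_continuous[OF continuous_potential] by (metis bdd_aboveI2)

lemma abs_potential_le: "finite A \<Longrightarrow> A \<noteq> {} \<Longrightarrow> x \<in> X \<Longrightarrow> \<bar>\<Phi> A x\<bar> \<le> nrm A"
  unfolding sup_norm_on_def by (intro cSUP_upper bdd_above_potential)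

lemma nrm_nonneg: "finite A \<Longrightarrow> A \<noteq> {} \<Longrightarrow> 0 \<le> nrm A"
  using abs_potential_le nonempty by (meson abs_ge_zero ex_in_conv order_trans)

lemma nrm_translate:
  assumes "finite A" "A \<noteq> {}"
  shows "nrm ((\<lambda>k. k + a) ` A) = nrm A"
proof -
  have "(\<lambda>x. \<bar>\<Phi> ((\<lambda>k. k + a) ` A) x\<bar>) ` X = (\<lambda>x. \<bar>\<Phi> A x\<bar>) ` X"
  proof (intro equalityI image_subsetI)
    fix x assume "x \<in> X"
    then show "\<bar>\<Phi> ((\<lambda>k. k + a) ` A) x\<bar> \<in> (\<lambda>x. \<bar>\<Phi> A x\<bar>) ` X"
      using translate_potential[OF assms, of x a] shift_mem by (metis image_eqI)
  next
    fix x assume x: "x \<in> X"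
    then have "\<bar>\<Phi> A x\<bar> = \<bar>\<Phi> ((\<lambda>k. k + a) ` A) (shift (- a) x)\<bar>"
      using translate_potential[OF assms shift_mem[OF x], of a "- a"] by (simp add: shift_shift)
    then show "\<bar>\<Phi> A x\<bar> \<in> (\<lambda>x. \<bar>\<Phi> ((\<lambda>k. k + a) ` A) x\<bar>) ` X"
      using shift_mem[OF x] by blast
  qed
  then show ?thesis by (simp only: sup_norm_on_def)
qed

lemma bij_translate_sets:
  "bij_betw (image (\<lambda>k. k + j)) {A :: (int ^ 'd) set. finite A \<and> 0 \<in> A} {A. finite A \<and> j \<in> A}"
proof (rule bij_betwI[where g = "image (\<lambda>k. k - j)"])
  show "image (\<lambda>k. k + j) \<in> {A. finite A \<and> 0 \<in> A} \<rightarrow> {A. finite A \<and> j \<in> A}"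
    by force
  show "image (\<lambda>k. k - j) \<in> {A. finite A \<and> j \<in> A} \<rightarrow> {A. finite A \<and> 0 \<in> A}"
    by force
qed (simp_all add: image_image)

lemma summable_nrm_at: "nrm summable_on {A. finite A \<and> j \<in> A}"
proof -
  have "(\<lambda>A. nrm ((\<lambda>k. k + j) ` A)) summable_on {A. finite A \<and> 0 \<in> A}"
    using summable_nrm_0
    by (rule summable_on_cong[THEN iffD1, rotated]) (metis (mono_tags) empty_iff mem_Collect_eq nrm_translate)
  then show ?thesis
    using summable_on_reindex_bij_betw[OF bij_translate_sets, of nrm j] by simp
qed

lemma abs_term_le:
  assumes "finite A" "A \<noteq> {}" "x \<in> X"
  shows "\<bar>\<Phi> A x / real (card A)\<bar> \<le> nrm A"
proof -
  have "1 \<le> real (card A)" using assms by (simp add: Suc_le_eq card_gt_0_iff)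
  then have "\<bar>\<Phi> A x / real (card A)\<bar> \<le> \<bar>\<Phi> A x\<bar> / 1"
    unfolding abs_divide by (intro frac_le) auto
  then show ?thesis using abs_potential_le[OF assms] by simp
qed

text \<open>Translation by \<open>j\<close> is moved from the configuration to the index sets. The
  terms of a Birkhoff sum thereby become series of values at the same \<open>x\<close>, each over
  the sets containing its site.\<close>

lemma has_sum_energy_shift:
  assumes "x \<in> X"
  shows "((\<lambda>A. \<Phi> A x / real (card A)) has_sum energy \<Phi> (shift j x)) {A. finite A \<and> j \<in> A}"
proof -
  have "(\<lambda>A. \<Phi> A x / real (card A)) summable_on {A. finite A \<and> j \<in> A}"
    by (rule abs_summable_summable, rule Infinite_Sum.abs_summable_on_comparison_test'[OF summable_nrm_at])
       (use abs_term_le assms in force)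
  moreover have "infsum (\<lambda>A. \<Phi> A x / real (card A)) {A. finite A \<and> j \<in> A} = energy \<Phi> (shift j x)"
  proof -
    have "infsum (\<lambda>A. \<Phi> A x / real (card A)) {A. finite A \<and> j \<in> A} =
        infsum (\<lambda>A. \<Phi> ((\<lambda>k. k + j) ` A) x / real (card ((\<lambda>k. k + j) ` A))) {A. finite A \<and> 0 \<in> A}"
      by (rule infsum_reindex_bij_betw[OF bij_translate_sets, symmetric])
    also have "... = energy \<Phi> (shift j x)"
      unfolding energy_def
    proof (rule infsum_cong)
      fix A :: "(int ^ 'd) set" assume A: "A \<in> {A. finite A \<and> 0 \<in> A}"
      have "card ((\<lambda>k. k + j) ` A) = card A" by (rule card_image) simp
      moreover have "\<Phi> ((\<lambda>k. k + j) ` A) x = \<Phi> A (shift j x)"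
        using A by (intro translate_potential[symmetric] assms) auto
      ultimately show "\<Phi> ((\<lambda>k. k + j) ` A) x / real (card ((\<lambda>k. k + j) ` A)) = \<Phi> A (shift j x) / real (card A)"
        by simp
    qed
    finally show ?thesis .
  qed
  ultimately show ?thesis by (simp only: has_sum_iff)
qed

lemma continuous_energy: "continuous_on X (energy \<Phi>)"
proof (rule uniform_limit_theorem)
  show "uniform_limit X (\<lambda>F x. \<Sum>A\<in>F. \<Phi> A x / real (card A)) (energy \<Phi>)
      (finite_subsets_at_top {A. finite A \<and> 0 \<in> A})"
    unfolding energy_def
    by (rule Weierstrass_m_test_general[OF _ summable_nrm_0]) (use abs_term_le in force)
  show "\<forall>\<^sub>F F in finite_subsets_at_top {A. finite A \<and> 0 \<in> A}.
      continuous_on X (\<lambda>x. \<Sum>A\<in>F. \<Phi> A x / real (card A))"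
  proof (rule eventually_finite_subsets_at_top_weakI)
    fix F :: "(int ^ 'd) set set" assume "F \<subseteq> {A. finite A \<and> 0 \<in> A}"
    then have "finite A" "A \<noteq> {}" if "A \<in> F" for A using that by auto
    then show "continuous_on X (\<lambda>x. \<Sum>A\<in>F. \<Phi> A x / real (card A))"
      by (intro continuous_on_sum continuous_on_divide continuous_potential continuous_on_const) (auto simp: card_gt_0_iff)
  qed
qed simp

text \<open>A set inside \<open>S\<close> contributes nothing to the difference. Any other set
  meeting \<Lambda> crosses the boundary of \<open>S\<close>; it occurs once for each of its sites
  in \<Lambda>, and the weight 1 / card A in \<open>energy\<close> absorbs this multiplicity. So it
  contributes at most twice its norm, whatever \<Lambda> is.\<close>

proposition agreement_bound_energy:
  assumes "nrm summable_on boundary S"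
  shows "agreement_bound X (energy \<Phi>) S (2 * infsum nrm (boundary S))"
  unfolding agreement_bound_def
proof (intro ballI impI allI, elim conjE)
  fix x y \<Lambda> assume xy: "x \<in> X" "y \<in> X" "\<forall>k\<in>S. x k = y k" and \<Lambda>: "finite \<Lambda>" "\<Lambda> \<subseteq> S"
  \<comment> \<open>Extension by 0 lets the series of all sites run over the same family of sets, so
    that they can be added termwise.\<close>
  define h where "h j A = (if j \<in> A then (\<Phi> A x - \<Phi> A y) / real (card A) else 0)"
    for j :: "int ^ 'd" and A :: "(int ^ 'd) set"
  have h: "(h j has_sum (energy \<Phi> (shift j x) - energy \<Phi> (shift j y))) (boundary S)" if "j \<in> \<Lambda>" for j
  proof -
    have "((\<lambda>A. \<Phi> A x / real (card A) + - (\<Phi> A y / real (card A)))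
        has_sum (energy \<Phi> (shift j x) + - energy \<Phi> (shift j y))) {A. finite A \<and> j \<in> A}"
      by (intro has_sum_add has_sum_uminusI has_sum_energy_shift xy)
    moreover have "((\<lambda>A. \<Phi> A x / real (card A) + - (\<Phi> A y / real (card A))) has_sum s) {A. finite A \<and> j \<in> A}
        \<longleftrightarrow> (h j has_sum s) (boundary S)" for s
    proof (rule has_sum_cong_neutral)
      fix A assume A: "A \<in> {A. finite A \<and> j \<in> A} - boundary S"
      then have "A \<subseteq> S" using that \<Lambda> by (auto simp: boundary_def)
      then have "\<Phi> A x = \<Phi> A y" using A xy by (intro local_potential) auto
      then show "\<Phi> A x / real (card A) + - (\<Phi> A y / real (card A)) = 0" by simp
    qed (auto simp: h_def boundary_def diff_divide_distrib)
    ultimately show ?thesis by simp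
  qed
  have "((\<lambda>A. \<Sum>j\<in>\<Lambda>. h j A) has_sum (\<Sum>j\<in>\<Lambda>. energy \<Phi> (shift j x) - energy \<Phi> (shift j y))) (boundary S)"
    using h by (intro has_sum_sum) auto
  moreover have "((\<lambda>A. 2 * nrm A) has_sum (2 * infsum nrm (boundary S))) (boundary S)"
    by (intro has_sum_cmult_right has_sum_infsum assms)
  moreover have "norm (\<Sum>j\<in>\<Lambda>. h j A) \<le> 2 * nrm A" if "A \<in> boundary S" for A
  proof -
    have A: "finite A" "A \<noteq> {}" using that by (auto simp: boundary_def)
    have cA: "real (card A) > 0" using A by (simp add: card_gt_0_iff)
    have "\<Lambda> \<inter> A \<subseteq> A" by simp
    then have "card (\<Lambda> \<inter> A) \<le> card A" by (rule card_mono[OF A(1)])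
    then have c\<Lambda>: "real (card (\<Lambda> \<inter> A)) \<le> real (card A)" by simp
    have "norm (\<Sum>j\<in>\<Lambda>. h j A) \<le> (\<Sum>j\<in>\<Lambda>. \<bar>h j A\<bar>)" by (simp add: sum_abs)
    also have "... = (\<Sum>j\<in>\<Lambda> \<inter> A. \<bar>\<Phi> A x - \<Phi> A y\<bar> / real (card A))"
      using \<Lambda> by (intro sum.mono_neutral_cong_right) (auto simp: h_def)
    also have "... \<le> real (card A) * (\<bar>\<Phi> A x - \<Phi> A y\<bar> / real (card A))"
      unfolding sum_constant by (rule mult_right_mono[OF c\<Lambda>]) simp
    also have "... = \<bar>\<Phi> A x - \<Phi> A y\<bar>" using cA by simp
    also have "... \<le> 2 * nrm A"
      using abs_potential_le[OF A xy(1)] abs_potential_le[OF A xy(2)] by linarith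
    finally show ?thesis .
  qed
  ultimately have "norm (\<Sum>j\<in>\<Lambda>. energy \<Phi> (shift j x) - energy \<Phi> (shift j y)) \<le> 2 * infsum nrm (boundary S)"
    by (rule norm_infsum_le)
  then show "\<bar>birkhoff (energy \<Phi>) \<Lambda> x - birkhoff (energy \<Phi>) \<Lambda> y\<bar> \<le> 2 * infsum nrm (boundary S)"
    by (simp add: birkhoff_def sum_subtractf)
qed

text \<open>Finitely many sets carry the whole norm up to \<epsilon>, and one cube contains them
  all.\<close>

lemma nrm_tail_small:
  assumes "\<epsilon> > 0"
  obtains R where "infsum nrm {A. finite A \<and> 0 \<in> A \<and> \<not> A \<subseteq> cube R} < \<epsilon>"
proof -
  let ?I = "{A :: (int ^ 'd) set. finite A \<and> 0 \<in> A}"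
  have "(sum nrm \<longlongrightarrow> infsum nrm ?I) (finite_subsets_at_top ?I)"
    using summable_nrm_0 by (simp add: has_sum_def[symmetric])
  then have "\<forall>\<^sub>F F in finite_subsets_at_top ?I. dist (sum nrm F) (infsum nrm ?I) < \<epsilon>"
    using assms by (rule tendstoD)
  then obtain F where F: "finite F" "F \<subseteq> ?I" "dist (sum nrm F) (infsum nrm ?I) < \<epsilon>"
    unfolding eventually_finite_subsets_at_top by blast
  define R where "R = Max (insert 0 ((\<lambda>p. nat \<bar>fst p $ snd p\<bar>) ` (\<Union>F \<times> UNIV)))"
  have fin: "finite (insert 0 ((\<lambda>p. nat \<bar>fst p $ snd p\<bar>) ` (\<Union>F \<times> (UNIV :: 'd set))))"
    using F by (auto intro!: finite_imageI finite_SigmaI)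
  have sub: "A \<subseteq> cube R" if "A \<in> F" for A
  proof
    fix k assume "k \<in> A"
    then have "nat \<bar>k $ i\<bar> \<le> R" for i
      unfolding R_def using that by (intro Max_ge fin) force
    then show "k \<in> cube R" by (simp add: cube_def nat_le_iff)
  qed
  have summ: "nrm summable_on ?I - F" by (rule summable_on_subset_banach[OF summable_nrm_0]) auto
  have "infsum nrm {A. finite A \<and> 0 \<in> A \<and> \<not> A \<subseteq> cube R} \<le> infsum nrm (?I - F)"
    using sub by (intro infsum_mono2 summable_on_subset_banach[OF summable_nrm_0] nrm_nonneg) auto
  also have "... = infsum nrm ?I - sum nrm F"
    using infsum_Diff[OF summable_nrm_0 _ F(2)] F by (simp add: summable_on_finite)
  also have "... < \<epsilon>" using F(3) by (simp add: dist_real_def)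
  finally show thesis by (rule that)
qed

text \<open>Charge a crossing set to one of its sites in \<open>cube M\<close>. Seen from a site of
  \<open>cube (M - R)\<close> it leaves the cube of radius \<open>R\<close>, so it belongs to the
  tail of the norm; the sites of the remaining shell are charged the full norm.\<close>

lemma boundary_cube:
  assumes "R \<le> M"
  shows "nrm summable_on boundary (cube M)"
    and "infsum nrm (boundary (cube M)) \<le>
      real (card (cube M :: (int ^ 'd) set)) * infsum nrm {A. finite A \<and> 0 \<in> A \<and> \<not> A \<subseteq> cube R} +
      (real (card (cube M :: (int ^ 'd) set)) - real (card (cube (M - R) :: (int ^ 'd) set))) *
        infsum nrm {A. finite A \<and> 0 \<in> A}"
proof -
  let ?V = "cube M :: (int ^ 'd) set" and ?U = "cube (M - R) :: (int ^ 'd) set"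
  let ?I = "\<lambda>i. {A :: (int ^ 'd) set. finite A \<and> i \<in> A}"
  let ?T = "infsum nrm {A. finite A \<and> 0 \<in> A \<and> \<not> A \<subseteq> cube R}" and ?Q = "infsum nrm (?I 0)"
  define h where "h i A = (if i \<in> A then nrm A else 0)" for i :: "int ^ 'd" and A
  have h_iff: "h i summable_on boundary ?V \<longleftrightarrow> nrm summable_on {A \<in> ?I i. \<not> A \<subseteq> ?V}"
    and h_sum: "infsum (h i) (boundary ?V) = infsum nrm {A \<in> ?I i. \<not> A \<subseteq> ?V}" if "i \<in> ?V" for i
    by (rule summable_on_cong_neutral infsum_cong_neutral; use that in \<open>force simp: h_def boundary_def\<close>)+
  have h_summable: "h i summable_on boundary ?V" if "i \<in> ?V" for i
    unfolding h_iff[OF that] by (rule summable_on_subset_banach[OF summable_nrm_at[of i]]) auto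
  have Hs: "((\<lambda>A. \<Sum>i\<in>?V. h i A) has_sum (\<Sum>i\<in>?V. infsum (h i) (boundary ?V))) (boundary ?V)"
    using h_summable by (intro has_sum_sum has_sum_infsum) auto
  then have H: "(\<lambda>A. \<Sum>i\<in>?V. h i A) summable_on boundary ?V" by (rule has_sum_imp_summable)
  have le: "nrm A \<le> (\<Sum>i\<in>?V. h i A)" if A: "A \<in> boundary ?V" for A
  proof -
    obtain i where i: "i \<in> A" "i \<in> ?V" using A by (auto simp: boundary_def)
    have "h i A \<le> (\<Sum>i\<in>?V. h i A)"
      using A by (intro member_le_sum i) (auto simp: h_def boundary_def intro!: nrm_nonneg)
    then show ?thesis using i by (simp add: h_def)
  qed
  show summ: "nrm summable_on boundary ?V"
    by (rule summable_on_comparison_test[OF H le]) (auto simp: boundary_def intro!: nrm_nonneg)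
  have all: "infsum (h i) (boundary ?V) \<le> ?Q" if "i \<in> ?V" for i
  proof -
    have "infsum nrm {A \<in> ?I i. \<not> A \<subseteq> ?V} \<le> infsum nrm (?I i)"
      by (intro infsum_mono2 summable_on_subset_banach[OF summable_nrm_at[of i]] nrm_nonneg) auto
    also have "... = ?Q"
      by (subst infsum_reindex_bij_betw[OF bij_translate_sets, symmetric], rule infsum_cong)
         (metis (mono_tags) empty_iff mem_Collect_eq nrm_translate)
    finally show ?thesis by (simp add: h_sum that)
  qed
  have inner: "infsum (h i) (boundary ?V) \<le> ?T" if i: "i \<in> ?U" for i
  proof -
    have iV: "i \<in> ?V" using i cube_mono[of "M - R" M] by auto
    have "infsum nrm {A \<in> ?I i. \<not> A \<subseteq> ?V} \<le> infsum nrm {A. finite A \<and> i \<in> A \<and> \<not> (\<lambda>k. k - i) ` A \<subseteq> cube R}"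
    proof (intro infsum_mono2 summable_on_subset_banach[OF summable_nrm_at[of i]] nrm_nonneg)
      show "{A \<in> ?I i. \<not> A \<subseteq> ?V} \<subseteq> {A. finite A \<and> i \<in> A \<and> \<not> (\<lambda>k. k - i) ` A \<subseteq> cube R}"
      proof clarify
        fix A k assume A: "(\<lambda>k. k - i) ` A \<subseteq> cube R" "k \<in> A" "k \<notin> ?V"
        then have "k - i \<in> cube R" by auto
        moreover have "\<forall>a. \<bar>i $ a\<bar> + int R \<le> int M"
          using i assms by (simp add: cube_def of_nat_diff le_diff_eq)
        ultimately have "(k - i) + i \<in> ?V" by (intro cube_add_subset(1))
        then show False using A by simp
      qed
    qed auto
    also have "... = ?T"
    proof -
      have "nrm ((\<lambda>k. k - i) ` A) = nrm A" if "finite A" "i \<in> A" for A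
        using nrm_translate[of A "- i"] that by auto
      then show ?thesis
        by (intro infsum_reindex_bij_witness[of _ "image (\<lambda>k. k + i)" "image (\<lambda>k. k - i)"])
           (auto simp: image_image)
    qed
    finally show ?thesis by (simp add: h_sum iV)
  qed
  have T0: "0 \<le> ?T" by (intro infsum_nonneg nrm_nonneg) auto
  have sub: "?U \<subseteq> ?V" by (rule cube_mono) simp
  have "infsum nrm (boundary ?V) \<le> infsum (\<lambda>A. \<Sum>i\<in>?V. h i A) (boundary ?V)"
    by (rule infsum_mono[OF summ H le])
  also have "... = (\<Sum>i\<in>?V. infsum (h i) (boundary ?V))"
    by (rule infsumI[OF Hs])
  also have "... = (\<Sum>i\<in>?V - ?U. infsum (h i) (boundary ?V)) + (\<Sum>i\<in>?U. infsum (h i) (boundary ?V))"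
    by (rule sum.subset_diff[OF sub finite_cube])
  also have "... \<le> real (card (?V - ?U)) * ?Q + real (card ?U) * ?T"
    using all inner by (intro add_mono sum_bounded_above) auto
  also have "... \<le> real (card (?V - ?U)) * ?Q + real (card ?V) * ?T"
    using T0 card_mono[OF finite_cube sub] by (intro add_left_mono mult_right_mono) auto
  also have "real (card (?V - ?U)) = real (card ?V) - real (card ?U)"
    using card_mono[OF finite_cube sub] by (simp add: card_Diff_subset[OF finite_cube sub] of_nat_diff)
  finally show "infsum nrm (boundary ?V) \<le> real (card ?V) * ?T + (real (card ?V) - real (card ?U)) * ?Q"
    by simp
qed

text \<open>First \<epsilon> fixes \<open>R\<close> through the tail, then the shell of width
  \<open>R\<close> has vanishing proportion.\<close>

lemma boundary_cube_small:
  assumes "\<epsilon> > 0"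
  shows "\<forall>\<^sub>F M in sequentially. infsum nrm (boundary (cube M)) \<le> \<epsilon> * real (card (cube M :: (int ^ 'd) set))"
proof -
  let ?c = "\<lambda>n. real (card (cube n :: (int ^ 'd) set))"
  let ?Q = "infsum nrm {A. finite A \<and> 0 \<in> A}"
  obtain R where R: "infsum nrm {A. finite A \<and> 0 \<in> A \<and> \<not> A \<subseteq> cube R} < \<epsilon>" (is "?T < \<epsilon>")
    using nrm_tail_small[OF assms] .
  have "(\<lambda>M. ?T + (1 - ?c (M - R) / ?c M) * ?Q) \<longlonglongrightarrow> ?T + (1 - 1) * ?Q"
    by (intro tendsto_intros bulk_ratio)
  then have "\<forall>\<^sub>F M in sequentially. ?T + (1 - ?c (M - R) / ?c M) * ?Q < \<epsilon>"
    using R by (intro order_tendstoD(2)) auto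
  then show ?thesis using eventually_ge_at_top[of R]
  proof eventually_elim
    case (elim M)
    have "infsum nrm (boundary (cube M)) \<le> (?T + (1 - ?c (M - R) / ?c M) * ?Q) * ?c M"
    proof -
      have "(?T + (1 - ?c (M - R) / ?c M) * ?Q) * ?c M = ?c M * ?T + (?c M - ?c (M - R)) * ?Q"
        by (simp add: algebra_simps)
      then show ?thesis using boundary_cube(2)[OF elim(2)] by simp
    qed
    also have "... \<le> \<epsilon> * ?c M" using elim by (intro mult_right_mono) auto
    finally show ?case .
  qed
qed

text \<open>A set crossing the end of the half-line either meets \<open>cube M\<close>, and then
  crosses its boundary, or jumps over it from one side to the other. The latter avoids [-1, 1]
  because \<open>1 \<le> M\<close>, so the straddling sum counts it; absolute summability alone does
  not bound the total of such jumps.\<close>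

lemma boundary_half_line:
  assumes d: "CARD('d) = 1" and straddling: "straddling_summable X \<Phi>" and "1 \<le> M"
    and S: "S = sites {..<- int M} \<or> S = sites {int M<..}"
  shows "nrm summable_on boundary S"
    and "infsum nrm (boundary S) \<le> infsum nrm (boundary (cube M)) +
      infsum nrm {A. finite A \<and> A \<subseteq> - sites {-1..1} \<and> A \<inter> sites {..<-1} \<noteq> {} \<and> A \<inter> sites {1<..} \<noteq> {}}"
proof -
  let ?B = "boundary (cube M :: (int ^ 'd) set)"
  let ?T = "{A :: (int ^ 'd) set. finite A \<and> A \<subseteq> - sites {-1..1} \<and> A \<inter> sites {..<-1} \<noteq> {} \<and> A \<inter> sites {1<..} \<noteq> {}}"
  obtain a :: 'd where a: "UNIV = {a}" using d by (rule card_1_singletonE)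
  then have all: "(\<forall>i. P i) \<longleftrightarrow> P a" for P :: "'d \<Rightarrow> bool" by (metis UNIV_I singletonD)
  \<comment> \<open>Subtracting \<open>?B\<close> makes the union disjoint, so that the two series
    simply add.\<close>
  have sub: "boundary S \<subseteq> ?B \<union> (?T - ?B)"
  proof
    fix A assume A: "A \<in> boundary S"
    then obtain k l where kl: "finite A" "k \<in> A" "k \<in> S" "l \<in> A" "l \<notin> S" by (auto simp: boundary_def)
    show "A \<in> ?B \<union> (?T - ?B)"
    proof (cases "A \<inter> cube M = {}")
      case False
      moreover have "k \<notin> cube M" using kl S by (auto simp: cube_def sites_def all)
      ultimately show ?thesis using kl by (auto simp: boundary_def)
    next
      case True
      have "sites {-1..1} \<subseteq> (cube M :: (int ^ 'd) set)" using \<open>1 \<le> M\<close> by (auto simp: sites_def cube_def all)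
      then have "A \<subseteq> - sites {-1..1}" using True by blast
      moreover have lM: "l \<notin> cube M" using True kl by blast
      moreover have "A \<inter> sites {..<-1} \<noteq> {} \<and> A \<inter> sites {1<..} \<noteq> {}"
        using S
      proof
        assume S: "S = sites {..<- int M}"
        have "l \<in> sites {1<..}" using kl S lM \<open>1 \<le> M\<close> by (auto simp: sites_def cube_def all)
        moreover have "k \<in> sites {..<-1}" using kl S \<open>1 \<le> M\<close> by (auto simp: sites_def all)
        ultimately show ?thesis using kl by blast
      next
        assume S: "S = sites {int M<..}"
        have "l \<in> sites {..<-1}" using kl S lM \<open>1 \<le> M\<close> by (auto simp: sites_def cube_def all)
        moreover have "k \<in> sites {1<..}" using kl S \<open>1 \<le> M\<close> by (auto simp: sites_def all)
        ultimately show ?thesis using kl by blast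
      qed
      ultimately show ?thesis using kl True by (auto simp: boundary_def)
    qed
  qed
  have B: "nrm summable_on ?B" by (rule boundary_cube(1)[OF le0])
  have T: "nrm summable_on ?T" using straddling by (simp add: straddling_summable_def)
  have TB: "nrm summable_on (?T - ?B)" by (rule summable_on_subset_banach[OF T]) auto
  have BT: "nrm summable_on ?B \<union> (?T - ?B)" by (rule summable_on_Un_disjoint[OF B TB]) auto
  have nonneg: "0 \<le> nrm A" if "A \<in> ?B \<union> ?T" for A using that by (intro nrm_nonneg) (auto simp: boundary_def)
  show "nrm summable_on boundary S" by (rule summable_on_subset_banach[OF BT sub])
  then have "infsum nrm (boundary S) \<le> infsum nrm (?B \<union> (?T - ?B))"
    using nonneg by (intro infsum_mono2 BT sub) auto
  also have "... = infsum nrm ?B + infsum nrm (?T - ?B)"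
    by (rule infsum_Un_disjoint[OF B TB]) auto
  also have "infsum nrm (?T - ?B) \<le> infsum nrm ?T"
    using nonneg by (intro infsum_mono2 TB T) auto
  finally show "infsum nrm (boundary S) \<le> infsum nrm ?B + infsum nrm ?T" by simp
qed

end

section \<open>Splicing under decoupling conditions\<close>

lemma agreement_boundD:
  assumes "agreement_bound X g S b" "x \<in> X" "y \<in> X" "\<forall>k\<in>S. x k = y k" "finite \<Lambda>" "\<Lambda> \<subseteq> S"
  shows "\<bar>birkhoff g \<Lambda> x - birkhoff g \<Lambda> y\<bar> \<le> b"
  using assms unfolding agreement_bound_def by blast

context finite_shift
begin

lemma abs_birkhoff_le:
  assumes "\<forall>x\<in>X. \<bar>g x\<bar> \<le> C" "x \<in> X"
  shows "\<bar>birkhoff g \<Lambda> x\<bar> \<le> C * real (card \<Lambda>)"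
proof -
  have "\<bar>birkhoff g \<Lambda> x\<bar> \<le> (\<Sum>k\<in>\<Lambda>. C)"
    unfolding birkhoff_def using assms by (intro order_trans[OF sum_abs] sum_mono) (auto simp: shift_mem)
  then show ?thesis by (simp add: mult.commute)
qed

text \<open>The indicator at \<open>shift j y\<close> sees only the window at \<open>j\<close>.
  Windows inside \<open>S\<close> show no difference, and each exceptional site in \<open>F\<close>
  costs at most 1.\<close>

lemma agreement_bound_indicator:
  assumes "finite F" "\<And>j. j \<in> S \<Longrightarrow> j \<notin> F \<Longrightarrow> (\<lambda>i. i + j) ` cube m \<subseteq> S"
  shows "agreement_bound X (indicat_real (cylinder X m x)) S (real (card F))"
  unfolding agreement_bound_def
proof (intro ballI impI allI, elim conjE)
  fix y z \<Lambda> assume yz: "y \<in> X" "z \<in> X" "\<forall>k\<in>S. y k = z k" and \<Lambda>: "finite \<Lambda>" "\<Lambda> \<subseteq> S"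
  let ?f = "indicat_real (cylinder X m x)"
  have "?f (shift j y) = ?f (shift j z)" if j: "j \<in> \<Lambda> - F" for j
  proof -
    have "\<forall>i\<in>cube m. shift j y i = shift j z i"
      using assms(2)[of j] j \<Lambda> yz(3) by (auto simp: shift_def)
    then show ?thesis using yz by (simp add: indicator_def mem_cylinder_iff shift_mem)
  qed
  then have "birkhoff ?f \<Lambda> y - birkhoff ?f \<Lambda> z = (\<Sum>j\<in>\<Lambda> \<inter> F. ?f (shift j y) - ?f (shift j z))"
    unfolding birkhoff_def sum_subtractf[symmetric] using \<Lambda> by (intro sum.mono_neutral_right) auto
  also have "\<bar>...\<bar> \<le> (\<Sum>j\<in>\<Lambda> \<inter> F. 1)"
    by (intro order_trans[OF sum_abs] sum_mono) (auto simp: indicator_def)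
  also have "... \<le> real (card F)" using assms(1) by (simp add: card_mono)
  finally show "\<bar>birkhoff ?f \<Lambda> y - birkhoff ?f \<Lambda> z\<bar> \<le> real (card F)" .
qed

text \<open>The decoupling conditions speak of a window at the origin. Conjugation with
  \<open>shift k\<close> brings the window at \<open>k\<close> there and turns \<open>cube n\<close>
  into \<Lambda>, the cube as seen from \<open>k\<close>.\<close>

lemma splicing_centered:
  fixes k :: "int ^ 'd" and n m r :: nat and z :: "('d, 'a) config \<Rightarrow> ('d, 'a) config \<Rightarrow> ('d, 'a) config"
    and lab :: "('d, 'a) config \<Rightarrow> ('d, 'a) config \<Rightarrow> int \<times> int \<times> (int ^ 'd) \<times> ('d, 'a) config"
  defines "\<Lambda> \<equiv> (\<lambda>i. i - k) ` cube n"
  assumes L: "finite L" "card L \<le> N"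
    and z: "\<And>w y. w \<in> X \<Longrightarrow> y \<in> X \<Longrightarrow> z w y \<in> X" "\<And>w y. w \<in> X \<Longrightarrow> y \<in> X \<Longrightarrow> lab w y \<in> L"
      "\<And>w y. w \<in> X \<Longrightarrow> y \<in> X \<Longrightarrow> \<exists>l\<in>cube r. \<forall>i\<in>cube m. z w y (i + l) = y i"
    and decode: "\<And>w y w' y'. w \<in> X \<Longrightarrow> y \<in> X \<Longrightarrow> w' \<in> X \<Longrightarrow> y' \<in> X \<Longrightarrow> lab w y = lab w' y' \<Longrightarrow>
      \<forall>i\<in>\<Lambda>. z w y i = z w' y' i \<Longrightarrow> (\<forall>i\<in>\<Lambda> - cube m. w i = w' i) \<and> (\<forall>i\<in>cube m. y i = y' i)"
    and energy: "\<And>g b C w y. \<forall>x\<in>X. \<bar>g x\<bar> \<le> C \<Longrightarrow> \<forall>S\<in>\<S>. agreement_bound X g S b \<Longrightarrow> w \<in> X \<Longrightarrow> y \<in> X \<Longrightarrow>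
      \<bar>birkhoff g \<Lambda> (z w y) - birkhoff g (cube m) y - birkhoff g (\<Lambda> - cube m) w\<bar> \<le> 4 * b + C * c"
  shows "splicing X \<S> m r c N n k"
  unfolding splicing_def
proof (rule exI[of _ "\<lambda>w y. shift (- k) (z (shift k w) y)"], rule exI[of _ "\<lambda>w y. lab (shift k w) y"],
    rule exI[of _ L], intro conjI ballI allI impI)
  let ?Z = "\<lambda>w y. shift (- k) (z (shift k w) y)"
  let ?lab = "\<lambda>w y. lab (shift k w) y"
  have \<Lambda>: "i \<in> \<Lambda> \<longleftrightarrow> i + k \<in> cube n" for i
    unfolding \<Lambda>_def by (auto simp: image_iff intro: bexI[of _ "i + k"])
  show "finite L" "card L \<le> N" by (rule L)+
  show "?Z w y \<in> X" "?lab w y \<in> L" if "w \<in> X" "y \<in> X" for w y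
    using that by (auto intro!: z shift_mem)
  show "\<exists>l\<in>cube r. \<forall>i\<in>cube m. ?Z w y (i + (k + l)) = y i" if wy: "w \<in> X" "y \<in> X" for w y
    using z(3)[OF shift_mem[OF wy(1)] wy(2), of k] by (simp add: shift_def algebra_simps)
  fix w y w' y' assume X: "w \<in> X" "y \<in> X" "w' \<in> X" "y' \<in> X"
    and eq: "?lab w y = ?lab w' y' \<and> (\<forall>i\<in>cube n. ?Z w y i = ?Z w' y' i)"
  have "\<forall>i\<in>\<Lambda>. z (shift k w) y i = z (shift k w') y' i"
  proof
    fix i assume "i \<in> \<Lambda>"
    then have "i + k \<in> cube n" by (simp add: \<Lambda>)
    then have "?Z w y (i + k) = ?Z w' y' (i + k)" using eq by blast
    then show "z (shift k w) y i = z (shift k w') y' i" by (simp add: shift_def)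
  qed
  from decode[OF shift_mem[OF X(1)] X(2) shift_mem[OF X(3)] X(4) _ this] eq
  have dec: "\<forall>i\<in>\<Lambda> - cube m. shift k w i = shift k w' i" "\<forall>i\<in>cube m. y i = y' i" by auto
  show "w i = w' i" if i: "i \<in> cube n - (\<lambda>i. i + k) ` cube m" for i
  proof -
    have "i - k \<in> \<Lambda> - cube m" using i by (auto simp: \<Lambda> image_iff)
    from bspec[OF dec(1) this] show ?thesis by (simp add: shift_def)
  qed
  show "y i = y' i" if "i \<in> cube m" for i using dec(2) that by blast
next
  let ?Z = "\<lambda>w y. shift (- k) (z (shift k w) y)"
  fix g :: "('d, 'a) config \<Rightarrow> real" and b C w y
  assume g: "(\<forall>x\<in>X. \<bar>g x\<bar> \<le> C) \<and> (\<forall>S\<in>\<S>. agreement_bound X g S b)" and wy: "w \<in> X" "y \<in> X"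
  have "(\<lambda>i. i + - k) ` cube n = \<Lambda>" by (simp add: \<Lambda>_def)
  moreover have "(\<lambda>i. i + k) ` (\<Lambda> - cube m) = cube n - (\<lambda>i. i + k) ` cube m"
    by (subst image_set_diff) (auto simp: \<Lambda>_def image_image inj_on_def)
  ultimately show "\<bar>birkhoff g (cube n) (?Z w y) - birkhoff g (cube m) y
      - birkhoff g (cube n - (\<lambda>i. i + k) ` cube m) w\<bar> \<le> 4 * b + C * c"
    using energy[of g C b "shift k w" y] g wy by (simp add: birkhoff_shift shift_mem)
qed

section \<open>Splicing maps obtained from the two decoupling conditions\<close>

lemma card_alphabet_pos: "card \<A> > 0"
  using nonempty mem_alphabet finite_alphabet by (metis card_gt_0_iff empty_iff ex_in_conv)

lemma agreement_bound_nonneg: "agreement_bound X g S b \<Longrightarrow> b \<ge> 0"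
  using nonempty agreement_boundD[of X g S b _ _ "{}"] by fastforce

text \<open>The label keeps the displacement and the letters of \<open>w\<close> in the collar
  between \<open>cube m\<close> and \<open>cube (m + q)\<close>, whose size is \<open>e\<close>;
  outside the larger cube \<open>w\<close> is visible in the spliced configuration. In the energy,
  the collar of \<open>w\<close> and the surroundings of the displaced word in
  \<open>cube (m + q)\<close> cost \<open>C * e\<close> each, and the outside and the word one
  agreement error each.\<close>

lemma splicing_of_decoupling:
  fixes q m :: nat
  defines "e \<equiv> card (cube (m + q) :: (int ^ 'd) set) - card (cube m :: (int ^ 'd) set)"
  assumes dec: "\<forall>x\<in>X. \<forall>y\<in>X. \<exists>z\<in>X. \<exists>l\<in>cube q.
      restrict (shift (- l) z) (cube m) = restrict y (cube m) \<and>
      restrict z (- cube (m + q)) = restrict x (- cube (m + q))"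
    and room: "\<forall>i. \<bar>k $ i\<bar> + int m + int q \<le> int n"
  shows "splicing X {cube m, - cube (m + q)} m q (2 * real e)
    (card (cube q :: (int ^ 'd) set) * card \<A> ^ e) n k"
proof -
  let ?V = "cube (m + q) :: (int ^ 'd) set" and ?\<Lambda> = "(\<lambda>i. i - k) ` cube n"
  let ?E = "?V - cube m"
  have cube_sub: "cube m \<subseteq> ?V" by (rule cube_mono) simp
  have cE: "card ?E = e" by (simp add: e_def card_Diff_subset[OF finite_cube cube_sub])
  have V\<Lambda>: "?V \<subseteq> ?\<Lambda>"
  proof
    fix i assume "i \<in> ?V"
    moreover have "\<forall>a. \<bar>k $ a\<bar> + int (m + q) \<le> int n" using room by (simp add: algebra_simps)
    ultimately have "i + k \<in> cube n" using cube_add_subset(1) by blast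
    then show "i \<in> ?\<Lambda>" by (metis add_diff_cancel image_eqI)
  qed
  have "\<forall>x. \<exists>f. \<forall>y. x \<in> X \<and> y \<in> X \<longrightarrow> fst (f y) \<in> X \<and> snd (f y) \<in> cube q \<and>
      (\<forall>i\<in>cube m. fst (f y) (i - snd (f y)) = y i) \<and> (\<forall>i\<in>- ?V. fst (f y) i = x i)"
    using dec unfolding restrict_eq_iff shift_def by (intro allI choice) (force simp: diff_conv_add_uminus simp del: add_uminus_conv_diff)
  then obtain f where f: "\<And>x y. x \<in> X \<Longrightarrow> y \<in> X \<Longrightarrow> fst (f x y) \<in> X \<and> snd (f x y) \<in> cube q \<and>
      (\<forall>i\<in>cube m. fst (f x y) (i - snd (f x y)) = y i) \<and> (\<forall>i\<in>- ?V. fst (f x y) i = x i)"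
    by metis
  define z where "z x y = fst (f x y)" for x y
  \<comment> \<open>The condition reads the word through \<open>shift (- l)\<close>, so its
    displacement is \<open>- l\<close>; cubes are symmetric.\<close>
  define l where "l x y = - snd (f x y)" for x y
  have z: "z x y \<in> X" "l x y \<in> cube q" "\<And>i. i \<in> cube m \<Longrightarrow> z x y (i + l x y) = y i"
    "\<And>i. i \<notin> ?V \<Longrightarrow> z x y i = x i" if "x \<in> X" "y \<in> X" for x y
    using f[OF that] by (auto simp: z_def l_def)
  have lV: "i + l' \<in> ?V" if "i \<in> cube m" "l' \<in> cube q" for i l' :: "int ^ 'd"
    using cube_add_subset(1)[of l' m "m + q" i] that by (auto simp: cube_def)
  let ?L = "{0 :: int} \<times> {0 :: int} \<times> (cube q :: (int ^ 'd) set) \<times> words X ?E"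
  show ?thesis
  proof (rule splicing_centered[where z = z and lab = "\<lambda>x y. (0, 0, l x y, restrict x ?E)" and L = ?L])
    show "finite ?L" using finite_words[of ?E] by simp
    show "card ?L \<le> card (cube q :: (int ^ 'd) set) * card \<A> ^ e"
      using card_words_le[of ?E] by (simp add: card_cartesian_product cE)
    show "(0, 0, l w y, restrict w ?E) \<in> ?L" if "w \<in> X" "y \<in> X" for w y
      using that z(2) by (simp add: restrict_mem_words)
    show "\<exists>l\<in>cube q. \<forall>i\<in>cube m. z w y (i + l) = y i" if "w \<in> X" "y \<in> X" for w y
      using z(2,3)[OF that] by blast
  next
    fix w y w' y' assume X: "w \<in> X" "y \<in> X" "w' \<in> X" "y' \<in> X"
      and lab: "(0 :: int, 0 :: int, l w y, restrict w ?E) = (0, 0, l w' y', restrict w' ?E)"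
      and eq: "\<forall>i\<in>?\<Lambda>. z w y i = z w' y' i"
    have "w i = w' i" if i: "i \<in> ?\<Lambda> - cube m" for i
    proof (cases "i \<in> ?V")
      case True
      then show ?thesis using lab i by (auto simp: restrict_eq_iff)
    next
      case False
      then show ?thesis using z(4)[OF X(1,2) False] z(4)[OF X(3,4) False] eq i by auto
    qed
    moreover have "y i = y' i" if i: "i \<in> cube m" for i
      using z(3)[OF X(1,2) i] z(3)[OF X(3,4) i] eq V\<Lambda> lV[OF i z(2)[OF X(1,2)]] lab by auto
    ultimately show "(\<forall>i\<in>?\<Lambda> - cube m. w i = w' i) \<and> (\<forall>i\<in>cube m. y i = y' i)" by blast
  next
    fix g :: "('d, 'a) config \<Rightarrow> real" and b C w y
    assume gC: "\<forall>x\<in>X. \<bar>g x\<bar> \<le> C" and gb: "\<forall>S\<in>{cube m, - ?V}. agreement_bound X g S b" and X: "w \<in> X" "y \<in> X"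
    let ?z = "z w y" and ?l = "l w y" and ?W = "(\<lambda>i. i + l w y) ` cube m"
    have b0: "0 \<le> b" using agreement_bound_nonneg gb by blast
    have W: "?W \<subseteq> ?V" using lV z(2)[OF X] by blast
    have cW: "card (?V - ?W) = e"
      by (simp add: card_Diff_subset[OF _ W] card_image e_def)
    have split_z: "birkhoff g ?\<Lambda> ?z = birkhoff g (?\<Lambda> - ?V) ?z + (birkhoff g (?V - ?W) ?z + birkhoff g (cube m) (shift ?l ?z))"
      unfolding birkhoff_shift birkhoff_Diff[OF finite_cube W, symmetric] by (rule birkhoff_Diff[OF _ V\<Lambda>]) simp
    have split_w: "birkhoff g (?\<Lambda> - cube m) w = birkhoff g (?\<Lambda> - ?V) w + birkhoff g ?E w"
    proof -
      have "?\<Lambda> - cube m = (?\<Lambda> - ?V) \<union> ?E" using V\<Lambda> cube_sub by blast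
      then show ?thesis by (simp only:) (rule birkhoff_Un; auto)
    qed
    have 1: "\<bar>birkhoff g (?\<Lambda> - ?V) ?z - birkhoff g (?\<Lambda> - ?V) w\<bar> \<le> b"
      by (rule agreement_boundD[of X g "- ?V"]) (use gb X z in auto)
    have 2: "\<bar>birkhoff g (cube m) (shift ?l ?z) - birkhoff g (cube m) y\<bar> \<le> b"
      by (rule agreement_boundD[of X g "cube m", OF _ shift_mem[OF z(1)[OF X]] X(2)])
         (use gb z(3)[OF X] in \<open>auto simp: shift_def\<close>)
    have 3: "\<bar>birkhoff g (?V - ?W) ?z\<bar> \<le> C * real e" "\<bar>birkhoff g ?E w\<bar> \<le> C * real e"
      using abs_birkhoff_le[OF gC z(1)[OF X], of "?V - ?W"] abs_birkhoff_le[OF gC X(1), of ?E] cE cW by simp_all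
    have "C * (2 * real e) = C * real e + C * real e" by simp
    then show "\<bar>birkhoff g ?\<Lambda> ?z - birkhoff g (cube m) y - birkhoff g (?\<Lambda> - cube m) w\<bar> \<le> 4 * b + C * (2 * real e)"
      using 1 2 3 b0 unfolding split_z split_w by linarith
  qed (rule z(1))
qed

text \<open>Each of the two set differences between an interval and its translate by
  \<open>s\<close> has at most \<open>q\<close> points.\<close>

lemma sum_interval_translate_le:
  fixes h :: "int \<Rightarrow> real" and s lo hi :: int
  assumes "\<And>i. \<bar>h i\<bar> \<le> C" "\<bar>s\<bar> \<le> int q"
  shows "\<bar>(\<Sum>i\<in>{lo..<hi}. h (i + s)) - (\<Sum>i\<in>{lo..<hi}. h i)\<bar> \<le> 2 * C * real q"
proof -
  let ?A = "{lo + s..<hi + s}" and ?B = "{lo..<hi}"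
  have C: "0 \<le> C" using assms(1)[of 0] by linarith
  have A: "(\<Sum>i\<in>?B. h (i + s)) = sum h ?A"
    by (rule sum.reindex_bij_witness[of _ "\<lambda>i. i - s" "\<lambda>i. i + s"]) auto
  have small: "\<bar>sum h S\<bar> \<le> C * real q" if "S \<subseteq> {l..<l + int q}" for S and l :: int
  proof -
    have "\<bar>sum h S\<bar> \<le> (\<Sum>i\<in>S. C)" using assms(1) by (intro order_trans[OF sum_abs] sum_mono)
    also have "... \<le> C * real q" using card_mono[OF _ that] C by (simp add: mult.commute mult_left_mono)
    finally show ?thesis .
  qed
  \<comment> \<open>The sign of \<open>s\<close> decides at which end each difference lies.\<close>
  have "?A - ?B \<subseteq> {(if s \<ge> 0 then hi else lo - int q)..<(if s \<ge> 0 then hi else lo - int q) + int q}"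
    "?B - ?A \<subseteq> {(if s \<ge> 0 then lo else hi - int q)..<(if s \<ge> 0 then lo else hi - int q) + int q}"
    using assms(2) by auto
  then have "\<bar>sum h (?A - ?B)\<bar> \<le> C * real q" "\<bar>sum h (?B - ?A)\<bar> \<le> C * real q" by (auto intro: small)
  moreover have "sum h ?A = sum h (?A - ?B) + sum h (?A \<inter> ?B)" "sum h ?B = sum h (?B - ?A) + sum h (?A \<inter> ?B)"
    by (simp_all add: sum.Int_Diff[of ?A h ?B] sum.Int_Diff[of ?B h ?A] Int_commute)
  ultimately show ?thesis unfolding A by linarith
qed

text \<open>Both half-lines are filled with translates of the same \<open>w\<close>, so the label
  records two displacements, with 2q + 1 choices each, besides the lost letters. Translating a
  half-line also moves its far end, so letters are lost and energy is spent at the ends of \<Lambda>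
  as well as near the window.\<close>

lemma splicing_of_one_decoupling:
  fixes q m :: nat
  assumes d: "CARD('d) = 1"
    and dec: "\<forall>xm\<in>X. \<forall>y\<in>X. \<forall>xp\<in>X. \<exists>lm lp :: int.
        \<bar>lm\<bar> \<le> int q \<and> \<bar>lp\<bar> \<le> int q \<and>
        (\<exists>z\<in>X.
          restrict z (sites {- int m..int m}) = restrict y (sites {- int m..int m}) \<and>
          restrict z (sites {..<- int m - int q}) = restrict (shift (vec (- lm)) xm) (sites {..<- int m - int q}) \<and>
          restrict z (sites {int m + int q<..}) = restrict (shift (vec (- lp)) xp) (sites {int m + int q<..}))"
    and room: "\<forall>i. \<bar>k $ i\<bar> + int m + int q \<le> int n"
  shows "splicing X {cube m, sites {..<- int (m + q)}, sites {int (m + q)<..}} m q (8 * real q)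
    ((2 * q + 1) ^ 2 * card \<A> ^ (6 * q)) n k"
proof -
  obtain a :: 'd where a: "UNIV = {a}" using d by (rule card_1_singletonE)
  have all: "(\<forall>i. P i) \<longleftrightarrow> P a" for P :: "'d \<Rightarrow> bool" using a by (metis UNIV_I singletonD)
  have vec_nth_a: "vec (i $ a) = i" for i :: "int ^ 'd" by (simp add: vec_eq_iff all)
  have sites: "sites S = (vec ` S :: (int ^ 'd) set)" for S
  proof (intro equalityI subsetI)
    fix i :: "int ^ 'd" assume "i \<in> sites S"
    then have "i $ a \<in> S" by (simp add: sites_def)
    then show "i \<in> vec ` S" using vec_nth_a[of i] by (metis imageI)
  qed (auto simp: sites_def)
  define \<kappa> where "\<kappa> = k $ a"
  have room: "\<bar>\<kappa>\<bar> + int m + int q \<le> int n" using room by (simp add: \<kappa>_def)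
  let ?\<Lambda> = "(\<lambda>i. i - k) ` cube n :: (int ^ 'd) set"
  define lo hi where "lo = - int n - \<kappa>" and "hi = int n - \<kappa> + 1"
  have \<Lambda>: "?\<Lambda> = sites {lo..<hi}"
  proof (intro equalityI subsetI)
    fix i assume "i \<in> ?\<Lambda>"
    then show "i \<in> sites {lo..<hi}" by (auto simp: cube_def sites_def all lo_def hi_def \<kappa>_def abs_le_iff)
  next
    fix i :: "int ^ 'd" assume "i \<in> sites {lo..<hi}"
    then have "i + k \<in> cube n" by (auto simp: cube_def sites_def all lo_def hi_def \<kappa>_def abs_le_iff)
    then show "i \<in> ?\<Lambda>" by (metis add_diff_cancel image_eqI)
  qed
  have cube: "cube m = (sites {- int m..int m} :: (int ^ 'd) set)"
    by (auto simp: cube_def sites_def all abs_le_iff)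
  have inj: "inj (vec :: int \<Rightarrow> int ^ 'd)" by (auto simp: inj_def vec_eq_iff)
  have fin_sites: "finite S \<Longrightarrow> finite (sites S :: (int ^ 'd) set)" for S by (simp add: sites)
  have card_sites: "card (sites S :: (int ^ 'd) set) = card S" for S
    unfolding sites by (rule card_image) (rule inj_on_subset[OF inj], simp)
  have birkhoff_sites: "birkhoff g (sites S) x = (\<Sum>i\<in>S. g (shift (vec i) x))" for g S and x :: "('d, 'a) config"
    unfolding birkhoff_def sites by (subst sum.reindex) (auto intro: inj_on_subset[OF inj])
  \<comment> \<open>Given the displacements, the spliced configuration reveals \<open>w\<close> at
    \<open>i\<close> if the displaced site lies in \<Lambda> and beyond the gap of width
    \<open>q\<close>. As displacements are at most \<open>q\<close>, this can fail only within 2q of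
    the window or within q of the ends of \<Lambda>: 4q + 2q letters.\<close>
  define E where "E = ({- int (m + 2 * q)..<- int m} \<union> {int m<..int (m + 2 * q)}) \<union> ({lo..<lo + int q} \<union> {hi - int q..<hi})"
  have finE: "finite E" by (simp add: E_def)
  have cE: "card E \<le> 6 * q"
    unfolding E_def by (intro order_trans[OF card_Un_le] order_trans[OF add_mono[OF card_Un_le card_Un_le]]) simp
  define P where "P x y p \<longleftrightarrow> (case p of (z, lm, lp) \<Rightarrow> z \<in> X \<and> \<bar>lm\<bar> \<le> int q \<and> \<bar>lp\<bar> \<le> int q \<and>
      (\<forall>i\<in>cube m. z i = y i) \<and> (\<forall>i. i < - int (m + q) \<longrightarrow> z (vec i) = x (vec (i - lm))) \<and>
      (\<forall>i>int (m + q). z (vec i) = x (vec (i - lp))))"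
    for x y :: "('d, 'a) config" and p :: "('d, 'a) config \<times> int \<times> int"
  have ex: "\<exists>p. P x y p" if xy: "x \<in> X" "y \<in> X" for x y
  proof -
    \<comment> \<open>The left and the right outer configuration are both taken to be
      \<open>x\<close>.\<close>
    obtain lm lp z where z: "\<bar>lm\<bar> \<le> int q" "\<bar>lp\<bar> \<le> int q" "z \<in> X"
        "restrict z (sites {- int m..int m}) = restrict y (sites {- int m..int m})"
        "restrict z (sites {..<- int m - int q}) = restrict (shift (vec (- lm)) x) (sites {..<- int m - int q})"
        "restrict z (sites {int m + int q<..}) = restrict (shift (vec (- lp)) x) (sites {int m + int q<..})"
      using dec xy by blast
    have add_vec: "vec i + vec (- l) = (vec (i - l) :: int ^ 'd)" for i l by (simp add: vec_eq_iff)
    have nth: "z i = y i" if "i \<in> cube m" for i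
      using z(4) that unfolding restrict_eq_iff cube by blast
    have left: "z (vec i) = x (vec (i - lm))" if "i < - int (m + q)" for i
      using bspec[OF z(5)[unfolded restrict_eq_iff], of "vec i"] that
      by (simp add: sites_def shift_def add_vec)
    have right: "z (vec i) = x (vec (i - lp))" if "i > int (m + q)" for i
      using bspec[OF z(6)[unfolded restrict_eq_iff], of "vec i"] that
      by (simp add: sites_def shift_def add_vec)
    have "P x y (z, lm, lp)" unfolding P_def prod.case using z(1-3) nth left right by blast
    then show ?thesis by blast
  qed
  have f: "P x y (SOME p. P x y p)" if "x \<in> X" "y \<in> X" for x y
    by (rule someI_ex[OF ex[OF that]])
  define f where "f x y = (SOME p. P x y p)" for x y
  define z where "z x y = fst (f x y)" for x y
  define lm where "lm x y = fst (snd (f x y))" for x y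
  define lp where "lp x y = snd (snd (f x y))" for x y
  have z: "z x y \<in> X" "\<bar>lm x y\<bar> \<le> int q" "\<bar>lp x y\<bar> \<le> int q" "\<And>i. i \<in> cube m \<Longrightarrow> z x y i = y i"
    "\<And>i. i < - int (m + q) \<Longrightarrow> z x y (vec i) = x (vec (i - lm x y))"
    "\<And>i. i > int (m + q) \<Longrightarrow> z x y (vec i) = x (vec (i - lp x y))" if "x \<in> X" "y \<in> X" for x y
    using f[OF that, folded f_def] unfolding P_def z_def lm_def lp_def by (simp_all add: case_prod_beta)
  let ?L = "{- int q..int q} \<times> {- int q..int q} \<times> {0 :: int ^ 'd} \<times> words X (sites E)"
  show ?thesis
  proof (rule splicing_centered[where z = z and lab = "\<lambda>x y. (lm x y, lp x y, 0, restrict x (sites E))" and L = ?L])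
    show "finite ?L" using finite_words[OF fin_sites[OF finE]] by simp
    have "card (words X (sites E)) \<le> card \<A> ^ (6 * q)"
      using card_words_le[OF fin_sites[OF finE]] power_increasing[OF cE, of "card \<A>"] card_alphabet_pos
      by (simp add: card_sites)
    moreover have "card {- int q..int q} = 2 * q + 1" by simp
    ultimately show "card ?L \<le> (2 * q + 1) ^ 2 * card \<A> ^ (6 * q)"
      unfolding card_cartesian_product power2_eq_square by (simp only: mult.assoc) (intro mult_le_mono, auto)
    show "(lm w y, lp w y, 0, restrict w (sites E)) \<in> ?L" if "w \<in> X" "y \<in> X" for w y
      using that z(2,3)[OF that] by (simp add: restrict_mem_words abs_le_iff)
    \<comment> \<open>Here the word keeps its place and the half-lines move, so the displacement 0
      serves.\<close>
    show "\<exists>l\<in>cube q. \<forall>i\<in>cube m. z w y (i + l) = y i" if "w \<in> X" "y \<in> X" for w y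
      using z(4)[OF that] by (intro bexI[of _ 0]) (auto simp: cube_def)
  next
    fix w y w' y' assume X: "w \<in> X" "y \<in> X" "w' \<in> X" "y' \<in> X"
      and lab: "(lm w y, lp w y, 0 :: int ^ 'd, restrict w (sites E)) = (lm w' y', lp w' y', 0, restrict w' (sites E))"
      and eq: "\<forall>i\<in>?\<Lambda>. z w y i = z w' y' i"
    have lmp: "lm w' y' = lm w y" "lp w' y' = lp w y" using lab by auto
    have eq': "z w y (vec i) = z w' y' (vec i)" if "lo \<le> i" "i < hi" for i
      using eq that unfolding \<Lambda> by (auto simp: sites_def)
    have "w (vec i) = w' (vec i)" if i: "lo \<le> i" "i < hi" "\<not> (- int m \<le> i \<and> i \<le> int m)" for i
    proof -
      consider "i \<in> E" | "i < - int (m + 2 * q)" "lo + int q \<le> i" | "int (m + 2 * q) < i" "i < hi - int q"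
        using i by (force simp: E_def)
      then show ?thesis
      proof cases
        case 1
        then show ?thesis using lab by (auto simp: restrict_eq_iff sites)
      next
        case 2
        then have "i + lm w y < - int (m + q)" "lo \<le> i + lm w y" using z(2)[OF X(1,2)] by auto
        moreover from this have "i + lm w y < hi" using room by (simp add: hi_def)
        ultimately show ?thesis
          using z(5)[OF X(1,2), of "i + lm w y"] z(5)[OF X(3,4), of "i + lm w y"] eq'[of "i + lm w y"] lmp by simp
      next
        case 3
        then have "i + lp w y > int (m + q)" "i + lp w y < hi" using z(3)[OF X(1,2)] by auto
        moreover from this have "lo \<le> i + lp w y" using room by (simp add: lo_def)
        ultimately show ?thesis
          using z(6)[OF X(1,2), of "i + lp w y"] z(6)[OF X(3,4), of "i + lp w y"] eq'[of "i + lp w y"] lmp by simp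
      qed
    qed
    then have "w i = w' i" if "i \<in> ?\<Lambda> - cube m" for i
      using that vec_nth_a[of i] unfolding \<Lambda> cube by (auto simp: sites_def all) metis+
    then have "\<forall>i\<in>?\<Lambda> - cube m. w i = w' i" by blast
    moreover have "y i = y' i" if i: "i \<in> cube m" for i
    proof -
      have "cube m \<subseteq> ?\<Lambda>" unfolding \<Lambda> cube using room by (auto simp: sites_def all lo_def hi_def)
      then show ?thesis using z(4)[OF X(1,2) i] z(4)[OF X(3,4) i] eq i by auto
    qed
    ultimately show "(\<forall>i\<in>?\<Lambda> - cube m. w i = w' i) \<and> (\<forall>i\<in>cube m. y i = y' i)" by blast
  next
    fix g :: "('d, 'a) config \<Rightarrow> real" and b C w y
    let ?SL = "sites {..<- int (m + q)} :: (int ^ 'd) set" and ?SR = "sites {int (m + q)<..} :: (int ^ 'd) set"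
    assume gC: "\<forall>x\<in>X. \<bar>g x\<bar> \<le> C" and gb: "\<forall>S\<in>{cube m, ?SL, ?SR}. agreement_bound X g S b" and X: "w \<in> X" "y \<in> X"
    have b0: "0 \<le> b" using agreement_bound_nonneg gb by blast
    let ?z = "z w y"
    define IL IR W where "IL = {lo..<- int (m + q)}" and "IR = {int (m + q) + 1..<hi}"
      and "W = {- int (m + q)..<- int m} \<union> {int m<..int (m + q)}"
    have dec1: "{lo..<hi} - {- int m..int m} = IL \<union> IR \<union> W" "{- int m..int m} \<subseteq> {lo..<hi}"
      using room by (auto simp: IL_def IR_def W_def lo_def hi_def)
    have D: "?\<Lambda> - cube m = sites ({lo..<hi} - {- int m..int m})"
      unfolding \<Lambda> cube by (auto simp: sites_def all)
    have split: "birkhoff g (?\<Lambda> - cube m) x = birkhoff g (sites IL) x + birkhoff g (sites IR) x + birkhoff g (sites W) x" for x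
      unfolding D dec1(1) birkhoff_sites
      by (subst sum.union_disjoint; (subst sum.union_disjoint)?) (auto simp: IL_def IR_def W_def)
    have splitz: "birkhoff g ?\<Lambda> ?z = birkhoff g (?\<Lambda> - cube m) ?z + birkhoff g (cube m) ?z"
      by (rule birkhoff_Diff) (use dec1(2) in \<open>auto simp: \<Lambda> cube sites\<close>)
    have cW: "card W \<le> 2 * q" unfolding W_def by (rule order_trans[OF card_Un_le]) simp
    have C0: "0 \<le> C" using gC X(1) by force
    have W: "\<bar>birkhoff g (sites W) x\<bar> \<le> C * (2 * real q)" if "x \<in> X" for x
    proof -
      have "\<bar>birkhoff g (sites W) x\<bar> \<le> C * real (card W)" using abs_birkhoff_le[OF gC that, of "sites W"] by (simp add: card_sites)
      also have "... \<le> C * (2 * real q)" using cW C0 by (intro mult_left_mono) auto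
      finally show ?thesis .
    qed
    have trans: "\<bar>birkhoff g (sites {l..<h}) (shift (vec (- s)) w) - birkhoff g (sites {l..<h}) w\<bar> \<le> 2 * C * real q"
      if "\<bar>s\<bar> \<le> int q" for l h s
    proof -
      have "vec i + vec (- s) = (vec (i + - s) :: int ^ 'd)" for i by (simp add: vec_eq_iff)
      then have "birkhoff g (sites {l..<h}) (shift (vec (- s)) w) = (\<Sum>i\<in>{l..<h}. g (shift (vec (i + - s)) w))"
        unfolding birkhoff_sites shift_shift by simp
      then show ?thesis
        using sum_interval_translate_le[of "\<lambda>i. g (shift (vec i) w)" C "- s" q l h] gC that shift_mem[OF X(1)]
        by (simp add: birkhoff_sites)
    qed
    have fin: "finite (sites IL :: (int ^ 'd) set)" "finite (sites IR :: (int ^ 'd) set)"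
      by (auto intro: fin_sites simp: IL_def IR_def)
    have sub: "sites IL \<subseteq> ?SL" "sites IR \<subseteq> ?SR" by (auto simp: sites_def IL_def IR_def all)
    have gb': "agreement_bound X g (cube m) b" "agreement_bound X g ?SL b" "agreement_bound X g ?SR b"
      using gb by auto
    have L: "\<bar>birkhoff g (sites IL) ?z - birkhoff g (sites IL) (shift (vec (- lm w y)) w)\<bar> \<le> b"
    proof (rule agreement_boundD[OF gb'(2) z(1)[OF X] shift_mem[OF X(1)] _ fin(1) sub(1)])
      show "\<forall>k\<in>?SL. ?z k = shift (vec (- lm w y)) w k"
      proof
        fix k assume "k \<in> ?SL"
        then have "k $ a < - int (m + q)" by (simp add: sites_def)
        moreover have "k + vec (- lm w y) = vec (k $ a - lm w y)" by (simp add: vec_eq_iff all)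
        ultimately show "?z k = shift (vec (- lm w y)) w k"
          using z(5)[OF X, of "k $ a"] by (simp add: shift_def vec_nth_a)
      qed
    qed
    have R: "\<bar>birkhoff g (sites IR) ?z - birkhoff g (sites IR) (shift (vec (- lp w y)) w)\<bar> \<le> b"
    proof (rule agreement_boundD[OF gb'(3) z(1)[OF X] shift_mem[OF X(1)] _ fin(2) sub(2)])
      show "\<forall>k\<in>?SR. ?z k = shift (vec (- lp w y)) w k"
      proof
        fix k assume "k \<in> ?SR"
        then have "int (m + q) < k $ a" by (simp add: sites_def)
        moreover have "k + vec (- lp w y) = vec (k $ a - lp w y)" by (simp add: vec_eq_iff all)
        ultimately show "?z k = shift (vec (- lp w y)) w k"
          using z(6)[OF X, of "k $ a"] by (simp add: shift_def vec_nth_a)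
      qed
    qed
    have M: "\<bar>birkhoff g (cube m) ?z - birkhoff g (cube m) y\<bar> \<le> b"
      by (rule agreement_boundD[of X g "cube m"]) (use gb X z in auto)
    \<comment> \<open>Two gap sums, for the spliced configuration and for \<open>w\<close>, and two
      translation errors cost \<open>2 * C * real q\<close> each; the window and the half-lines add
      three agreement errors.\<close>
    have "C * (8 * real q) = 4 * (2 * C * real q)" "C * (2 * real q) = 2 * C * real q" by simp_all
    then show "\<bar>birkhoff g ?\<Lambda> ?z - birkhoff g (cube m) y - birkhoff g (?\<Lambda> - cube m) w\<bar> \<le> 4 * b + C * (8 * real q)"
      using L R M W[OF z(1)[OF X]] W[OF X(1)] b0
        trans[OF z(2)[OF X], of lo "- int (m + q)", folded IL_def] trans[OF z(3)[OF X], of "int (m + q) + 1" hi, folded IR_def]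
      unfolding splitz split by linarith
  qed (rule z(1))
qed

end

section \<open>Weak Gibbs property\<close>

lemma agreement_bound_mono: "agreement_bound X g S b \<Longrightarrow> b \<le> b' \<Longrightarrow> agreement_bound X g S b'"
  unfolding agreement_bound_def by (meson order_trans)

section \<open>Quantities of smaller order than the volume of \<open>cube m\<close>\<close>

lemma le_card_cube: "m \<le> card (cube m :: (int ^ 'd) set)"
proof -
  have "2 * m + 1 \<le> (2 * m + 1) ^ CARD('d)"
    by (rule self_le_power) (auto simp: card_gt_0_iff)
  then show ?thesis by (simp add: card_cube)
qed

lemma tendsto_over_card_cube:
  fixes q :: "nat \<Rightarrow> nat" and u :: "nat \<Rightarrow> real"
  assumes "(\<lambda>m. real (q m) / real m) \<longlonglongrightarrow> 0" "\<And>m. \<bar>u m\<bar> \<le> K * real (q m)"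
  shows "(\<lambda>m. u m / real (card (cube m :: (int ^ 'd) set))) \<longlonglongrightarrow> 0"
proof (rule tendsto_rabs_zero_cancel, rule tendsto_sandwich[OF _ _ tendsto_const])
  show "(\<lambda>m. K * (real (q m) / real m)) \<longlonglongrightarrow> 0"
    using tendsto_mult[OF tendsto_const assms(1), of K] by simp
  show "\<forall>\<^sub>F m in sequentially. \<bar>u m / real (card (cube m :: (int ^ 'd) set))\<bar> \<le> K * (real (q m) / real m)"
  proof (rule eventually_sequentiallyI[of 1])
    fix m :: nat assume "1 \<le> m"
    then have "\<bar>u m\<bar> / real (card (cube m :: (int ^ 'd) set)) \<le> (K * real (q m)) / real m"
      using le_card_cube[of m, where 'd = 'd] order_trans[OF abs_ge_zero assms(2)]
      by (intro frac_le assms(2)) auto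
    then show "\<bar>u m / real (card (cube m :: (int ^ 'd) set))\<bar> \<le> K * (real (q m) / real m)" by simp
  qed
qed auto

lemma ln_card_cube_le: "ln (real (card (cube q :: (int ^ 'd) set))) \<le> 2 * real CARD('d) * real q"
proof -
  have "ln (1 + 2 * real q) \<le> 2 * real q" by (rule ln_add_one_self_le_self) simp
  then have "real CARD('d) * ln (1 + 2 * real q) \<le> real CARD('d) * (2 * real q)" by (intro mult_left_mono) auto
  then show ?thesis by (simp add: card_cube ln_realpow add.commute)
qed

lemma ln_card_cube_nonneg: "0 \<le> ln (real (card (cube q :: (int ^ 'd) set)))"
  using card_cube_pos[of q, where 'd = 'd] by (simp add: Suc_le_eq)

lemma tendsto_ln_card_cube:
  fixes q :: "nat \<Rightarrow> nat"
  assumes "(\<lambda>m. real (q m) / real m) \<longlonglongrightarrow> 0"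
  shows "(\<lambda>m. ln (real (card (cube (q m) :: (int ^ 'd) set))) / real (card (cube m :: (int ^ 'd) set))) \<longlonglongrightarrow> 0"
  by (rule tendsto_over_card_cube[OF assms, where K = "2 * real CARD('d)"])
     (simp only: abs_of_nonneg[OF ln_card_cube_nonneg] ln_card_cube_le)

context finite_shift
begin

text \<open>All losses in the cylinder estimate are o(|cube m|) and disappear after division by the
  volume. For the indicator it suffices that some finite \<open>b'\<close> exists for each
  \<open>m\<close> and \<open>x\<close>, because the size of the perturbation is chosen after
  it.\<close>

proposition weak_Gibbs_if_splicing:
  fixes \<S> :: "nat \<Rightarrow> (int ^ 'd) set set" and r N :: "nat \<Rightarrow> nat" and c :: "nat \<Rightarrow> real"
  assumes cont: "continuous_on X \<phi>" and tangent: "tangent_functional X \<phi> \<nu>" and \<nu>: "\<nu> \<in> M1 X"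
    and splice: "\<And>m n k. \<forall>i. \<bar>k $ i\<bar> + int m + int (r m) \<le> int n \<Longrightarrow> splicing X (\<S> m) m (r m) (c m) (N m) n k"
    and cube: "\<And>m. cube m \<in> \<S> m" and c: "\<And>m. c m \<ge> 0"
    and agree: "\<And>\<epsilon>. \<epsilon> > 0 \<Longrightarrow> \<forall>\<^sub>F m in sequentially. \<forall>S\<in>\<S> m.
      agreement_bound X \<phi> S (\<epsilon> * real (card (cube m :: (int ^ 'd) set)))"
    and agree_f: "\<And>m x. \<exists>b'\<ge>0. \<forall>S\<in>\<S> m. agreement_bound X (indicat_real (cylinder X m x)) S b'"
    and lim_c: "(\<lambda>m. c m / real (card (cube m :: (int ^ 'd) set))) \<longlonglongrightarrow> 0"
    and lim_N: "(\<lambda>m. ln (real (N m)) / real (card (cube m :: (int ^ 'd) set))) \<longlonglongrightarrow> 0"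
    and lim_r: "(\<lambda>m. ln (real (card (cube (r m) :: (int ^ 'd) set))) / real (card (cube m :: (int ^ 'd) set))) \<longlonglongrightarrow> 0"
  shows "weak_Gibbs X (\<lambda>x. \<phi> x - pressure X \<phi>) \<nu>"
  unfolding weak_Gibbs_def
proof (intro conjI \<nu> allI impI)
  fix \<delta> :: real assume \<delta>: "\<delta> > 0"
  let ?v = "\<lambda>m. real (card (cube m :: (int ^ 'd) set))"
  have v: "?v m > 0" for m by simp
  obtain C where C: "C > 0" "\<And>x. x \<in> X \<Longrightarrow> \<bar>\<phi> x\<bar> \<le> C" using bounded_continuous[OF cont] by blast
  have "\<forall>\<^sub>F m in sequentially. (\<forall>S\<in>\<S> m. agreement_bound X \<phi> S (\<delta> / 64 * ?v m)) \<and>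
      c m / ?v m < \<delta> / (32 * C) \<and> ln (real (N m)) / ?v m < \<delta> / 4 \<and>
      ln (real (card (cube (r m) :: (int ^ 'd) set))) / ?v m < \<delta> / 4 \<and>
      ln (partition_function X \<phi> (cube m)) / ?v m < pressure X \<phi> + \<delta> / 8"
    using \<delta> C(1) pressure_limit(1)[OF cont]
    by (intro eventually_conj agree order_tendstoD(2)[OF lim_c] order_tendstoD(2)[OF lim_N]
        order_tendstoD(2)[OF lim_r] order_tendstoD(2)[OF pressure_limit(1)[OF cont]]) auto
  then obtain M where M: "\<And>m. m \<ge> M \<Longrightarrow> (\<forall>S\<in>\<S> m. agreement_bound X \<phi> S (\<delta> / 64 * ?v m)) \<and>
      c m / ?v m < \<delta> / (32 * C) \<and> ln (real (N m)) / ?v m < \<delta> / 4 \<and>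
      ln (real (card (cube (r m) :: (int ^ 'd) set))) / ?v m < \<delta> / 4 \<and>
      ln (partition_function X \<phi> (cube m)) / ?v m < pressure X \<phi> + \<delta> / 8"
    unfolding eventually_sequentially by blast
  show "\<exists>M. \<forall>m\<ge>M. \<forall>x\<in>X. measure \<nu> (cylinder X m x) > 0 \<and>
      \<bar>1 / ?v m * ln (measure \<nu> (cylinder X m x))
        - 1 / ?v m * (\<Sum>j\<in>cube m. \<phi> (shift j x) - pressure X \<phi>)\<bar> \<le> \<delta>"
  proof (intro exI allI impI ballI)
    fix m x assume m: "M \<le> m" and x: "x \<in> X"
    have M1: "\<And>S. S \<in> \<S> m \<Longrightarrow> agreement_bound X \<phi> S (\<delta> / 64 * ?v m)" using M[OF m] by blast
    have M2: "c m < \<delta> / (32 * C) * ?v m" "ln (real (N m)) < \<delta> / 4 * ?v m"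
        "ln (real (card (cube (r m) :: (int ^ 'd) set))) < \<delta> / 4 * ?v m"
        "ln (partition_function X \<phi> (cube m)) < (pressure X \<phi> + \<delta> / 8) * ?v m"
      using M[OF m] v[of m] by (simp_all only: pos_divide_less_eq)
    obtain b' where b': "b' \<ge> 0" "\<And>S. S \<in> \<S> m \<Longrightarrow> agreement_bound X (indicat_real (cylinder X m x)) S b'"
      using agree_f by blast
    have "C * c m < C * (\<delta> / (32 * C) * ?v m)" using M2(1) C(1) by (rule mult_strict_left_mono)
    also have "... = \<delta> / 32 * ?v m" using C(1) by simp
    finally have Cc: "C * c m < \<delta> / 32 * ?v m" .
    \<comment> \<open>Budget per site: 4/64 + 1/32 = 3/32 is strictly below 1/8, which leaves slack
      for the perturbation. With \<open>E\<close> equal to \<delta>/8, the term 4 E takes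
      \<delta>/2, and the two logarithms take \<delta>/4 each.\<close>
    have E: "4 * (\<delta> / 64 * ?v m) + C * c m < \<delta> / 8 * ?v m" using Cc mult_pos_pos[OF \<delta> v[of m]] by (simp add: mult.commute)
    have P: "ln (partition_function X \<phi> (cube m)) \<le> ?v m * pressure X \<phi> + \<delta> / 8 * ?v m"
      using M2(4) by (simp add: algebra_simps)
    have b: "0 \<le> \<delta> / 64 * ?v m" using \<delta> by simp
    note g = gibbs_bounds_from_splicing[OF cont C(2) less_imp_le[OF C(1)] tangent \<nu> splice cube c b M1 b' E P x]
    have "\<bar>ln (measure \<nu> (cylinder X m x)) - (birkhoff \<phi> (cube m) x - ?v m * pressure X \<phi>)\<bar>
        \<le> ln (real (N m)) + 4 * (\<delta> / 8 * ?v m) + ln (real (card (cube (r m) :: (int ^ 'd) set)))"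
      by (rule g(2))
    also have "... \<le> \<delta> * ?v m" using M2(2,3) by simp
    finally have main: "\<bar>ln (measure \<nu> (cylinder X m x)) - (birkhoff \<phi> (cube m) x - ?v m * pressure X \<phi>)\<bar> \<le> \<delta> * ?v m" .
    have sum: "(\<Sum>j\<in>cube m. \<phi> (shift j x) - pressure X \<phi>) = birkhoff \<phi> (cube m) x - ?v m * pressure X \<phi>"
      by (simp add: birkhoff_def sum_subtractf)
    have "\<bar>1 / ?v m * ln (measure \<nu> (cylinder X m x)) - 1 / ?v m * (\<Sum>j\<in>cube m. \<phi> (shift j x) - pressure X \<phi>)\<bar>
        = \<bar>ln (measure \<nu> (cylinder X m x)) - (birkhoff \<phi> (cube m) x - ?v m * pressure X \<phi>)\<bar> / ?v m"
      unfolding sum by (simp add: diff_divide_distrib[symmetric])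
    also have "... \<le> \<delta>" using main v[of m] by (simp only: pos_divide_le_eq)
    finally show "measure \<nu> (cylinder X m x) > 0 \<and>
      \<bar>1 / ?v m * ln (measure \<nu> (cylinder X m x))
        - 1 / ?v m * (\<Sum>j\<in>cube m. \<phi> (shift j x) - pressure X \<phi>)\<bar> \<le> \<delta>"
      using g(1) by blast
  qed
qed

end

context shift_potential
begin

text \<open>Enlarging the cube by \<open>q m\<close> eventually multiplies its volume by less than
  2, so the bound for the larger cube with \<epsilon>/2 is enough.\<close>

lemma boundary_cube_add_small:
  fixes q :: "nat \<Rightarrow> nat"
  assumes q: "(\<lambda>m. real (q m) / real m) \<longlonglongrightarrow> 0" and "\<epsilon> > 0"
  shows "\<forall>\<^sub>F m in sequentially. infsum nrm (boundary (cube (m + q m)))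
    \<le> \<epsilon> * real (card (cube m :: (int ^ 'd) set))"
proof -
  let ?v = "\<lambda>m. real (card (cube m :: (int ^ 'd) set))"
  have "(\<lambda>m. ?v (m + q m) / ?v m) \<longlonglongrightarrow> 1"
    by (rule cube_ratio_tendsto_1[OF q]) simp
  then have ratio: "\<forall>\<^sub>F m in sequentially. ?v (m + q m) / ?v m < 2" by (rule order_tendstoD) simp
  obtain M where M: "\<And>n. n \<ge> M \<Longrightarrow> infsum nrm (boundary (cube n)) \<le> \<epsilon> / 2 * ?v n"
    using boundary_cube_small[of "\<epsilon> / 2"] assms(2) unfolding eventually_sequentially by auto
  show ?thesis using ratio eventually_ge_at_top[of M]
  proof eventually_elim
    case (elim m)
    have "infsum nrm (boundary (cube (m + q m))) \<le> \<epsilon> / 2 * ?v (m + q m)" using elim by (intro M) auto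
    also have "... \<le> \<epsilon> / 2 * (2 * ?v m)"
      using elim(1) assms(2) by (intro mult_left_mono) (auto simp: pos_divide_less_eq)
    finally show ?case by simp
  qed
qed

theorem weak_Gibbs_of_decoupling:
  assumes "decoupling X" "\<nu> \<in> M1 X" "tangent_functional X (energy \<Phi>) \<nu>"
  shows "weak_Gibbs X (\<lambda>x. energy \<Phi> x - pressure X (energy \<Phi>)) \<nu>"
proof -
  obtain q where q: "(\<lambda>m. real (q m) / real m) \<longlonglongrightarrow> 0"
    and dec: "\<And>m. \<forall>x\<in>X. \<forall>y\<in>X. \<exists>z\<in>X. \<exists>l\<in>cube (q m).
        restrict (shift (- l) z) (cube m) = restrict y (cube m) \<and>
        restrict z (- cube (m + q m)) = restrict x (- cube (m + q m))"
    using assms(1) unfolding decoupling_def by auto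
  let ?v = "\<lambda>m. real (card (cube m :: (int ^ 'd) set))"
  define e where "e m = card (cube (m + q m) :: (int ^ 'd) set) - card (cube m :: (int ^ 'd) set)" for m
  have "(\<lambda>m. ?v (m + q m) / ?v m - 1) \<longlonglongrightarrow> 1 - 1"
    by (intro tendsto_diff cube_ratio_tendsto_1[OF q] tendsto_const) simp
  moreover have "?v (m + q m) / ?v m - 1 = real (e m) / ?v m" for m
  proof -
    have "cube m \<subseteq> (cube (m + q m) :: (int ^ 'd) set)" by (rule cube_mono) simp
    from card_mono[OF finite_cube this] show ?thesis
      by (simp add: e_def of_nat_diff diff_divide_distrib)
  qed
  ultimately have lim_e: "(\<lambda>m. real (e m) / ?v m) \<longlonglongrightarrow> 0" by simp
  show ?thesis
  proof (rule weak_Gibbs_if_splicing[OF continuous_energy assms(3,2)])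
    show "splicing X {cube m, - cube (m + q m)} m (q m) (2 * real (e m))
        (card (cube (q m) :: (int ^ 'd) set) * card \<A> ^ e m) n k"
      if "\<forall>i. \<bar>k $ i\<bar> + int m + int (q m) \<le> int n" for m n and k :: "int ^ 'd"
      unfolding e_def by (rule splicing_of_decoupling[OF dec that])
    show "\<forall>\<^sub>F m in sequentially. \<forall>S\<in>{cube m, - cube (m + q m)}. agreement_bound X (energy \<Phi>) S (\<epsilon> * ?v m)"
      if \<epsilon>: "\<epsilon> > 0" for \<epsilon>
    proof -
      have "\<forall>\<^sub>F m in sequentially. infsum nrm (boundary (cube m)) \<le> \<epsilon> / 2 * ?v m"
        "\<forall>\<^sub>F m in sequentially. infsum nrm (boundary (cube (m + q m))) \<le> \<epsilon> / 2 * ?v m"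
        using \<epsilon> boundary_cube_small[of "\<epsilon> / 2"] boundary_cube_add_small[OF q, of "\<epsilon> / 2"] by simp_all
      then show ?thesis
      proof eventually_elim
        case (elim m)
        have "agreement_bound X (energy \<Phi>) (cube m) (2 * infsum nrm (boundary (cube m)))"
          "agreement_bound X (energy \<Phi>) (- cube (m + q m)) (2 * infsum nrm (boundary (- cube (m + q m))))"
          by (intro agreement_bound_energy; simp add: boundary_Compl boundary_cube(1)[OF le0])+
        then show ?case using elim by (auto simp: boundary_Compl elim!: agreement_bound_mono)
      qed
    qed
    show "\<exists>b'\<ge>0. \<forall>S\<in>{cube m, - cube (m + q m)}. agreement_bound X (indicat_real (cylinder X m x)) S b'" for m x
    \<comment> \<open>A site outside \<open>cube (2 * m + q m)\<close> cannot lie in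
      \<open>cube m\<close>, and its window misses \<open>cube (m + q m)\<close>; hence this cube
      contains all exceptional sites for both sets.\<close>
    proof (intro exI[of _ "?v (2 * m + q m)"] conjI ballI agreement_bound_indicator)
      fix S j assume S: "S \<in> {cube m, - cube (m + q m)}" and j: "j \<in> S" "j \<notin> cube (2 * m + q m)"
      have False if "j \<in> cube m" using that j(2) cube_mono[of m "2 * m + q m"] by auto
      moreover have "i + j \<notin> cube (m + q m)" if i: "i \<in> cube m" for i
      proof
        assume "i + j \<in> cube (m + q m)"
        moreover have "\<forall>a. \<bar>(- i) $ a\<bar> + int (m + q m) \<le> int (2 * m + q m)" using i by (auto simp: cube_def)
        ultimately have "(i + j) + - i \<in> cube (2 * m + q m)" by (rule cube_add_subset(1)[rotated])
        then show False using j(2) by simp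
      qed
      ultimately show "(\<lambda>i. i + j) ` cube m \<subseteq> S" using S j(1) by auto
    qed auto
    have "(\<lambda>m. 2 * (real (e m) / ?v m)) \<longlonglongrightarrow> 2 * 0" by (intro tendsto_intros lim_e)
    then show "(\<lambda>m. 2 * real (e m) / ?v m) \<longlonglongrightarrow> 0" by simp
    have "(\<lambda>m. ln (real (card (cube (q m) :: (int ^ 'd) set))) / ?v m + (real (e m) / ?v m) * ln (real (card \<A>))) \<longlonglongrightarrow> 0 + 0 * ln (real (card \<A>))"
      by (intro tendsto_intros lim_e tendsto_ln_card_cube q)
    then show "(\<lambda>m. ln (real (card (cube (q m) :: (int ^ 'd) set) * card \<A> ^ e m)) / ?v m) \<longlonglongrightarrow> 0"
      using card_alphabet_pos by (simp add: ln_mult ln_realpow add_divide_distrib)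
  qed (use tendsto_ln_card_cube[OF q] in auto)
qed

theorem weak_Gibbs_of_one_decoupling:
  assumes d: "CARD('d) = 1" and "one_decoupling X" and straddling: "straddling_summable X \<Phi>"
    and "\<nu> \<in> M1 X" "tangent_functional X (energy \<Phi>) \<nu>"
  shows "weak_Gibbs X (\<lambda>x. energy \<Phi> x - pressure X (energy \<Phi>)) \<nu>"
proof -
  obtain q where q: "(\<lambda>m. real (q m) / real m) \<longlonglongrightarrow> 0"
    and dec: "\<And>m. \<forall>xm\<in>X. \<forall>y\<in>X. \<forall>xp\<in>X. \<exists>lm lp :: int.
        \<bar>lm\<bar> \<le> int (q m) \<and> \<bar>lp\<bar> \<le> int (q m) \<and>
        (\<exists>z\<in>X.
          restrict z (sites {- int m..int m}) = restrict y (sites {- int m..int m}) \<and>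
          restrict z (sites {..<- int m - int (q m)}) =
            restrict (shift (vec (- lm)) xm) (sites {..<- int m - int (q m)}) \<and>
          restrict z (sites {int m + int (q m)<..}) =
            restrict (shift (vec (- lp)) xp) (sites {int m + int (q m)<..}))"
    using assms(2) unfolding one_decoupling_def by auto
  obtain a :: 'd where a: "UNIV = {a}" using d by (rule card_1_singletonE)
  have all: "(\<forall>i. P i) \<longleftrightarrow> P a" for P :: "'d \<Rightarrow> bool" using a by (metis UNIV_I singletonD)
  let ?v = "\<lambda>m. real (card (cube m :: (int ^ 'd) set))"
  let ?\<S> = "\<lambda>m. {cube m, sites {..<- int (m + q m)}, sites {int (m + q m)<..}} :: (int ^ 'd) set set"
  define K where "K = infsum nrm {A. finite A \<and> A \<subseteq> - sites {-1..1} \<and> A \<inter> sites {..<-1} \<noteq> {} \<and> A \<inter> sites {1<..} \<noteq> {}}"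
  show ?thesis
  proof (rule weak_Gibbs_if_splicing[OF continuous_energy assms(5,4)])
    show "splicing X (?\<S> m) m (q m) (8 * real (q m)) ((2 * q m + 1) ^ 2 * card \<A> ^ (6 * q m)) n k"
      if "\<forall>i. \<bar>k $ i\<bar> + int m + int (q m) \<le> int n" for m n and k :: "int ^ 'd"
      by (rule splicing_of_one_decoupling[OF d dec that])
    show "\<forall>\<^sub>F m in sequentially. \<forall>S\<in>?\<S> m. agreement_bound X (energy \<Phi>) S (\<epsilon> * ?v m)"
      if \<epsilon>: "\<epsilon> > 0" for \<epsilon>
    proof -
      \<comment> \<open>The straddling sum is a single constant, negligible against \<open>m\<close>
        and therefore against the volume.\<close>
      have "(\<lambda>m. K / real m) \<longlonglongrightarrow> 0"
        by (intro tendsto_divide_0[OF tendsto_const] filterlim_at_top_imp_at_infinity filterlim_real_sequentially)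
      then have K: "\<forall>\<^sub>F m in sequentially. K / real m < \<epsilon> / 4" using \<epsilon> by (intro order_tendstoD(2)) auto
      have "\<forall>\<^sub>F m in sequentially. infsum nrm (boundary (cube m)) \<le> \<epsilon> / 2 * ?v m"
        "\<forall>\<^sub>F m in sequentially. infsum nrm (boundary (cube (m + q m))) \<le> \<epsilon> / 4 * ?v m"
        using \<epsilon> boundary_cube_small[of "\<epsilon> / 2"] boundary_cube_add_small[OF q, of "\<epsilon> / 4"] by simp_all
      then show ?thesis using K eventually_ge_at_top[of 1]
      proof eventually_elim
        case (elim m)
        have "K \<le> \<epsilon> / 4 * real m" using elim(3,4) by (simp add: pos_divide_less_eq)
        also have "... \<le> \<epsilon> / 4 * ?v m" using le_card_cube[of m, where 'd = 'd] \<epsilon> by (intro mult_left_mono) auto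
        finally have K: "K \<le> \<epsilon> / 4 * ?v m" .
        show ?case
        proof
          fix S assume "S \<in> ?\<S> m"
          then consider "S = cube m" | "S = sites {..<- int (m + q m)} \<or> S = sites {int (m + q m)<..}" by blast
          then show "agreement_bound X (energy \<Phi>) S (\<epsilon> * ?v m)"
          proof cases
            case 1
            have "agreement_bound X (energy \<Phi>) (cube m) (2 * infsum nrm (boundary (cube m)))"
              by (intro agreement_bound_energy boundary_cube(1)[OF le0])
            then show ?thesis unfolding 1 by (rule agreement_bound_mono) (use elim(1) in simp)
          next
            case 2
            have "1 \<le> m + q m" using elim(4) by simp
            note B = boundary_half_line[OF d straddling this 2]
            show ?thesis
              by (rule agreement_bound_mono[OF agreement_bound_energy[OF B(1)]])
                 (use B(2) K elim(2) in \<open>simp add: K_def\<close>)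
          qed
        qed
      qed
    qed
    show "\<exists>b'\<ge>0. \<forall>S\<in>?\<S> m. agreement_bound X (indicat_real (cylinder X m x)) S b'" for m x
    proof (intro exI[of _ "?v (2 * m + q m)"] conjI ballI agreement_bound_indicator)
      fix S j assume S: "S \<in> ?\<S> m" and j: "j \<in> S" "j \<notin> cube (2 * m + q m)"
      have "\<bar>i $ a\<bar> \<le> int m" if "i \<in> cube m" for i :: "int ^ 'd" using that by (simp add: cube_def)
      then show "(\<lambda>i. i + j) ` cube m \<subseteq> S"
        using S j by (auto simp: cube_def sites_def all abs_le_iff)
    qed auto
    show "(\<lambda>m. 8 * real (q m) / ?v m) \<longlonglongrightarrow> 0"
      by (rule tendsto_over_card_cube[OF q, where K = 8]) simp
    show "(\<lambda>m. ln (real ((2 * q m + 1) ^ 2 * card \<A> ^ (6 * q m))) / ?v m) \<longlonglongrightarrow> 0"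
    proof (rule tendsto_over_card_cube[OF q, where K = "4 + 6 * ln (real (card \<A>))"])
      fix m
      have "ln (1 + 2 * real (q m)) \<le> 2 * real (q m)" by (rule ln_add_one_self_le_self) simp
      moreover have "ln (real ((2 * q m + 1) ^ 2 * card \<A> ^ (6 * q m))) =
          2 * ln (1 + 2 * real (q m)) + 6 * real (q m) * ln (real (card \<A>))"
        using card_alphabet_pos by (simp add: ln_mult ln_realpow add.commute)
      moreover have "0 \<le> ln (1 + 2 * real (q m))" "0 \<le> 6 * real (q m) * ln (real (card \<A>))"
        using card_alphabet_pos by (simp_all add: Suc_le_eq)
      ultimately show "\<bar>ln (real ((2 * q m + 1) ^ 2 * card \<A> ^ (6 * q m)))\<bar> \<le> (4 + 6 * ln (real (card \<A>))) * real (q m)"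
        by (simp add: algebra_simps)
    qed
  qed (use tendsto_ln_card_cube[OF q] in auto)
qed

end

theorem theorem2p1:
  fixes \<A> :: "'a::discrete_topology set"
    and X :: "(int ^ 'd \<Rightarrow> 'a) set"
    and \<Phi> :: "(int ^ 'd) set \<Rightarrow> (int ^ 'd \<Rightarrow> 'a) \<Rightarrow> real"
  assumes "finite \<A>" and "shift_space \<A> X" and "\<Phi> \<in> potentials X"
  shows "(decoupling X \<longrightarrow>
      (\<forall>\<nu>\<in>M1T X. tangent_functional X (energy \<Phi>) \<nu> \<longrightarrow>
        weak_Gibbs X (\<lambda>x. energy \<Phi> x - pressure X (energy \<Phi>)) \<nu>))
    \<and> (CARD('d) = 1 \<and> one_decoupling X \<and> straddling_summable X \<Phi> \<longrightarrow>
      (\<forall>\<nu>\<in>M1T X. tangent_functional X (energy \<Phi>) \<nu> \<longrightarrow>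
        weak_Gibbs X (\<lambda>x. energy \<Phi> x - pressure X (energy \<Phi>)) \<nu>))"
proof (cases "X = {}")
  case True
  \<comment> \<open>An empty space carries no probability measure, so this case is vacuous; the
    locale used in the other case needs a point of \<open>X\<close>.\<close>
  have "M1T X = {}"
  proof (rule ccontr)
    assume "M1T X \<noteq> {}"
    then obtain \<nu> where \<nu>: "prob_space \<nu>" "sets \<nu> = sets (restrict_space borel X)"
      by (auto simp: M1T_def M1_def)
    have "space \<nu> = {}" using sets_eq_imp_space_eq[OF \<nu>(2)] True by (simp add: space_restrict_space)
    then show False using prob_space.not_empty[OF \<nu>(1)] by simp
  qed
  then show ?thesis by simp
next
  case False
  interpret shift_potential \<A> X \<Phi>
    by unfold_locales (use assms False in auto)
  show ?thesis
    using weak_Gibbs_of_decoupling weak_Gibbs_of_one_decoupling by (auto simp: M1T_def)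
qed

end
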